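(* Let $\lambda\in\mathcal{P}^0(n)$, $\mu\in\mathcal{P}^0(m)$ and $T\in SDT(\lambda)$, $U\in SDT(\mu)$. For $I\subset\{0\}\cup[n+m-1]$ let $D^B_I$ be the set of signed permutations $\pi$ with $Des(\pi)=I$ and $\Delta^B_I$ the set of standard domino tableaux with descent set $I$. Then \begin{equation} \sum_{\nu \in \mathcal{P}^0(n+m)}c^{\nu^-}_{\lambda^-\mu^-}c^{\nu^+}_{\lambda^+\mu^+}|SDT(\nu) \cap \Delta^B_I| = \left|\left(C^B_T \sqcup\!\sqcup\, C^B_U \right) \cap D^B_I\right|. \end{equation}
   Context: $B_n$ is the hyperoctahedral group of signed permutations of $\{-n,\dots,n\}$ with $\pi(-i)=-\pi(i)$; the descent set of $\pi\in B_n$ is $Des(\pi)=\{0\le i\le n-1 : \pi(i)>\pi(i+1)\}$ (with $\pi(0)=0$), and $tc(\pi)=|\{i\ge1:\pi(i)<0\}|$. $\mathcal{P}^0(n)$ is the set of partitions of $2n$ with empty $2$-core (those tileable by dominoes). A standard domino tableau of shape $\lambda$ is a domino tiling of the Young diagram of $\lambda$ with dominoes labelled by $[n]$, increasing along rows and down columns; $SDT(\lambda)$ is the set of them. Its descent set contains $i>0$ if $i+1$ lies strictly below $i$, and $0$ if the domino labelled $1$ is vertical; its spin $sp(T)$ is half the number of vertical dominoes. $(\lambda^-,\lambda^+)$ is the $2$-quotient of $\lambda$, and $c^\nu_{\lambda\mu}$ are the Littlewood–Richardson coefficients ($s_\lambda s_\mu=\sum_\nu c^\nu_{\lambda\mu}s_\nu$).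 For a standard domino tableau $T$ of shape $\lambda$, $C^B_T$ is a class of signed permutations such that every $\pi\in C^B_T$ has $Des(\pi^{-1})=Des(T)$ and there is a descent preserving bijection $C^B_T\to SDT(\lambda)$, $\pi\mapsto U$, with $Des(U)=Des(\pi)$ and $tc(\pi)=sp(T)+sp(U)$ (its existence follows from the type B Cauchy identity for Chow's quasisymmetric functions, equivalently from the Barbash–Vogan domino insertion). For $\alpha\in B_n$, $\beta\in B_m$, $\alpha\sqcup\!\sqcup\,\beta$ is the set of signed permutations in $B_{n+m}$ obtained by shuffling the letters $\alpha(1)\cdots\alpha(n)$ with those of $\beta$ after shifting their absolute values by $n$ (keeping signs), preserving relative order within each word; for sets, take all such shuffles. *)

theory Defs
  imports Complex_Main "HOL-Library.Multiset" "HOL-Combinatorics.Permutations"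
begin

section \<open>Partitions and Young diagrams\<close>

definition partitions :: "nat \<Rightarrow> nat list set" where
  "partitions n = {lam. sorted_wrt (\<ge>) lam \<and> 0 \<notin> set lam \<and> sum_list lam = n}"

definition is_partition :: "nat list \<Rightarrow> bool" where
  "is_partition lam \<longleftrightarrow> lam \<in> partitions (sum_list lam)"

text \<open>Cells are pairs (row, column), both counted from 0; rows grow downwards.\<close>

definition diagram :: "nat list \<Rightarrow> (nat \<times> nat) set" where
  "diagram lam = {(r, c). r < length lam \<and> c < lam ! r}"

definition is_domino :: "(nat \<times> nat) set \<Rightarrow> bool" where
  "is_domino D \<longleftrightarrow> (\<exists>r c. D = {(r, c), (r, Suc c)} \<or> D = {(r, c), (Suc r, c)})"


section \<open>2-core and 2-quotient\<close>

definition removes_domino :: "nat list \<Rightarrow> nat list \<Rightarrow> bool" where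
  "removes_domino lam mu \<longleftrightarrow> is_partition lam \<and> is_partition mu \<and>
     diagram mu \<subseteq> diagram lam \<and> is_domino (diagram lam - diagram mu)"

definition is_two_core_of :: "nat list \<Rightarrow> nat list \<Rightarrow> bool" where
  "is_two_core_of kap lam \<longleftrightarrow> removes_domino\<^sup>*\<^sup>* lam kap \<and> \<not> (\<exists>mu. removes_domino kap mu)"

definition P0 :: "nat \<Rightarrow> nat list set" where
  "P0 n = {lam \<in> partitions (2 * n). is_two_core_of [] lam}"

text \<open>The 2-quotient is read off the 2-abacus: from the beta numbers
  \<open>lam\<^sub>i + N - i\<close> (\<open>i = 1, \<dots>, N\<close>), the beads on the even and on the odd runner
  give one partition each.  The number \<open>N\<close> of beads is taken even, so that the order of
  the two components is the same for all partitions; the horizontal domino \<open>[2]\<close> has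
  quotient \<open>([], [1])\<close> and the vertical domino \<open>[1,1]\<close> has quotient \<open>([1], [])\<close>.
  Equivalently, with the cells of the diagram coloured alternately by minus and plus, minus
  in the top left corner, each domino of a tiling contributes one cell to the component
  given by the colour of its top right cell.\<close>

definition beta_set :: "nat list \<Rightarrow> nat set" where
  "beta_set lam = (let N = 2 * length lam in
     {(if i < length lam then lam ! i else 0) + (N - Suc i) |i. i < N})"

definition partition_of_beads :: "nat set \<Rightarrow> nat list" where
  "partition_of_beads B =
     filter (\<lambda>k. 0 < k) (map (\<lambda>b. card ({..<b} - B)) (rev (sorted_list_of_set B)))"

definition quot_minus :: "nat list \<Rightarrow> nat list" where
  "quot_minus lam = partition_of_beads {b. 2 * b \<in> beta_set lam}"

definition quot_plus :: "nat list \<Rightarrow> nat list" where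
  "quot_plus lam = partition_of_beads {b. 2 * b + 1 \<in> beta_set lam}"


section \<open>Schur functions and Littlewood--Richardson coefficients\<close>

text \<open>Fillings are functions on all cells, set to 0 outside the diagram.  In a semistandard
  tableau the entry \<open>k\<close> stands for the variable \<open>x\<^sub>k\<close>, where the variables are
  \<open>x\<^sub>0, x\<^sub>1, \<dots>\<close>; thus 0 is also a legitimate entry.\<close>

definition SSYT :: "nat list \<Rightarrow> (nat \<times> nat \<Rightarrow> nat) set" where
  "SSYT lam = {T.
     (\<forall>x. x \<notin> diagram lam \<longrightarrow> T x = 0) \<and>
     (\<forall>r c. (r, Suc c) \<in> diagram lam \<longrightarrow> T (r, c) \<le> T (r, Suc c)) \<and>
     (\<forall>r c. (Suc r, c) \<in> diagram lam \<longrightarrow> T (r, c) < T (Suc r, c))}"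

text \<open>A formal power series in \<open>x\<^sub>0, x\<^sub>1, \<dots>\<close> is given by its coefficients; a monomial
  is the multiset of the indices of its variables, so that the product of monomials is the
  sum of multisets.\<close>

type_synonym series = "nat multiset \<Rightarrow> int"

definition series_mult :: "series \<Rightarrow> series \<Rightarrow> series" where
  "series_mult f g = (\<lambda>M. \<Sum>A | A \<subseteq># M. f A * g (M - A))"

definition schur :: "nat list \<Rightarrow> series" where
  "schur lam = (\<lambda>M. int (card {T \<in> SSYT lam. image_mset T (mset_set (diagram lam)) = M}))"

text \<open>\<open>lr_coeff lam mu nu\<close> is the coefficient of \<open>schur nu\<close> in the expansion of the product
  of \<open>schur lam\<close> and \<open>schur mu\<close>.  By homogeneity only partitions of
  \<open>sum_list lam + sum_list mu\<close> occur, and the coefficients are unique because Schur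
  functions are linearly independent.\<close>

definition lr_coeff :: "nat list \<Rightarrow> nat list \<Rightarrow> nat list \<Rightarrow> int" where
  "lr_coeff lam mu = (THE c.
     (\<forall>nu. nu \<notin> partitions (sum_list lam + sum_list mu) \<longrightarrow> c nu = 0) \<and>
     series_mult (schur lam) (schur mu) =
       (\<lambda>M. \<Sum>nu\<in>partitions (sum_list lam + sum_list mu). c nu * schur nu M))"


section \<open>Standard domino tableaux\<close>

text \<open>A tableau assigns to each cell the label of the domino covering it.  The two cells of
  a domino carry the same label and different dominoes carry different labels, so labels
  increase from domino to domino exactly if the cell entries increase weakly.\<close>

definition SDT :: "nat list \<Rightarrow> (nat \<times> nat \<Rightarrow> nat) set" where
  "SDT lam = {T.
     (\<forall>x. x \<notin> diagram lam \<longrightarrow> T x = 0) \<and>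
     (\<forall>x\<in>diagram lam. T x \<in> {1..sum_list lam div 2}) \<and>
     (\<forall>i\<in>{1..sum_list lam div 2}. is_domino {x. T x = i}) \<and>
     (\<forall>r c. (r, Suc c) \<in> diagram lam \<longrightarrow> T (r, c) \<le> T (r, Suc c)) \<and>
     (\<forall>r c. (Suc r, c) \<in> diagram lam \<longrightarrow> T (r, c) \<le> T (Suc r, c))}"

definition vertical :: "(nat \<times> nat \<Rightarrow> nat) \<Rightarrow> nat \<Rightarrow> bool" where
  "vertical T i \<longleftrightarrow> (\<exists>r c. T (r, c) = i \<and> T (Suc r, c) = i)"

text \<open>The first argument is the number of dominoes.\<close>

definition DesT :: "nat \<Rightarrow> (nat \<times> nat \<Rightarrow> nat) \<Rightarrow> nat set" where
  "DesT n T =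
     {i. 0 < i \<and> i < n \<and> (\<forall>x y. T x = i \<and> T y = Suc i \<longrightarrow> fst x < fst y)} \<union>
     {i. i = 0 \<and> 0 < n \<and> vertical T 1}"

definition spin :: "nat \<Rightarrow> (nat \<times> nat \<Rightarrow> nat) \<Rightarrow> rat" where
  "spin n T = of_nat (card {i \<in> {1..n}. vertical T i}) / 2"

definition Delta_B :: "nat \<Rightarrow> nat set \<Rightarrow> (nat \<times> nat \<Rightarrow> nat) set" where
  "Delta_B n I = {T. (\<exists>lam\<in>P0 n. T \<in> SDT lam) \<and> DesT n T = I}"


section \<open>Signed permutations\<close>

definition signed_perms :: "nat \<Rightarrow> (int \<Rightarrow> int) set" where
  "signed_perms n = {p. p permutes {- int n..int n} \<and> (\<forall>i. p (- i) = - p i)}"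

definition Des :: "nat \<Rightarrow> (int \<Rightarrow> int) \<Rightarrow> nat set" where
  "Des n p = {i. i < n \<and> p (int i) > p (int i + 1)}"

definition tc :: "nat \<Rightarrow> (int \<Rightarrow> int) \<Rightarrow> nat" where
  "tc n p = card {i \<in> {1..int n}. p i < 0}"

definition D_B :: "nat \<Rightarrow> nat set \<Rightarrow> (int \<Rightarrow> int) set" where
  "D_B n I = {p \<in> signed_perms n. Des n p = I}"

definition word :: "nat \<Rightarrow> (int \<Rightarrow> int) \<Rightarrow> int list" where
  "word n p = map p [1..int n]"

definition shift_letter :: "nat \<Rightarrow> int \<Rightarrow> int" where
  "shift_letter n x = sgn x * (\<bar>x\<bar> + int n)"

definition signed_shuffle :: "nat \<Rightarrow> nat \<Rightarrow> (int \<Rightarrow> int) \<Rightarrow> (int \<Rightarrow> int) \<Rightarrow> (int \<Rightarrow> int) set" where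
  "signed_shuffle n m a b = {p \<in> signed_perms (n + m).
     word (n + m) p \<in> shuffles (word n a) (map (shift_letter n) (word m b))}"

definition signed_shuffle_sets ::
  "nat \<Rightarrow> nat \<Rightarrow> (int \<Rightarrow> int) set \<Rightarrow> (int \<Rightarrow> int) set \<Rightarrow> (int \<Rightarrow> int) set" where
  "signed_shuffle_sets n m A B = (\<Union>a\<in>A. \<Union>b\<in>B. signed_shuffle n m a b)"

text \<open>The defining properties of a class of signed permutations attached to a standard domino
  tableau \<open>T\<close> of shape \<open>lam\<close> with \<open>n\<close> dominoes.  They do not determine the class uniquely.\<close>

definition is_CB_class :: "nat \<Rightarrow> nat list \<Rightarrow> (nat \<times> nat \<Rightarrow> nat) \<Rightarrow> (int \<Rightarrow> int) set \<Rightarrow> bool" where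
  "is_CB_class n lam T C \<longleftrightarrow>
     C \<subseteq> signed_perms n \<and>
     (\<forall>p\<in>C. Des n (inv p) = DesT n T) \<and>
     (\<exists>f. bij_betw f C (SDT lam) \<and>
       (\<forall>p\<in>C. DesT n (f p) = Des n p \<and> of_nat (tc n p) = spin n T + spin n (f p)))"

end

theory Submission
  imports Defs "HOL-Library.Product_Lexorder"
begin

text \<open>Recording the starting positions of the beads moved on the 2-abacus turns a standard domino
  tableau into an integer word, with the descents of the tableau becoming the descents of the word
  (the first letter being compared with the threshold \<open>-2\<close>).  The generating function of these
  words, in Chow's fundamental quasisymmetric functions, splits along the two runners of the abacus
  into \<open>G\<^sub>\<lambda> = s\<^bsub>\<lambda>\<^sup>-\<^esub>(x\<^sub>1, x\<^sub>2, \<dots>) s\<^bsub>\<lambda>\<^sup>+\<^esub>(x\<^sub>0, x\<^sub>1, \<dots>)\<close>, and the generating function of the signed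
  shuffles of two classes is \<open>G\<^sub>\<lambda> G\<^sub>\<mu>\<close>, because both the runner decomposition and the signed
  shuffle are shuffles of words in disjoint alphabets.  Expanding both Schur products gives
  \<open>G\<^sub>\<lambda> G\<^sub>\<mu> = \<Sum>\<^sub>\<nu> c c G\<^sub>\<nu>\<close>, and comparing coefficients at a monomial counts the tableaux and the
  permutations whose descent set is contained in a prescribed set.\<close>

section \<open>Products of series\<close>

text \<open>In the ground state \<open>{..<0}\<close> the bead that moves first stands at -1 for a
  horizontal domino and at -2 for a vertical one. The descent 0 marks the vertical case; with ties
  counted as descents this makes -2 the threshold. Position -1 of the abacus is place -1 of the odd
  runner and position -2 is place -1 of the even runner, so the boundary condition bites on the even
  runner only: the variable with index 0 disappears from the minus factor and stays in the plus
  factor.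

  A series depends on its words through lengths and descent sets alone. Hence an arbitrary class can
  be exchanged for the tableaux of its shape, whatever insertion procedure lies behind it.

  \<open>lr_coeff\<close> is a definite description, so its use requires that a product of Schur
  series has exactly one Schur expansion. Bender-Knuth involutions give symmetry; a symmetric series
  is fixed by its coefficients at monomials with partition exponents, and there the matrix of Schur
  coefficients is unitriangular.\<close>

lemma finite_submultisets: "finite {A. A \<subseteq># (M :: 'a multiset)}"
proof -
  have "{A. A \<subseteq># M} \<subseteq> mset ` {xs. set xs \<subseteq> set_mset M \<and> length xs \<le> size M}"
  proof
    fix A assume "A \<in> {A. A \<subseteq># M}"
    then have "A \<subseteq># M" by simp
    moreover obtain xs where "mset xs = A" using ex_mset by blast
    ultimately show "A \<in> mset ` {xs. set xs \<subseteq> set_mset M \<and> length xs \<le> size M}"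
      by (metis (mono_tags, lifting) image_eqI mem_Collect_eq set_mset_mono set_mset_mset size_mset size_mset_mono)
  qed
  then show ?thesis
    by (rule finite_subset) (simp add: finite_lists_length_le)
qed

text \<open>Summing over ordered factorisations of the monomial treats both factors alike, so
  commutativity, associativity and symmetry become reindexings.\<close>

lemma series_mult_eq_sum_pairs:
  "series_mult f g M = (\<Sum>(A, B) | A + B = M. f A * g B)"
proof -
  have "bij_betw (\<lambda>A. (A, M - A)) {A. A \<subseteq># M} {(A, B). A + B = M}"
    by (rule bij_betwI[where g = fst]) auto
  from sum.reindex_bij_betw[OF this, of "\<lambda>(A, B). f A * g B"] show ?thesis
    unfolding series_mult_def by (simp add: Collect_case_prod)
qed

lemma finite_add_pairs: "finite {(A, B). A + B = (M :: 'a multiset)}"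
proof -
  have "{(A, B). A + B = M} = (\<lambda>A. (A, M - A)) ` {A. A \<subseteq># M}"
    by (auto simp: image_iff)
  then show ?thesis using finite_submultisets[of M] by (metis finite_imageI)
qed

lemma series_mult_commute: "series_mult f g = series_mult g f"
proof
  fix M :: "nat multiset"
  have "bij_betw prod.swap {(A, B). A + B = M} {(A, B). A + B = M}"
    by (rule bij_betwI[where g = prod.swap]) (auto simp: add.commute)
  from sum.reindex_bij_betw[OF this, of "\<lambda>(A, B). g A * f B"]
  show "series_mult f g M = series_mult g f M"
    unfolding series_mult_eq_sum_pairs
    by (simp add: case_prod_unfold mult.commute)
qed

lemma series_mult_assoc:
  "series_mult (series_mult f g) h = series_mult f (series_mult g h)"
proof
  fix M
  have "series_mult (series_mult f g) h M =
    (\<Sum>(D, C) | D + C = M. \<Sum>(A, B) | A + B = D. f A * g B * h C)"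
    unfolding series_mult_eq_sum_pairs by (simp add: sum_distrib_right case_prod_unfold)
  also have "\<dots> = (\<Sum>((D, C), (A, B)) \<in> (SIGMA p:{(D, C). D + C = M}. {(A, B). A + B = fst p}). f A * g B * h C)"
    by (subst sum.Sigma[symmetric]) (auto simp: finite_add_pairs[unfolded case_prod_unfold] case_prod_unfold intro!: sum.cong)
  also have "\<dots> = (\<Sum>((A, D), (B, C)) \<in> (SIGMA p:{(A, D). A + D = M}. {(B, C). B + C = snd p}). f A * g B * h C)"
    by (rule sum.reindex_bij_witness[where i = "\<lambda>((A, D), (B, C)). ((A + B, C), (A, B))"
          and j = "\<lambda>((D, C), (A, B)). ((A, B + C), (B, C))"])
       (auto simp: add.assoc)
  also have "\<dots> = (\<Sum>(A, D) | A + D = M. \<Sum>(B, C) | B + C = D. f A * g B * h C)"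
    by (subst sum.Sigma[symmetric]) (auto simp: finite_add_pairs[unfolded case_prod_unfold] case_prod_unfold intro!: sum.cong)
  also have "\<dots> = series_mult f (series_mult g h) M"
    unfolding series_mult_eq_sum_pairs by (simp add: sum_distrib_left case_prod_unfold mult.assoc)
  finally show "series_mult (series_mult f g) h M = series_mult f (series_mult g h) M" .
qed

text \<open>Regroups the factors of two domino series: the minus components are multiplied with each
  other, and so are the plus components.\<close>

lemma series_mult_four:
  "series_mult (series_mult a b) (series_mult c d) = series_mult (series_mult a c) (series_mult b d)"
  by (metis series_mult_assoc series_mult_commute)

lemma series_mult_sums:
  assumes "finite A" "finite B"
  shows "series_mult (\<lambda>M. \<Sum>a\<in>A. c a * f a M) (\<lambda>M. \<Sum>b\<in>B. d b * g b M) =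
    (\<lambda>M. \<Sum>a\<in>A. \<Sum>b\<in>B. c a * d b * series_mult (f a) (g b) M)"
proof
  fix M
  have "series_mult (\<lambda>M. \<Sum>a\<in>A. c a * f a M) (\<lambda>M. \<Sum>b\<in>B. d b * g b M) M =
    (\<Sum>X | X \<subseteq># M. \<Sum>a\<in>A. \<Sum>b\<in>B. c a * d b * (f a X * g b (M - X)))"
    unfolding series_mult_def sum_product by (simp add: algebra_simps)
  also have "\<dots> = (\<Sum>a\<in>A. \<Sum>X | X \<subseteq># M. \<Sum>b\<in>B. c a * d b * (f a X * g b (M - X)))"
    by (rule sum.swap)
  also have "\<dots> = (\<Sum>a\<in>A. \<Sum>b\<in>B. \<Sum>X | X \<subseteq># M. c a * d b * (f a X * g b (M - X)))"
    by (intro sum.cong refl sum.swap)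
  finally show "series_mult (\<lambda>M. \<Sum>a\<in>A. c a * f a M) (\<lambda>M. \<Sum>b\<in>B. d b * g b M) M =
    (\<Sum>a\<in>A. \<Sum>b\<in>B. c a * d b * series_mult (f a) (g b) M)"
    by (simp add: series_mult_def sum_distrib_left)
qed

text \<open>The specialisation of the variable with index 0 to the value 0, in terms of
  coefficients.\<close>

definition drop_zero :: "series \<Rightarrow> series" where
  "drop_zero f M = (if 0 \<in># M then 0 else f M)"

text \<open>Setting a variable to 0 is multiplicative, because 0 occurs in \<open>A + B\<close> iff
  it occurs in \<open>A\<close> or in \<open>B\<close>.\<close>

lemma series_mult_drop_zero:
  "series_mult (drop_zero f) (drop_zero g) = drop_zero (series_mult f g)"
proof
  fix M
  show "series_mult (drop_zero f) (drop_zero g) M = drop_zero (series_mult f g) M"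
  proof (cases "0 \<in># M")
    case True
    then have "drop_zero f A * drop_zero g B = 0" if "A + B = M" for A B
      using that by (auto simp: drop_zero_def)
    then show ?thesis using True
      unfolding series_mult_eq_sum_pairs drop_zero_def[of "\<lambda>M. \<Sum>(A, B) | A + B = M. f A * g B"]
      by (auto simp: drop_zero_def intro!: sum.neutral)
  next
    case False
    then show ?thesis
      unfolding series_mult_eq_sum_pairs drop_zero_def
      by (auto intro!: sum.cong)
  qed
qed


section \<open>Generating functions of words\<close>

text \<open>A biword pairs the letters of a word with the indices of the variables of a monomial.  With
  \<open>Z x \<longleftrightarrow> t < x\<close>, a word of the right length occurs in a biword for \<open>M\<close> exactly if its descents,
  relative to the threshold \<open>t\<close>, are among the places where the indices in \<open>M\<close> increase; so
  \<open>words_series\<close> is a sum of Chow's fundamental quasisymmetric functions.\<close>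

definition biword :: "('a::linorder \<Rightarrow> bool) \<Rightarrow> nat multiset \<Rightarrow> (nat \<times> 'a) list \<Rightarrow> bool" where
  "biword Z M zs \<longleftrightarrow> sorted_wrt (<) zs \<and> mset (map fst zs) = M \<and> (\<forall>(a, x)\<in>set zs. a = 0 \<longrightarrow> Z x)"

definition words_series :: "('a::linorder \<Rightarrow> bool) \<Rightarrow> 'a list set \<Rightarrow> series" where
  "words_series Z W M = int (card {zs. biword Z M zs \<and> map snd zs \<in> W})"

text \<open>Lexicographic increase forces weak increase of the first components. The monomial thus
  fixes the upper row, and a biword amounts to its lower word.\<close>

lemma biword_fst: "biword Z M zs \<Longrightarrow> map fst zs = sorted_list_of_multiset M"
proof -
  assume "biword Z M zs"
  then have "sorted_wrt (<) zs" and M: "mset (map fst zs) = M" by (auto simp: biword_def)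
  then have "sorted_wrt (\<lambda>x y. fst x \<le> fst y) zs"
    by (elim sorted_wrt_mono_rel[rotated]) (auto simp: less_prod_def)
  then have "sorted (map fst zs)" by (simp add: sorted_wrt_map)
  then show ?thesis using M by (metis sorted_list_of_multiset_mset sort_key_id_if_sorted sorted_sort_id)
qed

lemma words_series_eq_card:
  "words_series Z W M = int (card {w \<in> W. length w = size M \<and> biword Z M (zip (sorted_list_of_multiset M) w)})"
proof -
  have len: "length (sorted_list_of_multiset M) = size M" for M :: "nat multiset"
    by (metis mset_sorted_list_of_multiset size_mset)
  have "bij_betw (map snd) {zs. biword Z M zs \<and> map snd zs \<in> W}
    {w \<in> W. length w = size M \<and> biword Z M (zip (sorted_list_of_multiset M) w)}"
  proof (rule bij_betwI[where g = "zip (sorted_list_of_multiset M)"])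
    show "map snd \<in> {zs. biword Z M zs \<and> map snd zs \<in> W} \<rightarrow>
        {w \<in> W. length w = size M \<and> biword Z M (zip (sorted_list_of_multiset M) w)}"
    proof
      fix zs assume "zs \<in> {zs. biword Z M zs \<and> map snd zs \<in> W}"
      then have *: "biword Z M zs" "map snd zs \<in> W" by auto
      have e: "zip (sorted_list_of_multiset M) (map snd zs) = zs"
        using biword_fst[OF *(1)] by (metis zip_map_fst_snd)
      have "length zs = size M" using *(1) unfolding biword_def
        by (metis length_map size_mset)
      then show "map snd zs \<in> {w \<in> W. length w = size M \<and> biword Z M (zip (sorted_list_of_multiset M) w)}"
        using * e by simp
    qed
    show "zip (sorted_list_of_multiset M) \<in> {w \<in> W. length w = size M \<and> biword Z M (zip (sorted_list_of_multiset M) w)}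
      \<rightarrow> {zs. biword Z M zs \<and> map snd zs \<in> W}"
      using len by auto
    show "zip (sorted_list_of_multiset M) (map snd zs) = zs" if "zs \<in> {zs. biword Z M zs \<and> map snd zs \<in> W}" for zs
      using that biword_fst[of Z M zs] by (metis (mono_tags, lifting) mem_Collect_eq zip_map_fst_snd)
    show "map snd (zip (sorted_list_of_multiset M) w) = w"
      if "w \<in> {w \<in> W. length w = size M \<and> biword Z M (zip (sorted_list_of_multiset M) w)}" for w
      using that len by auto
  qed
  then show ?thesis unfolding words_series_def by (simp add: bij_betw_same_card)
qed

text \<open>A biword is a finite set of pairs listed in increasing order. Splitting this set by the
  alphabet of the second component is undone by sorting the union, and the boundary condition
  concerns single pairs, so it splits too. The words on the left are all shuffles of a word of
  \<open>U\<close> with a word of \<open>V\<close>.\<close>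

lemma words_series_shuffle:
  assumes fin: "finite U" "finite V"
    and U: "\<And>u. u \<in> U \<Longrightarrow> \<forall>x\<in>set u. X x" and V: "\<And>v. v \<in> V \<Longrightarrow> \<forall>x\<in>set v. \<not> X x"
  shows "words_series Z {w. filter X w \<in> U \<and> filter (\<lambda>x. \<not> X x) w \<in> V} =
    series_mult (words_series Z U) (words_series Z V)"
proof
  fix M
  let ?W = "{w. filter X w \<in> U \<and> filter (\<lambda>x. \<not> X x) w \<in> V}"
  define S where "S = (\<lambda>(W :: 'a list set) M. {zs. biword Z M zs \<and> map snd zs \<in> W})"
  have S_fin: "finite (S W M)" if "finite W" for W M
  proof -
    have "S W M \<subseteq> zip (sorted_list_of_multiset M) ` W"
      unfolding S_def using biword_fst by (smt (verit) image_iff mem_Collect_eq subsetI zip_map_fst_snd)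
    then show ?thesis using that finite_surj by blast
  qed
  let ?p = "\<lambda>z :: nat \<times> 'a. X (snd z)"
  let ?q = "\<lambda>z :: nat \<times> 'a. \<not> X (snd z)"
  \<comment> \<open>Each pair of biwords carries the factorisation of the monomial, so counting
    \<open>?R\<close> yields the convolution sum.\<close>
  let ?R = "SIGMA p:{(A, B). A + B = M}. S U (fst p) \<times> S V (snd p)"
  have flt: "map snd (filter ?p zs) = filter X (map snd zs)"
    "map snd (filter ?q zs) = filter (\<lambda>x. \<not> X x) (map snd zs)" for zs :: "(nat \<times> 'a) list"
    by (simp_all add: filter_map o_def)
  have srt: "sort (filter ?p zs @ filter ?q zs) = zs" if "sorted_wrt (<) zs" for zs :: "(nat \<times> 'a) list"
  proof -
    have "mset (filter ?p zs @ filter ?q zs) = mset zs"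
      by (metis mset_append mset_filter multiset_partition)
    moreover have "sorted zs" using that strict_sorted_imp_sorted by blast
    ultimately show ?thesis by (metis properties_for_sort)
  qed
  let ?F = "\<lambda>zs. ((mset (map fst (filter ?p zs)), mset (map fst (filter ?q zs))), (filter ?p zs, filter ?q zs))"
  have "bij_betw ?F
     (S ?W M) ?R"
  proof (rule bij_betwI[where g = "\<lambda>(_, us, vs). sort (us @ vs)"])
    show "?F
      \<in> S ?W M \<rightarrow> ?R"
    proof
      fix zs assume "zs \<in> S ?W M"
      then have *: "sorted_wrt (<) zs" "mset (map fst zs) = M" "\<forall>(a, x)\<in>set zs. a = 0 \<longrightarrow> Z x"
        "filter X (map snd zs) \<in> U" "filter (\<lambda>x. \<not> X x) (map snd zs) \<in> V"
        by (auto simp: S_def biword_def)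
      have "mset (map fst (filter ?p zs)) + mset (map fst (filter ?q zs)) = M"
        using *(2) by (simp flip: image_mset_union multiset_partition)
      then show "((mset (map fst (filter ?p zs)), mset (map fst (filter ?q zs))), (filter ?p zs, filter ?q zs)) \<in> ?R"
        using * flt by (auto simp: S_def biword_def sorted_wrt_filter)
    qed
    show "(\<lambda>(_, us, vs). sort (us @ vs)) \<in> ?R \<rightarrow> S ?W M"
    proof
      fix y assume y: "y \<in> ?R"
      obtain A B us vs where yy: "y = ((A, B), us, vs)" by (metis surj_pair)
      with y have M: "M = A + B" by auto
      from y yy have *: "sorted_wrt (<) us" "mset (map fst us) = A" "\<forall>(a, x)\<in>set us. a = 0 \<longrightarrow> Z x" "map snd us \<in> U"
        "sorted_wrt (<) vs" "mset (map fst vs) = B" "\<forall>(a, x)\<in>set vs. a = 0 \<longrightarrow> Z x" "map snd vs \<in> V"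
        by (auto simp: S_def biword_def)
      have X: "\<forall>z\<in>set us. X (snd z)" "\<forall>z\<in>set vs. \<not> X (snd z)" using U[OF *(4)] V[OF *(8)] by auto
      \<comment> \<open>Disjointness of the alphabets enters here: no pair occurs on both sides, so
        the merged list increases strictly.\<close>
      then have "distinct (us @ vs)" using *(1,5) by (auto simp: strict_sorted_iff)
      then have st: "sorted_wrt (<) (sort (us @ vs))" by (simp add: strict_sorted_iff)
      have fp: "filter ?p (sort (us @ vs)) = us" "filter ?q (sort (us @ vs)) = vs"
        using X *(1,5) by (simp_all add: filter_sort strict_sorted_iff sorted_sort_id)
      have ms: "mset (map fst (sort (us @ vs))) = A + B" using *(2,6) by simp
      have z: "\<forall>(a, x)\<in>set (sort (us @ vs)). a = 0 \<longrightarrow> Z x" using *(3,7) by auto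
      show "(\<lambda>(_, us, vs). sort (us @ vs)) y \<in> S ?W M"
        using st ms z fp *(4,8) flt[of "sort (us @ vs)"]
        by (simp add: S_def biword_def M yy)
    qed
    show "(\<lambda>(_, us, vs). sort (us @ vs)) (?F zs) = zs" if "zs \<in> S ?W M" for zs
      using that srt by (simp add: S_def biword_def)
    show "?F ((\<lambda>(_, us, vs). sort (us @ vs)) y) = y"
      if "y \<in> ?R" for y
    proof -
      obtain A B us vs where y: "y = ((A, B), us, vs)" by (metis surj_pair)
      with that have *: "sorted_wrt (<) us" "mset (map fst us) = A" "map snd us \<in> U"
        "sorted_wrt (<) vs" "mset (map fst vs) = B" "map snd vs \<in> V"
        by (auto simp: S_def biword_def)
      have X: "\<forall>z\<in>set us. X (snd z)" "\<forall>z\<in>set vs. \<not> X (snd z)" using U[OF *(3)] V[OF *(6)] by auto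
      have fp: "filter ?p (sort (us @ vs)) = us" "filter ?q (sort (us @ vs)) = vs"
        using X *(1,4) by (simp_all add: filter_sort strict_sorted_iff sorted_sort_id)
      show ?thesis using fp *(2,5) by (simp add: y Let_def)
    qed
  qed
  then have "card (S ?W M) = card ?R" by (rule bij_betw_same_card)
  also have "\<dots> = (\<Sum>p\<in>{(A, B). A + B = M}. card (S U (fst p)) * card (S V (snd p)))"
    using finite_add_pairs S_fin fin by (subst card_SigmaI) (auto simp: card_cartesian_product)
  finally show "words_series Z ?W M = series_mult (words_series Z U) (words_series Z V) M"
    unfolding series_mult_eq_sum_pairs words_series_def S_def by (simp add: case_prod_unfold)
qed

text \<open>A monotone relabelling keeps the lexicographic order of pairs; what remains is to pull
  back the boundary predicate.\<close>

lemma words_series_map_strict_mono: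
  assumes "strict_mono f"
  shows "words_series Z (map f ` W) = words_series (\<lambda>x. Z (f x)) W"
proof
  fix M
  have inj: "inj (map f)" using assms by (simp add: strict_mono_imp_inj_on)
  have "zip a (map f w) = map (map_prod id f) (zip a w)" for a :: "nat list" and w
    by (simp add: zip_map2 map_prod_def)
  moreover have "biword Z M (map (map_prod id f) zs) \<longleftrightarrow> biword (\<lambda>x. Z (f x)) M zs" for zs
    using strict_mono_less[OF assms]
    by (simp add: biword_def sorted_wrt_map less_prod_def[abs_def] map_prod_def case_prod_unfold o_def)
  ultimately have "{w \<in> map f ` W. length w = size M \<and> biword Z M (zip (sorted_list_of_multiset M) w)}
    = map f ` {w \<in> W. length w = size M \<and> biword (\<lambda>x. Z (f x)) M (zip (sorted_list_of_multiset M) w)}"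
    by auto
  then show "words_series Z (map f ` W) M = words_series (\<lambda>x. Z (f x)) W M"
    unfolding words_series_eq_card
    by (simp only: card_image[OF inj_on_subset[OF inj subset_UNIV]])
qed


section \<open>Descents of words and the coefficients of their series\<close>

definition word_Des :: "'a::linorder \<Rightarrow> 'a list \<Rightarrow> nat set" where
  "word_Des t w = {i. i < length w \<and> (t # w) ! i \<ge> (t # w) ! Suc i}"

text \<open>The prepended 0 has the effect that, for a nonempty monomial, 0 is a cut iff the
  variable with index 0 does not occur.\<close>

definition cuts :: "nat multiset \<Rightarrow> nat set" where
  "cuts M = {i. i < size M \<and> (0 # sorted_list_of_multiset M) ! i < (0 # sorted_list_of_multiset M) ! Suc i}"

text \<open>Prepending the pair \<open>(0, t)\<close> makes the boundary condition one more
  comparison of neighbours: \<open>(0, t) < (a, x)\<close> says that \<open>a\<close> is positive or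
  \<open>t < x\<close>. By transitivity neighbours suffice, and where the indices agree the letters
  must rise strictly; hence descents are weak in \<open>word_Des\<close>.\<close>

lemma biword_iff_word_Des:
  fixes t :: "'a::linorder"
  assumes "length w = size M"
  shows "biword (\<lambda>x. t < x) M (zip (sorted_list_of_multiset M) w) \<longleftrightarrow> word_Des t w \<subseteq> cuts M"
proof -
  let ?a = "sorted_list_of_multiset M"
  have len: "length ?a = size M" by (metis mset_sorted_list_of_multiset size_mset)
  let ?z = "zip (0 # ?a) (t # w)"
  have "sorted (0 # ?a)" by simp
  have "biword (\<lambda>x. t < x) M (zip ?a w) \<longleftrightarrow> sorted_wrt (<) ?z"
  proof -
    have "(\<forall>(a, x)\<in>set (zip ?a w). a = 0 \<longrightarrow> t < x) \<longleftrightarrow> (\<forall>y\<in>set (zip ?a w). (0, t) < y)"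
      by (auto simp: less_prod_def)
    moreover have "mset (map fst (zip ?a w)) = M" using len assms by simp
    ultimately show ?thesis unfolding biword_def by auto
  qed
  also have "\<dots> \<longleftrightarrow> (\<forall>i. Suc i < length ?z \<longrightarrow> ?z ! i < ?z ! Suc i)"
    by (rule sorted_wrt_iff_nth_Suc_transp) (auto simp: transp_on_def)
  also have "\<dots> \<longleftrightarrow> (\<forall>i<size M. ((0 # ?a) ! i, (t # w) ! i) < ((0 # ?a) ! Suc i, (t # w) ! Suc i))"
    using assms len by (auto simp del: nth_Cons_Suc zip_Cons_Cons)
  also have "\<dots> \<longleftrightarrow> word_Des t w \<subseteq> cuts M"
  proof -
    have "(0 # ?a) ! i \<le> (0 # ?a) ! Suc i" if "i < size M" for i
      using sorted_nth_mono[OF \<open>sorted (0 # ?a)\<close>, of i "Suc i"] that len by (simp del: nth_Cons_Suc)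
    then show ?thesis unfolding word_Des_def cuts_def using assms
      by (auto simp del: nth_Cons_Suc simp: less_prod_def not_less)
  qed
  finally show ?thesis .
qed

lemma words_series_eq_card_Des:
  fixes t :: "'a::linorder"
  shows "words_series (\<lambda>x. t < x) W M = int (card {w \<in> W. length w = size M \<and> word_Des t w \<subseteq> cuts M})"
  unfolding words_series_eq_card using biword_iff_word_Des by (metis (lifting))

text \<open>Length and descent set are all that matters, so the two sides may live over different
  alphabets with different thresholds. This links signed permutations (threshold 0) to bead words
  (threshold -2).\<close>

lemma words_series_cong_Des:
  fixes t :: "'a::linorder" and t' :: "'b::linorder"
  assumes "bij_betw f U V" and "\<And>u. u \<in> U \<Longrightarrow> length (f u) = length u \<and> word_Des t' (f u) = word_Des t u"
  shows "words_series (\<lambda>x. t < x) U = words_series (\<lambda>x. t' < x) V"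
proof
  fix M
  have "f ` {w \<in> U. length w = size M \<and> word_Des t w \<subseteq> cuts M} = {w \<in> V. length w = size M \<and> word_Des t' w \<subseteq> cuts M}"
    using assms by (auto simp: bij_betw_def)
  then have "bij_betw f {w \<in> U. length w = size M \<and> word_Des t w \<subseteq> cuts M}
     {w \<in> V. length w = size M \<and> word_Des t' w \<subseteq> cuts M}"
    by (intro bij_betw_subset[OF assms(1)]) auto
  then show "words_series (\<lambda>x. t < x) U M = words_series (\<lambda>x. t' < x) V M"
    unfolding words_series_eq_card_Des by (simp add: bij_betw_same_card)
qed

lemma ex_cuts:
  assumes "I \<subseteq> {..<N}"
  shows "\<exists>M. size M = N \<and> cuts M = I"
proof -
  have finI: "finite I" using assms finite_subset by blast
  \<comment> \<open>The index at place \<open>i\<close> is the number of elements of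
    \<open>I\<close> up to \<open>i\<close>; started from 0, this sequence goes up exactly at the
    elements of \<open>I\<close>.\<close>
  let ?a = "map (\<lambda>i. card (I \<inter> {..i})) [0..<N]"
  have "sorted ?a" by (auto simp: sorted_iff_nth_mono intro!: card_mono)
  then have s: "sorted_list_of_multiset (mset ?a) = ?a"
    by (metis sorted_list_of_multiset_mset sorted_sort_id)
  have step: "(0 # ?a) ! i < (0 # ?a) ! Suc i \<longleftrightarrow> i \<in> I" if "i < N" for i
  proof -
    have "(0 # ?a) ! i = card (I \<inter> {..<i})" using that by (cases i) (auto simp: lessThan_Suc_atMost)
    moreover have "(0 # ?a) ! Suc i = card (I \<inter> {..i})" using that by simp
    moreover have "I \<inter> {..i} = (if i \<in> I then insert i (I \<inter> {..<i}) else I \<inter> {..<i})"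
      using order_le_less by auto
    ultimately show ?thesis by auto
  qed
  have "cuts (mset ?a) = {i. i < N \<and> (0 # ?a) ! i < (0 # ?a) ! Suc i}"
    unfolding cuts_def s by simp
  also have "\<dots> = I" using step assms by blast
  finally show ?thesis by (intro exI[of _ "mset ?a"]) simp
qed

text \<open>Inversion on the Boolean lattice, without signs: by induction the proper subsets
  contribute equally, which leaves the term of the full set.\<close>

lemma eq_if_subset_sums_eq:
  fixes f g :: "'a set \<Rightarrow> 'b::ab_group_add"
  assumes "finite I" and "\<And>J. J \<subseteq> I \<Longrightarrow> (\<Sum>K\<in>Pow J. f K) = (\<Sum>K\<in>Pow J. g K)"
  shows "f I = g I"
  using assms
proof (induction I rule: finite_psubset_induct)
  case (psubset I)
  have "f K = g K" if "K \<subset> I" for K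
    using psubset.IH[OF that] psubset.prems that by (meson psubset_imp_subset subset_trans)
  then have "(\<Sum>K\<in>Pow I - {I}. f K) = (\<Sum>K\<in>Pow I - {I}. g K)" by (intro sum.cong) auto
  moreover have "(\<Sum>K\<in>Pow I. f K) = f I + (\<Sum>K\<in>Pow I - {I}. f K)" for f :: "'a set \<Rightarrow> 'b"
    using psubset.hyps by (intro sum.remove) auto
  ultimately show ?case using psubset.prems[of I] by simp
qed


section \<open>Partitions as row functions\<close>

text \<open>Padding with zeros makes shapes with different numbers of rows comparable as total
  functions.\<close>

definition row :: "nat list \<Rightarrow> nat \<Rightarrow> nat" where
  "row lam i = (if i < length lam then lam ! i else 0)"

lemma diagram_row: "diagram lam = {(r, c). c < row lam r}"
  by (auto simp: diagram_def row_def split: if_splits)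

lemma mem_diagram [simp]: "(r, c) \<in> diagram lam \<longleftrightarrow> c < row lam r"
  by (simp add: diagram_row)

lemma is_partition_iff: "is_partition lam \<longleftrightarrow> sorted_wrt (\<ge>) lam \<and> 0 \<notin> set lam"
  by (simp add: is_partition_def partitions_def)

lemma partitions_iff: "lam \<in> partitions n \<longleftrightarrow> is_partition lam \<and> sum_list lam = n"
  by (auto simp: is_partition_iff partitions_def)

lemma row_antimono: "is_partition lam \<Longrightarrow> i \<le> j \<Longrightarrow> row lam j \<le> row lam i"
  by (cases "i = j") (auto simp: is_partition_iff row_def sorted_wrt_iff_nth_less)

lemma row_pos_iff: "is_partition lam \<Longrightarrow> 0 < row lam i \<longleftrightarrow> i < length lam"
  by (auto simp: is_partition_iff row_def in_set_conv_nth)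

lemma row_inject: "is_partition lam \<Longrightarrow> is_partition mu \<Longrightarrow> row lam = row mu \<Longrightarrow> lam = mu"
proof (rule nth_equalityI)
  assume a: "is_partition lam" "is_partition mu" "row lam = row mu"
  then have "i < length lam \<longleftrightarrow> i < length mu" for i
    by (metis row_pos_iff)
  then show l: "length lam = length mu" by (metis linorder_neqE_nat order_less_irrefl)
  show "lam ! i = mu ! i" if "i < length lam" for i
    using a(3) that l by (metis row_def)
qed

lemma ex_partition_row:
  assumes "antimono p" and "p k = 0"
  shows "\<exists>lam. is_partition lam \<and> row lam = p"
proof -
  define l where "l = (LEAST k. p k = 0)"
  have l: "p l = 0" unfolding l_def using assms(2) by (rule LeastI)
  have pos: "0 < p i" if "i < l" for i using not_less_Least that unfolding l_def by blast
  have z: "p i = 0" if "l \<le> i" for i using antimonoD[OF assms(1) that] l by simp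
  have "is_partition (map p [0..<l])"
    using assms(1) pos by (auto simp: is_partition_iff sorted_wrt_iff_nth_less antimono_def) (metis less_irrefl)
  moreover have "row (map p [0..<l]) = p" using z by (auto simp: row_def)
  ultimately show ?thesis by blast
qed

lemma diagram_Sigma: "diagram lam = (SIGMA r:{..<length lam}. {..<row lam r})"
  by (auto simp: diagram_def row_def)

lemma finite_diagram [simp]: "finite (diagram lam)"
  unfolding diagram_Sigma by blast

lemma card_diagram: "card (diagram lam) = sum_list lam"
  by (simp add: diagram_Sigma row_def sum_list_sum_nth lessThan_atLeast0)

lemma diagram_down_closed:
  "is_partition lam \<Longrightarrow> (r, c) \<in> diagram lam \<Longrightarrow> r' \<le> r \<Longrightarrow> c' \<le> c \<Longrightarrow> (r', c') \<in> diagram lam"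
  using row_antimono[of lam r' r] by simp

lemma initial_segment:
  fixes A :: "nat set"
  assumes "finite A" and "\<And>i j. j \<in> A \<Longrightarrow> i \<le> j \<Longrightarrow> i \<in> A"
  shows "A = {..<card A}"
proof -
  have "\<exists>n. A = {..<n}"
  proof (cases "A = {}")
    case False
    then have "A = {..<Suc (Max A)}"
      using assms(2)[OF Max_in[OF assms(1)]] Max_ge[OF assms(1)] by (auto simp: less_Suc_eq_le)
    then show ?thesis by blast
  qed auto
  then show ?thesis by auto
qed

text \<open>Removing the largest cell or the last domino of a tableau leaves a down-closed set of
  cells; this lemma turns it back into a partition.\<close>

lemma ex_partition_diagram:
  assumes "finite S" and down: "\<And>r c r' c'. (r, c) \<in> S \<Longrightarrow> r' \<le> r \<Longrightarrow> c' \<le> c \<Longrightarrow> (r', c') \<in> S"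
  shows "\<exists>lam. is_partition lam \<and> diagram lam = S"
proof -
  define p where "p r = card {c. (r, c) \<in> S}" for r
  have fin: "finite {c. (r, c) \<in> S}" for r
    using finite_subset[of "{c. (r, c) \<in> S}" "snd ` S"] assms(1) by force
  have seg: "{c. (r, c) \<in> S} = {..<p r}" for r
    unfolding p_def by (rule initial_segment[OF fin]) (use down in blast)
  have "antimono p"
    unfolding antimono_def p_def using down fin by (auto intro!: card_mono)
  moreover have "\<exists>k. p k = 0"
  proof -
    obtain k where "k \<notin> fst ` S" using assms(1) by (meson ex_new_if_finite finite_imageI infinite_UNIV_nat)
    then have "{c. (k, c) \<in> S} = {}" by force
    then show ?thesis unfolding p_def by (metis card.empty)
  qed
  ultimately obtain lam where lam: "is_partition lam" "row lam = p" using ex_partition_row by blast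
  have "diagram lam = S" using seg by (auto simp: diagram_row lam(2))
  with lam show ?thesis by blast
qed

lemma diagram_inject: "is_partition lam \<Longrightarrow> is_partition mu \<Longrightarrow> diagram lam = diagram mu \<Longrightarrow> lam = mu"
proof (rule row_inject)
  assume "diagram lam = diagram mu"
  then have "c < row lam r \<longleftrightarrow> c < row mu r" for r c by (metis mem_diagram)
  then show "row lam = row mu" by (intro ext) (metis linorder_neqE_nat order_less_irrefl)
qed

lemma finite_partitions: "finite (partitions n)"
proof -
  have "partitions n \<subseteq> {xs. set xs \<subseteq> {..n} \<and> length xs \<le> n}"
  proof
    fix lam assume "lam \<in> partitions n"
    then have *: "0 \<notin> set lam" "sum_list lam = n" by (auto simp: partitions_def)
    have "length lam \<le> sum_list lam"
      using *(1) by (induction lam) auto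
    moreover have "x \<le> n" if "x \<in> set lam" for x using member_le_sum_list[OF that] * by simp
    ultimately show "lam \<in> {xs. set xs \<subseteq> {..n} \<and> length xs \<le> n}" using * by auto
  qed
  then show ?thesis by (rule finite_subset) (simp add: finite_lists_length_le)
qed

lemma is_partition_Nil [simp]: "is_partition []" by (simp add: is_partition_iff)

lemma row_Nil [simp]: "row [] = (\<lambda>_. 0)" by (auto simp: row_def)

lemma partition_sum_0: "is_partition lam \<Longrightarrow> sum_list lam = 0 \<longleftrightarrow> lam = []"
  by (auto simp: is_partition_iff) (metis last_in_set neq_Nil_conv list.set_intros(1))


section \<open>Symmetry of Schur functions\<close>

definition content :: "nat list \<Rightarrow> (nat \<times> nat \<Rightarrow> nat) \<Rightarrow> nat multiset" where
  "content lam T = image_mset T (mset_set (diagram lam))"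

lemma schur_eq: "schur lam M = int (card {T \<in> SSYT lam. content lam T = M})"
  by (simp add: schur_def content_def)

lemma size_content: "size (content lam T) = sum_list lam"
  by (simp add: content_def card_diagram)

lemma count_content: "count (content lam T) j = card {x \<in> diagram lam. T x = j}"
  by (simp add: content_def count_image_mset Int_def vimage_def conj_commute)

lemma SSYT_zero: "T \<in> SSYT lam \<Longrightarrow> \<not> c < row lam r \<Longrightarrow> T (r, c) = 0"
  by (simp add: SSYT_def)

lemma SSYT_row: "T \<in> SSYT lam \<Longrightarrow> Suc c < row lam r \<Longrightarrow> T (r, c) \<le> T (r, Suc c)"
  by (simp add: SSYT_def)

lemma SSYT_col: "T \<in> SSYT lam \<Longrightarrow> c < row lam (Suc r) \<Longrightarrow> T (r, c) < T (Suc r, c)"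
  by (simp add: SSYT_def)

lemma SSYT_row_le:
  assumes "T \<in> SSYT lam" "c \<le> d" "d < row lam r"
  shows "T (r, c) \<le> T (r, d)"
  using assms(2,3)
proof (induction d)
  case (Suc d)
  then show ?case using SSYT_row[OF assms(1), of d r] by (cases "c = Suc d") auto
qed simp

text \<open>For growing \<open>k\<close> these are the row lengths of the nested shapes filled by
  entries below \<open>k\<close>, a Gelfand-Tsetlin pattern. In these coordinates a tableau can be
  changed at a single level.\<close>

definition row_count :: "nat list \<Rightarrow> (nat \<times> nat \<Rightarrow> nat) \<Rightarrow> nat \<Rightarrow> nat \<Rightarrow> nat" where
  "row_count lam T k r = card {c. c < row lam r \<and> T (r, c) < k}"

lemma row_count_iff:
  assumes "T \<in> SSYT lam" "c < row lam r"
  shows "T (r, c) < k \<longleftrightarrow> c < row_count lam T k r"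
proof -
  have "{c. c < row lam r \<and> T (r, c) < k} = {..<row_count lam T k r}"
    unfolding row_count_def
    by (rule initial_segment) (use SSYT_row_le[OF assms(1)] in \<open>auto intro: le_less_trans\<close>)
  then show ?thesis using assms(2) by blast
qed

lemma row_count_le_row: "row_count lam T k r \<le> row lam r"
  unfolding row_count_def by (rule order_trans[OF card_mono[of "{..<row lam r}"]]) auto

lemma row_count_mono: "k \<le> l \<Longrightarrow> row_count lam T k r \<le> row_count lam T l r"
  unfolding row_count_def by (rule card_mono) auto

text \<open>Interlacing: by column strictness an entry at most \<open>k\<close> in row
  \<open>Suc r\<close> has an entry below \<open>k\<close> on top of it.\<close>

lemma row_count_Suc_le:
  assumes "is_partition lam" "T \<in> SSYT lam"
  shows "row_count lam T (Suc k) (Suc r) \<le> row_count lam T k r"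
proof (rule ccontr)
  assume "\<not> ?thesis"
  then have c: "row_count lam T k r < row_count lam T (Suc k) (Suc r)" (is "?c < _") by simp
  then have "?c < row lam (Suc r)" using row_count_le_row by (meson le_trans linorder_not_less)
  moreover from this have "?c < row lam r" using row_antimono[OF assms(1), of r "Suc r"] by simp
  ultimately show False
    using row_count_iff[OF assms(2), of ?c "Suc r" "Suc k"] row_count_iff[OF assms(2), of ?c r k]
      SSYT_col[OF assms(2), of ?c r] c by simp
qed

lemma row_count_eqI:
  assumes "n \<le> row lam r" "\<And>c. c < row lam r \<Longrightarrow> T (r, c) < k \<longleftrightarrow> c < n"
  shows "row_count lam T k r = n"
proof -
  have "{c. c < row lam r \<and> T (r, c) < k} = {..<n}" using assms by auto
  then show ?thesis by (simp add: row_count_def)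
qed

text \<open>The Bender--Knuth involution, in the language of Gelfand--Tsetlin patterns: the row lengths
  \<open>m\<close> of the shape filled with entries at most \<open>k\<close> range independently over the intervals
  \<open>[bk_low r, bk_high r]\<close>, and each of them is reflected in its interval.\<close>

definition bk_low :: "nat list \<Rightarrow> nat \<Rightarrow> (nat \<times> nat \<Rightarrow> nat) \<Rightarrow> nat \<Rightarrow> nat" where
  "bk_low lam k T r = max (row_count lam T k r) (row_count lam T (Suc (Suc k)) (Suc r))"

definition bk_high :: "nat list \<Rightarrow> nat \<Rightarrow> (nat \<times> nat \<Rightarrow> nat) \<Rightarrow> nat \<Rightarrow> nat" where
  "bk_high lam k T r = (case r of 0 \<Rightarrow> row_count lam T (Suc (Suc k)) 0
     | Suc q \<Rightarrow> min (row_count lam T k q) (row_count lam T (Suc (Suc k)) r))"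

definition bk_mid :: "nat list \<Rightarrow> nat \<Rightarrow> (nat \<times> nat \<Rightarrow> nat) \<Rightarrow> nat \<Rightarrow> nat" where
  "bk_mid lam k T r = bk_low lam k T r + bk_high lam k T r - row_count lam T (Suc k) r"

definition bk :: "nat list \<Rightarrow> nat \<Rightarrow> (nat \<times> nat \<Rightarrow> nat) \<Rightarrow> (nat \<times> nat \<Rightarrow> nat)" where
  "bk lam k T = (\<lambda>(r, c).
     if row_count lam T k r \<le> c \<and> c < row_count lam T (Suc (Suc k)) r
     then (if c < bk_mid lam k T r then k else Suc k) else T (r, c))"

context
  fixes lam :: "nat list" and T :: "nat \<times> nat \<Rightarrow> nat" and k :: nat
  assumes part: "is_partition lam" and T: "T \<in> SSYT lam"
begin

private abbreviation "a \<equiv> row_count lam T k"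
private abbreviation "m \<equiv> row_count lam T (Suc k)"
private abbreviation "b \<equiv> row_count lam T (Suc (Suc k))"
private abbreviation "lo \<equiv> bk_low lam k T"
private abbreviation "hi \<equiv> bk_high lam k T"
private abbreviation "m' \<equiv> bk_mid lam k T"

lemma bk_bounds: "lo r \<le> m r" "m r \<le> hi r"
proof -
  show "lo r \<le> m r"
    unfolding bk_low_def using row_count_mono[of k "Suc k"] row_count_Suc_le[OF part T] by simp
  show "m r \<le> hi r"
    unfolding bk_high_def using row_count_mono[of "Suc k" "Suc (Suc k)"] row_count_Suc_le[OF part T]
    by (simp split: nat.split)
qed

lemma bk_mid_bounds: "lo r \<le> m' r" "m' r \<le> hi r"
  using bk_bounds[of r] unfolding bk_mid_def by linarith+

text \<open>The reflected row lengths interlace with the levels \<open>k\<close> and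
  \<open>Suc (Suc k)\<close> as the original ones do; these four inequalities make the new filling
  semistandard.\<close>

lemma bk_mid_between: "a r \<le> m' r" "m' r \<le> b r" "b (Suc r) \<le> m' r" "m' (Suc r) \<le> a r"
  using bk_mid_bounds[of r] bk_mid_bounds[of "Suc r"]
  unfolding bk_low_def bk_high_def by (simp_all split: nat.splits)

lemma bk_values:
  assumes "c < row lam r"
  shows "c < a r \<Longrightarrow> bk lam k T (r, c) = T (r, c) \<and> T (r, c) < k"
    "a r \<le> c \<Longrightarrow> c < m' r \<Longrightarrow> bk lam k T (r, c) = k"
    "m' r \<le> c \<Longrightarrow> c < b r \<Longrightarrow> bk lam k T (r, c) = Suc k"
    "b r \<le> c \<Longrightarrow> bk lam k T (r, c) = T (r, c) \<and> Suc k < T (r, c)"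
  using row_count_iff[OF T assms, of k] row_count_iff[OF T assms, of "Suc (Suc k)"] bk_mid_between[of r]
  by (auto simp: bk_def)

lemma bk_SSYT: "bk lam k T \<in> SSYT lam"
  unfolding SSYT_def mem_Collect_eq
proof (intro conjI allI impI)
  fix x assume "x \<notin> diagram lam"
  then show "bk lam k T x = 0"
    using row_count_le_row[of lam T "Suc (Suc k)" "fst x"] SSYT_zero[OF T]
    by (cases x) (auto simp: bk_def)
next
  fix r c assume "(r, Suc c) \<in> diagram lam"
  then have c: "Suc c < row lam r" "c < row lam r" by auto
  have *: "T (r, c) \<le> T (r, Suc c)" using SSYT_row[OF T c(1)] .
  consider "Suc c < a r" | "a r \<le> Suc c" "Suc c < m' r" | "m' r \<le> Suc c" "Suc c < b r" | "b r \<le> Suc c"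
    by linarith
  then show "bk lam k T (r, c) \<le> bk lam k T (r, Suc c)"
  proof cases
    case 1 then show ?thesis using bk_values(1)[OF c(1)] bk_values(1)[OF c(2)] * by simp
  next
    case 2 then show ?thesis using bk_values(2)[OF c(1)] bk_values(1,2)[OF c(2)] by (cases "c < a r") auto
  next
    case 3 then show ?thesis using bk_values(3)[OF c(1)] bk_values(1,2,3)[OF c(2)]
      by (cases "c < a r"; cases "c < m' r") auto
  next
    case 4 then show ?thesis using bk_values(4)[OF c(1)] bk_values[OF c(2)] *
      by (cases "c < a r"; cases "c < m' r"; cases "c < b r") auto
  qed
next
  fix r c assume "(Suc r, c) \<in> diagram lam"
  then have c: "c < row lam (Suc r)" "c < row lam r"
    using row_antimono[OF part, of r "Suc r"] by auto
  have *: "T (r, c) < T (Suc r, c)" using SSYT_col[OF T c(1)] .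
  have a: "a (Suc r) \<le> a r"
    using row_count_Suc_le[OF part T, of k r] row_count_mono[of k "Suc k" lam T "Suc r"] by simp
  consider "c < a (Suc r)" | "a (Suc r) \<le> c" "c < m' (Suc r)" | "m' (Suc r) \<le> c" "c < b (Suc r)" | "b (Suc r) \<le> c"
    by linarith
  then show "bk lam k T (r, c) < bk lam k T (Suc r, c)"
  proof cases
    case 1 then show ?thesis using bk_values(1)[OF c(1)] bk_values(1)[OF c(2)] * a by simp
  next
    case 2 then show ?thesis using bk_values(2)[OF c(1)] bk_values(1)[OF c(2)] bk_mid_between(4)[of r] by simp
  next
    case 3 then show ?thesis using bk_values(3)[OF c(1)] bk_values(1,2)[OF c(2)] bk_mid_between(3)[of r]
      by (cases "c < a r") auto
  next
    case 4 then show ?thesis using bk_values(4)[OF c(1)] bk_values[OF c(2)] *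
      by (cases "c < a r"; cases "c < m' r"; cases "c < b r") auto
  qed
qed

lemma row_count_bk:
  "row_count lam (bk lam k T) k r = a r"
  "row_count lam (bk lam k T) (Suc k) r = m' r"
  "row_count lam (bk lam k T) (Suc (Suc k)) r = b r"
proof -
  have le: "a r \<le> row lam r" "b r \<le> row lam r" by (rule row_count_le_row)+
  have v: "(bk lam k T (r, c) < k \<longleftrightarrow> c < a r) \<and> (bk lam k T (r, c) < Suc k \<longleftrightarrow> c < m' r)
    \<and> (bk lam k T (r, c) < Suc (Suc k) \<longleftrightarrow> c < b r)" if "c < row lam r" for c
    using bk_values[OF that] bk_mid_between(1,2)[of r]
    by (cases "c < a r"; cases "c < m' r"; cases "c < b r") auto
  show "row_count lam (bk lam k T) k r = a r"
    "row_count lam (bk lam k T) (Suc k) r = m' r"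
    "row_count lam (bk lam k T) (Suc (Suc k)) r = b r"
    using v le bk_mid_between(2)[of r] by (auto intro!: row_count_eqI)
qed

text \<open>The interval bounds depend on the levels \<open>k\<close> and
  \<open>Suc (Suc k)\<close>, which \<open>bk\<close> does not change, so the second application
  reflects in the same intervals.\<close>

lemma bk_bk: "bk lam k (bk lam k T) = T"
proof
  fix x :: "nat \<times> nat"
  obtain r c where x: "x = (r, c)" by (cases x)
  have lh: "bk_low lam k (bk lam k T) r = lo r" "bk_high lam k (bk lam k T) r = hi r"
    unfolding bk_low_def bk_high_def by (simp_all add: row_count_bk split: nat.split)
  have mid: "bk_mid lam k (bk lam k T) r = m r"
    using bk_bounds[of r] unfolding bk_mid_def[of lam k "bk lam k T"] lh row_count_bk bk_mid_def by simp
  show "bk lam k (bk lam k T) x = T x"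
  proof (cases "a r \<le> c \<and> c < b r")
    case True
    then have "c < row lam r" using row_count_le_row by (meson le_trans linorder_not_less)
    then have "T (r, c) = (if c < m r then k else Suc k)"
      using True row_count_iff[OF T, of c r] by (metis less_Suc_eq linorder_not_less)
    then show ?thesis using True mid by (simp add: x bk_def[of lam k "bk lam k T"] row_count_bk)
  next
    case False
    then show ?thesis by (simp add: x bk_def[of lam k "bk lam k T"] row_count_bk) (simp add: bk_def False)
  qed
qed

lemma card_entry: "card {x \<in> diagram lam. T x = l} = (\<Sum>r<length lam. row_count lam T (Suc l) r - row_count lam T l r)"
proof -
  have "{x \<in> diagram lam. T x = l} = (SIGMA r:{..<length lam}. {row_count lam T l r..<row_count lam T (Suc l) r})"
  proof (intro set_eqI)
    fix x :: "nat \<times> nat"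
    obtain r c where x: "x = (r, c)" by (cases x)
    have "c < row lam r \<and> T (r, c) = l \<longleftrightarrow> row_count lam T l r \<le> c \<and> c < row_count lam T (Suc l) r"
      using row_count_iff[OF T, of c r l] row_count_iff[OF T, of c r "Suc l"]
        row_count_le_row[of lam T "Suc l" r] by auto
    moreover have "c < row lam r \<Longrightarrow> r < length lam" by (auto simp: row_def split: if_splits)
    ultimately show "x \<in> {x \<in> diagram lam. T x = l} \<longleftrightarrow>
      x \<in> (SIGMA r:{..<length lam}. {row_count lam T l r..<row_count lam T (Suc l) r})"
      by (auto simp: x)
  qed
  then show ?thesis by simp
qed

end

text \<open>Write a, m, b for the row lengths at the three levels. The interval bounds sum over all
  rows to the sum of a + b, so reflection replaces the sum of m by that of a + b - m. The entries
  \<open>k\<close> then number the sum of b - m, formerly the number of entries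
  \<open>Suc k\<close>.\<close>

lemma bk_count_k:
  assumes part: "is_partition lam" and T: "T \<in> SSYT lam"
  shows "count (content lam (bk lam k T)) k = count (content lam T) (Suc k)"
proof -
  let ?a = "row_count lam T k" and ?m = "row_count lam T (Suc k)" and ?b = "row_count lam T (Suc (Suc k))"
  let ?lo = "bk_low lam k T" and ?hi = "bk_high lam k T" and ?L = "length lam"
  \<comment> \<open>The low bound of row \<open>n\<close> and the high bound of row
    \<open>Suc n\<close> are the maximum and the minimum of the same two numbers, so the sum is
    regrouped with a shift by one row.\<close>
  have lohi: "(\<Sum>r<n. ?lo r + ?hi r) + ?hi n = ?b 0 + (\<Sum>r<n. ?a r + ?b (Suc r))" for n
  proof (induction n)
    case (Suc n)
    have "?lo n + ?hi (Suc n) = ?a n + ?b (Suc n)" by (simp add: bk_low_def bk_high_def)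
    then show ?case using Suc by simp
  qed (simp add: bk_high_def)
  have ab: "(\<Sum>r<n. ?a r + ?b r) + ?b n = ?b 0 + (\<Sum>r<n. ?a r + ?b (Suc r))" for n
    by (induction n) auto
  \<comment> \<open>The row with index \<open>?L\<close> is empty, so the boundary terms of both
    regrouped sums vanish there.\<close>
  have bL: "?b ?L = 0" using row_count_le_row[of lam T "Suc (Suc k)" ?L] by (simp add: row_def)
  have hL: "?hi ?L = 0" using bL by (auto simp: bk_high_def split: nat.split)
  have sum: "(\<Sum>r<?L. ?lo r + ?hi r) = (\<Sum>r<?L. ?a r + ?b r)"
    using lohi[of ?L] ab[of ?L] by (simp only: bL hL)
  have le: "?a r \<le> ?m r" "?m r \<le> ?b r" for r by (auto intro: row_count_mono)
  have "count (content lam (bk lam k T)) k = (\<Sum>r<?L. bk_mid lam k T r - ?a r)"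
    unfolding count_content card_entry[OF part bk_SSYT[OF part T]] by (simp add: row_count_bk[OF part T])
  also have "int \<dots> = (\<Sum>r<?L. int (?lo r + ?hi r) - int (?m r) - int (?a r))"
    unfolding of_nat_sum
  proof (rule sum.cong)
    fix r
    show "int (bk_mid lam k T r - ?a r) = int (?lo r + ?hi r) - int (?m r) - int (?a r)"
      using bk_mid_between(1)[OF part T, of k r] bk_bounds[OF part T, of k r] unfolding bk_mid_def by linarith
  qed simp
  also have "\<dots> = int (\<Sum>r<?L. ?lo r + ?hi r) - (\<Sum>r<?L. int (?m r)) - (\<Sum>r<?L. int (?a r))"
    by (simp add: sum_subtractf sum.distrib)
  also have "\<dots> = (\<Sum>r<?L. int (?b r) - int (?m r))"
    unfolding sum by (simp add: sum_subtractf sum.distrib)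
  also have "\<dots> = int (\<Sum>r<?L. ?b r - ?m r)" using le by (simp add: of_nat_diff)
  also have "(\<Sum>r<?L. ?b r - ?m r) = count (content lam T) (Suc k)"
    unfolding count_content card_entry[OF part T] by simp
  finally show ?thesis by simp
qed

lemma count_image_mset_transpose:
  "count (image_mset (transpose i j) M) l = count M (transpose i j l)"
proof -
  have "transpose i j -` {l} = {transpose i j l}"
    by (auto simp: transpose_def split: if_splits)
  then show ?thesis
    by (cases "transpose i j l \<in># M") (auto simp: count_image_mset not_in_iff)
qed

lemma content_bk:
  assumes part: "is_partition lam" and T: "T \<in> SSYT lam"
  shows "content lam (bk lam k T) = image_mset (transpose k (Suc k)) (content lam T)"
proof (rule multiset_eqI)
  fix l
  consider "l = k" | "l = Suc k" | "l \<noteq> k" "l \<noteq> Suc k" by blast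
  then show "count (content lam (bk lam k T)) l = count (image_mset (transpose k (Suc k)) (content lam T)) l"
  proof cases
    case 1 then show ?thesis using bk_count_k[OF assms] by (simp add: count_image_mset_transpose)
  next
    \<comment> \<open>Since \<open>bk\<close> is an involution, the count of \<open>Suc k\<close> in
      the image is obtained by counting \<open>k\<close> after a second application.\<close>
    case 2 then show ?thesis using bk_count_k[OF part bk_SSYT[OF assms], of k k]
      by (simp add: count_image_mset_transpose bk_bk[OF assms])
  next
    case 3
    have "bk lam k T (r, c) = l \<longleftrightarrow> T (r, c) = l" if "c < row lam r" for r c
    proof -
      have "T (r, c) \<in> {k, Suc k}" if "row_count lam T k r \<le> c" "c < row_count lam T (Suc (Suc k)) r"
        using that row_count_iff[OF T \<open>c < row lam r\<close>] by (metis insertI1 insertI2 less_Suc_eq linorder_not_less)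
      then show ?thesis using 3 by (auto simp: bk_def)
    qed
    then have "{x \<in> diagram lam. bk lam k T x = l} = {x \<in> diagram lam. T x = l}"
      by (auto simp del: mem_diagram simp: diagram_row)
    then show ?thesis using 3 by (simp add: count_image_mset_transpose count_content)
  qed
qed

section \<open>Symmetric series, tested on adjacent transpositions and determined at partition
  exponents\<close>

definition symmetric_series :: "series \<Rightarrow> bool" where
  "symmetric_series f \<longleftrightarrow> (\<forall>k M. f (image_mset (transpose k (Suc k)) M) = f M)"

lemma image_mset_transpose_twice [simp]: "image_mset (transpose i j) (image_mset (transpose i j) M) = M"
  by (simp add: multiset.map_comp)

lemma symmetric_schur: "is_partition lam \<Longrightarrow> symmetric_series (schur lam)"
  unfolding symmetric_series_def
proof (intro allI)
  fix k M assume part: "is_partition lam"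
  have "bij_betw (bk lam k) {T \<in> SSYT lam. content lam T = image_mset (transpose k (Suc k)) M}
    {T \<in> SSYT lam. content lam T = M}"
    by (rule bij_betwI[where g = "bk lam k"]) (auto simp: bk_bk[OF part] bk_SSYT[OF part] content_bk[OF part])
  then show "schur lam (image_mset (transpose k (Suc k)) M) = schur lam M"
    unfolding schur_eq by (simp add: bij_betw_same_card)
qed

lemma symmetric_series_mult:
  assumes "symmetric_series f" "symmetric_series g"
  shows "symmetric_series (series_mult f g)"
  unfolding symmetric_series_def
proof (intro allI)
  fix k M
  let ?s = "image_mset (transpose k (Suc k)) :: nat multiset \<Rightarrow> nat multiset"
  have "(\<Sum>(A, B) | A + B = ?s M. f A * g B) = (\<Sum>(A, B) | A + B = M. f A * g B)"
    by (rule sum.reindex_bij_witness[where i = "\<lambda>(A, B). (?s A, ?s B)" and j = "\<lambda>(A, B). (?s A, ?s B)"])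
      (use assms in \<open>auto simp: symmetric_series_def simp flip: image_mset_union\<close>)
  then show "series_mult f g (?s M) = series_mult f g M" by (simp add: series_mult_eq_sum_pairs)
qed

lemma symmetric_series_sum:
  assumes "\<And>x. x \<in> A \<Longrightarrow> symmetric_series (f x)"
  shows "symmetric_series (\<lambda>M. \<Sum>x\<in>A. c x * f x M)"
  using assms by (simp add: symmetric_series_def)

text \<open>The monomial with exponent vector \<open>mu\<close>, presented as the content of the
  filling by row numbers, so that its index sum is a sum over cells.\<close>

definition row_monomial :: "nat list \<Rightarrow> nat multiset" where
  "row_monomial mu = content mu fst"

lemma count_row_monomial: "count (row_monomial mu) i = row mu i"
proof -
  have "{x \<in> diagram mu. fst x = i} = {i} \<times> {..<row mu i}" by auto
  then show ?thesis by (simp add: row_monomial_def count_content)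
qed

text \<open>Swapping neighbouring exponents that stand in increasing order lowers the sum of the
  indices. When no such swap is left, the exponents form a partition.\<close>

lemma symmetric_series_eqI:
  assumes f: "symmetric_series f" and g: "symmetric_series g"
    and eq: "\<And>mu. is_partition mu \<Longrightarrow> f (row_monomial mu) = g (row_monomial mu)"
  shows "f = g"
proof
  fix M show "f M = g M"
  proof (induction "sum_mset M" arbitrary: M rule: less_induct)
    case less
    show ?case
    proof (cases "\<exists>k. count M k < count M (Suc k)")
      case True
      then obtain k where k: "count M k < count M (Suc k)" by blast
      let ?p = "count M k" and ?q = "count M (Suc k)" and ?R = "filter_mset (\<lambda>x. x \<noteq> k \<and> x \<noteq> Suc k) M"
      have M: "M = replicate_mset ?p k + replicate_mset ?q (Suc k) + ?R"
        by (rule multiset_eqI) auto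
      have M': "image_mset (transpose k (Suc k)) M = replicate_mset ?q k + replicate_mset ?p (Suc k) + ?R"
        by (rule multiset_eqI) (auto simp: count_image_mset_transpose transpose_def)
      have "sum_mset (image_mset (transpose k (Suc k)) M) < sum_mset M"
        unfolding M' by (subst (3) M) (use k in simp)
      then show ?thesis using less f g unfolding symmetric_series_def by metis
    next
      case False
      then have "antimono (count M)" by (simp add: antimono_iff_le_Suc not_less)
      moreover obtain k where "k \<notin># M" by (meson ex_new_if_finite finite_set_mset infinite_UNIV_nat)
      then have "count M k = 0" by (simp add: not_in_iff)
      ultimately obtain mu where "is_partition mu" "row mu = count M" using ex_partition_row by blast
      moreover from this have "M = row_monomial mu" by (intro multiset_eqI) (simp add: count_row_monomial)
      ultimately show ?thesis using eq by simp
    qed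
  qed
qed


section \<open>The Littlewood--Richardson expansion\<close>

lemma SSYT_ge_row:
  assumes "is_partition lam" "T \<in> SSYT lam" "c < row lam r"
  shows "r \<le> T (r, c)"
  using assms(3)
proof (induction r)
  case (Suc r)
  then have "c < row lam r" using row_antimono[OF assms(1), of r "Suc r"] by simp
  then show ?case using Suc SSYT_col[OF assms(2) Suc.prems] by simp
qed simp

lemma sum_mset_content: "sum_mset (content lam T) = (\<Sum>x\<in>diagram lam. T x)"
  by (simp add: content_def sum_unfold_sum_mset)

text \<open>Entries in row r are at least r, so the entry sum is at least the sum of the row
  numbers, with equality for the filling by row numbers alone. This numerical weight takes the place
  of dominance order in the unitriangularity of the Kostka matrix.\<close>

lemma SSYT_row_monomial:
  assumes lam: "is_partition lam" and mu: "is_partition mu"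
    and T: "T \<in> SSYT lam" "content lam T = row_monomial mu"
  shows "sum_mset (row_monomial lam) < sum_mset (row_monomial mu) \<or>
    lam = mu \<and> T = (\<lambda>x. if x \<in> diagram lam then fst x else 0)"
proof -
  have ge: "fst x \<le> T x" if "x \<in> diagram lam" for x
    using SSYT_ge_row[OF lam T(1)] that by (cases x) auto
  have s: "sum_mset (row_monomial mu) = (\<Sum>x\<in>diagram lam. T x)"
    "sum_mset (row_monomial lam) = (\<Sum>x\<in>diagram lam. fst x)"
    by (metis T(2) sum_mset_content, simp add: row_monomial_def sum_mset_content)
  show ?thesis
  proof (cases "\<exists>x\<in>diagram lam. fst x \<noteq> T x")
    case True
    then have "\<exists>x\<in>diagram lam. fst x < T x" using ge le_neq_implies_less by blast
    then have "(\<Sum>x\<in>diagram lam. fst x) < (\<Sum>x\<in>diagram lam. T x)"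
      using ge by (intro sum_strict_mono_ex1) auto
    then show ?thesis by (simp add: s)
  next
    case False
    then have eq: "T = (\<lambda>x. if x \<in> diagram lam then fst x else 0)"
      using T(1) unfolding SSYT_def by (intro ext) (metis (mono_tags, lifting) mem_Collect_eq)
    have "content lam T = row_monomial lam"
      unfolding row_monomial_def content_def using False by (intro image_mset_cong) auto
    then have "row lam = row mu" using T(2) by (metis count_row_monomial ext)
    then show ?thesis using eq row_inject lam mu by blast
  qed
qed

lemma schur_row_monomial_less:
  assumes "is_partition lam" "is_partition mu" "schur lam (row_monomial mu) \<noteq> 0" "lam \<noteq> mu"
  shows "sum_mset (row_monomial lam) < sum_mset (row_monomial mu)"
proof -
  have "{T \<in> SSYT lam. content lam T = row_monomial mu} \<noteq> {}"
    using assms(3) by (metis (mono_tags) card.empty of_nat_0 schur_eq)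
  then show ?thesis using SSYT_row_monomial[OF assms(1,2)] assms(4) by blast
qed

lemma schur_row_monomial_self:
  assumes "is_partition lam"
  shows "schur lam (row_monomial lam) = 1"
proof -
  let ?T = "\<lambda>x. if x \<in> diagram lam then fst x else 0"
  have "?T \<in> SSYT lam" using row_antimono[OF assms] by (auto simp: SSYT_def)
  moreover have "content lam ?T = row_monomial lam"
    unfolding row_monomial_def content_def by (intro image_mset_cong) auto
  ultimately have "{T \<in> SSYT lam. content lam T = row_monomial lam} = {?T}"
    using SSYT_row_monomial[OF assms assms] by blast
  then show ?thesis by (simp add: schur_eq)
qed

lemma schur_homogeneous: "schur lam M \<noteq> 0 \<Longrightarrow> size M = sum_list lam"
proof -
  assume "schur lam M \<noteq> 0"
  then have "{T \<in> SSYT lam. content lam T = M} \<noteq> {}" by (metis (mono_tags) card.empty of_nat_0 schur_eq)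
  then show ?thesis using size_content by blast
qed

text \<open>Substitution by increasing height: an unknown of height \<open>d\<close> enters its own
  equation with coefficient 1 and otherwise only equations of greater height.\<close>

lemma unitriangular_solution:
  fixes K :: "'a \<Rightarrow> 'a \<Rightarrow> int" and h :: "'a \<Rightarrow> nat"
  assumes fin: "finite S" and one: "\<And>x. x \<in> S \<Longrightarrow> K x x = 1"
    and tri: "\<And>x y. x \<in> S \<Longrightarrow> y \<in> S \<Longrightarrow> K x y \<noteq> 0 \<Longrightarrow> x \<noteq> y \<Longrightarrow> h x < h y"
  shows "\<exists>c. (\<forall>x. x \<notin> S \<longrightarrow> c x = 0) \<and> (\<forall>y\<in>S. (\<Sum>x\<in>S. c x * K x y) = f y)"
proof -
  have "\<exists>c. (\<forall>x. x \<notin> S \<longrightarrow> c x = 0) \<and> (\<forall>y\<in>S. h y < d \<longrightarrow> (\<Sum>x\<in>S. c x * K x y) = f y)" for d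
  proof (induction d)
    case 0
    show ?case by (rule exI[of _ "\<lambda>_. 0"]) simp
  next
    case (Suc d)
    then obtain c where c: "\<And>x. x \<notin> S \<Longrightarrow> c x = 0"
      "\<And>y. y \<in> S \<Longrightarrow> h y < d \<Longrightarrow> (\<Sum>x\<in>S. c x * K x y) = f y" by blast
    \<comment> \<open>The correction is the error left at height \<open>d\<close>. It does not
      disturb the equations of smaller height, nor those of other elements of height
      \<open>d\<close>.\<close>
    define e where "e x = (if x \<in> S \<and> h x = d then f x - (\<Sum>z\<in>S. c z * K z x) else 0)" for x
    have "(\<Sum>x\<in>S. (c x + e x) * K x y) = f y" if y: "y \<in> S" "h y < Suc d" for y
    proof -
      have "e x * K x y = (if x = y then e y else 0)" if "x \<in> S" for x
        using tri[OF that y(1)] y one[OF y(1)] by (auto simp: e_def)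
      then have "(\<Sum>x\<in>S. e x * K x y) = e y" using fin y(1) by simp
      then have "(\<Sum>x\<in>S. (c x + e x) * K x y) = (\<Sum>x\<in>S. c x * K x y) + e y"
        by (simp add: distrib_right sum.distrib)
      then show ?thesis using c(2)[OF y(1)] y by (cases "h y = d") (auto simp: e_def)
    qed
    moreover have "\<forall>x. x \<notin> S \<longrightarrow> c x + e x = 0" using c(1) by (simp add: e_def)
    ultimately show ?case by (intro exI[of _ "\<lambda>x. c x + e x"]) blast
  qed
  from this[of "Suc (Max (h ` S))"] show ?thesis
    using fin by (auto simp: less_Suc_eq_le)
qed

lemma unitriangular_unique:
  fixes K :: "'a \<Rightarrow> 'a \<Rightarrow> int" and h :: "'a \<Rightarrow> nat"
  assumes fin: "finite S" and one: "\<And>x. x \<in> S \<Longrightarrow> K x x = 1"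
    and tri: "\<And>x y. x \<in> S \<Longrightarrow> y \<in> S \<Longrightarrow> K x y \<noteq> 0 \<Longrightarrow> x \<noteq> y \<Longrightarrow> h x < h y"
    and eq: "\<And>y. y \<in> S \<Longrightarrow> (\<Sum>x\<in>S. c x * K x y) = (\<Sum>x\<in>S. d x * K x y)"
  shows "y \<in> S \<Longrightarrow> c y = d y"
proof (induction "h y" arbitrary: y rule: less_induct)
  case less
  have "c x * K x y = d x * K x y" if "x \<in> S - {y}" for x
    using less(1)[of x] tri[of x y] that less(2) by (cases "K x y = 0") auto
  then have "(\<Sum>x\<in>S - {y}. c x * K x y) = (\<Sum>x\<in>S - {y}. d x * K x y)" by (intro sum.cong) auto
  moreover have "(\<Sum>x\<in>S. g x * K x y) = g y + (\<Sum>x\<in>S - {y}. g x * K x y)" for g :: "'a \<Rightarrow> int"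
    using sum.remove[OF fin less(2), of "\<lambda>x. g x * K x y"] one[OF less(2)] by simp
  ultimately show ?case using eq[OF less(2)] by simp
qed

text \<open>The system at partition monomials of the right degree yields the coefficients, and
  symmetry carries the identity to every monomial. The same matrix gives uniqueness, so the definite
  description denotes.\<close>

lemma lr_coeff_spec:
  assumes lam: "is_partition lam" and mu: "is_partition mu"
  shows "nu \<notin> partitions (sum_list lam + sum_list mu) \<Longrightarrow> lr_coeff lam mu nu = 0"
    and "series_mult (schur lam) (schur mu) =
      (\<lambda>M. \<Sum>nu\<in>partitions (sum_list lam + sum_list mu). lr_coeff lam mu nu * schur nu M)"
proof -
  let ?S = "partitions (sum_list lam + sum_list mu)"
  let ?P = "\<lambda>c. (\<forall>nu. nu \<notin> ?S \<longrightarrow> c nu = 0) \<and>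
     series_mult (schur lam) (schur mu) = (\<lambda>M. \<Sum>nu\<in>?S. c nu * schur nu M)"
  let ?K = "\<lambda>nu kap. schur nu (row_monomial kap)" and ?h = "\<lambda>nu. sum_mset (row_monomial nu)"
  have one: "x \<in> ?S \<Longrightarrow> ?K x x = 1" for x by (simp add: schur_row_monomial_self partitions_iff)
  have tri: "x \<in> ?S \<Longrightarrow> y \<in> ?S \<Longrightarrow> ?K x y \<noteq> 0 \<Longrightarrow> x \<noteq> y \<Longrightarrow> ?h x < ?h y" for x y
    using schur_row_monomial_less by (simp add: partitions_iff)
  have "\<exists>!c. ?P c"
  proof (rule ex_ex1I)
    have "\<exists>c. (\<forall>nu. nu \<notin> ?S \<longrightarrow> c nu = 0) \<and>
      (\<forall>kap\<in>?S. (\<Sum>nu\<in>?S. c nu * ?K nu kap) = series_mult (schur lam) (schur mu) (row_monomial kap))"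
      by (rule unitriangular_solution[where K = ?K and h = ?h]) (fact finite_partitions one tri)+
    then obtain c where c: "\<forall>nu. nu \<notin> ?S \<longrightarrow> c nu = 0"
      "\<forall>kap\<in>?S. (\<Sum>nu\<in>?S. c nu * ?K nu kap) = series_mult (schur lam) (schur mu) (row_monomial kap)"
      by blast
    have "series_mult (schur lam) (schur mu) = (\<lambda>M. \<Sum>nu\<in>?S. c nu * schur nu M)"
    proof (rule symmetric_series_eqI)
      show "symmetric_series (series_mult (schur lam) (schur mu))"
        using symmetric_series_mult symmetric_schur lam mu by blast
      show "symmetric_series (\<lambda>M. \<Sum>nu\<in>?S. c nu * schur nu M)"
        by (rule symmetric_series_sum) (simp add: symmetric_schur partitions_iff)
      fix kap assume kap: "is_partition kap"
      show "series_mult (schur lam) (schur mu) (row_monomial kap) = (\<Sum>nu\<in>?S. c nu * ?K nu kap)"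
      proof (cases "kap \<in> ?S")
        \<comment> \<open>A partition outside \<open>?S\<close> has the wrong size, and by
          homogeneity both sides vanish there.\<close>
        case False
        have sz: "size (row_monomial kap) = sum_list kap" by (simp add: row_monomial_def size_content)
        have "schur lam A * schur mu B = 0" if "A + B = row_monomial kap" for A B
        proof (rule ccontr)
          assume "schur lam A * schur mu B \<noteq> 0"
          then have "size A = sum_list lam" "size B = sum_list mu" using schur_homogeneous by auto
          then have "sum_list kap = sum_list lam + sum_list mu" using sz that by (metis size_union)
          then show False using False kap by (simp add: partitions_iff)
        qed
        then have "series_mult (schur lam) (schur mu) (row_monomial kap) = 0"
          unfolding series_mult_eq_sum_pairs by (intro sum.neutral) auto
        moreover have "?K nu kap = 0" if "nu \<in> ?S" for nu
          using schur_homogeneous[of nu "row_monomial kap"] that False kap sz by (auto simp: partitions_iff)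
        ultimately show ?thesis by simp
      qed (use c in simp)
    qed
    with c show "\<exists>c. ?P c" by blast
  next
    fix c d assume "?P c" "?P d"
    then have z: "\<And>nu. nu \<notin> ?S \<Longrightarrow> c nu = d nu"
      and e: "(\<lambda>M. \<Sum>nu\<in>?S. c nu * schur nu M) = (\<lambda>M. \<Sum>nu\<in>?S. d nu * schur nu M)" by auto
    have "c nu = d nu" if "nu \<in> ?S" for nu
    proof (rule unitriangular_unique[where S = ?S and K = ?K and h = ?h])
      show "(\<Sum>x\<in>?S. c x * ?K x y) = (\<Sum>x\<in>?S. d x * ?K x y)" for y
        using fun_cong[OF e, of "row_monomial y"] .
    qed (fact finite_partitions one tri that)+
    with z show "c = d" by blast
  qed
  then have "?P (lr_coeff lam mu)" unfolding lr_coeff_def by (rule theI')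
  then show "nu \<notin> ?S \<Longrightarrow> lr_coeff lam mu nu = 0"
    and "series_mult (schur lam) (schur mu) = (\<lambda>M. \<Sum>nu\<in>?S. lr_coeff lam mu nu * schur nu M)" by blast+
qed


section \<open>Maya diagrams\<close>

text \<open>Beta numbers for infinitely many beads, normalised so that the empty partition occupies
  exactly the negative positions.\<close>

definition beta :: "nat list \<Rightarrow> nat \<Rightarrow> int" where
  "beta lam i = int (row lam i) - int i - 1"

definition maya :: "nat list \<Rightarrow> int set" where
  "maya lam = range (beta lam)"

text \<open>The distance \<open>d\<close> is 1 for adding a cell and 2 for adding a domino; sharing
  the definition lets the two kinds of paths be compared on the runners.\<close>

definition movable :: "int \<Rightarrow> int \<Rightarrow> int set \<Rightarrow> bool" where
  "movable d x M \<longleftrightarrow> x \<in> M \<and> x + d \<notin> M"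

definition move :: "int \<Rightarrow> int \<Rightarrow> int set \<Rightarrow> int set" where
  "move d x M = insert (x + d) (M - {x})"

lemma beta_strict_antimono: "is_partition lam \<Longrightarrow> i < j \<Longrightarrow> beta lam j < beta lam i"
  using row_antimono[of lam i j] by (simp add: beta_def)

lemma beta_less_iff: "is_partition lam \<Longrightarrow> beta lam j < beta lam i \<longleftrightarrow> i < j"
  by (metis beta_strict_antimono linorder_neqE_nat order_less_asym order_less_irrefl)

lemma beta_eq_iff: "is_partition lam \<Longrightarrow> beta lam i = beta lam j \<longleftrightarrow> i = j"
  by (metis beta_less_iff linorder_neqE_nat order_less_irrefl)

lemma inj_beta: "is_partition lam \<Longrightarrow> inj (beta lam)"
  by (simp add: inj_def beta_eq_iff)

lemma beta_in_maya [simp]: "beta lam i \<in> maya lam"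
  by (simp add: maya_def)

text \<open>\<open>beta\<close> lists the beads in decreasing order. Once the first beads agree, the
  next one is the largest bead left in the common set.\<close>

lemma maya_inject:
  assumes "is_partition lam" "is_partition mu" "maya lam = maya mu"
  shows "lam = mu"
proof -
  have le: "beta lam i \<le> beta mu i"
    if "is_partition lam" "is_partition mu" "maya lam = maya mu" "\<And>j. j < i \<Longrightarrow> beta lam j = beta mu j" for lam mu i
  proof -
    have "beta lam i \<in> maya mu" using that(3) by (metis beta_in_maya)
    then obtain k where k: "beta lam i = beta mu k" by (auto simp: maya_def)
    then have "\<not> k < i" using that(1,4) beta_eq_iff by (metis order_less_irrefl)
    then show ?thesis using k beta_less_iff[OF that(2), of i k] by linarith
  qed
  have "beta lam i = beta mu i" for i
    by (induction i rule: less_induct) (metis assms le order_antisym)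
  then have "row lam = row mu" by (auto simp: beta_def fun_eq_iff)
  then show ?thesis using row_inject assms by blast
qed

lemma maya_Nil [simp]: "maya [] = {..<0}"
proof -
  have "x \<in> maya []" if "x < 0" for x
    unfolding maya_def using that by (intro range_eqI[of _ _ "nat (- x - 1)"]) (simp add: beta_def)
  then show ?thesis by (auto simp: maya_def beta_def)
qed

lemma beads_above: "is_partition lam \<Longrightarrow> {b \<in> maya lam. beta lam r < b} = beta lam ` {..<r}"
  by (auto simp: maya_def beta_less_iff)

text \<open>Recovers the row number of a bead from the bead set, which is how rows of successive
  dominoes are compared.\<close>

lemma card_beads_above: "is_partition lam \<Longrightarrow> card {b \<in> maya lam. beta lam r < b} = r"
  by (simp add: beads_above card_image inj_on_subset[OF inj_beta])

lemma move_row: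
  assumes lam: "is_partition lam" and lam': "is_partition lam'" and d: "0 < d"
    and row: "row lam = (row lam')(r := row lam' r + d)"
  shows "movable (int d) (beta lam' r) (maya lam')" "maya lam = move (int d) (beta lam' r) (maya lam')"
proof -
  let ?x = "beta lam' r"
  have b: "beta lam = (beta lam')(r := ?x + int d)" using row by (auto simp: beta_def fun_eq_iff)
  have "?x + int d \<noteq> beta lam' j" for j
    using beta_eq_iff[OF lam, of r j] b d by (cases "j = r") auto
  then show "movable (int d) ?x (maya lam')" by (auto simp: movable_def maya_def)
  show "maya lam = move (int d) ?x (maya lam')"
    unfolding maya_def b move_def using beta_eq_iff[OF lam'] by (auto simp: image_iff)
qed

lemma ex_bead_row: "movable d x (maya lam) \<Longrightarrow> \<exists>r. x = beta lam r"
  by (auto simp: movable_def maya_def)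

text \<open>That \<open>x + 1\<close> is free means that the row above, if there is one, is strictly
  longer; so lengthening the row of \<open>x\<close> leaves a partition.\<close>

lemma add_cell:
  assumes lam': "is_partition lam'" and mv: "movable 1 x (maya lam')"
  shows "\<exists>lam r. is_partition lam \<and> maya lam = move 1 x (maya lam') \<and>
    row lam = (row lam')(r := Suc (row lam' r)) \<and> x = beta lam' r"
proof -
  obtain r where r: "x = beta lam' r" using ex_bead_row[OF mv] by blast
  define p where "p = (row lam')(r := Suc (row lam' r))"
  have up: "Suc (row lam' r) \<le> row lam' i" if "i < r" for i
  proof (rule ccontr)
    assume "\<not> ?thesis"
    then have "row lam' (r - 1) = row lam' r"
      using row_antimono[OF lam', of i "r - 1"] row_antimono[OF lam', of "r - 1" r] that by linarith
    then have "beta lam' (r - 1) = x + 1" using that by (simp add: r beta_def of_nat_diff)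
    then show False using mv by (metis beta_in_maya movable_def)
  qed
  have "antimono p"
    using up row_antimono[OF lam'] by (auto simp: antimono_def p_def le_Suc_eq)
  moreover have "p (Suc (length lam' + r)) = 0" by (simp add: p_def row_def)
  ultimately obtain lam where lam: "is_partition lam" "row lam = p" using ex_partition_row by blast
  have "row lam = (row lam')(r := row lam' r + 1)" using lam(2) p_def by simp
  from move_row(2)[OF lam(1) lam' _ this] have "maya lam = move 1 x (maya lam')" by (simp add: r)
  then show ?thesis using lam r p_def by blast
qed

lemma diagram_row_upd:
  "row lam = (row lam')(r := Suc (row lam' r)) \<Longrightarrow> diagram lam = insert (r, row lam' r) (diagram lam')"
  by (auto simp: diagram_row split: if_splits)

lemma row_diagram_insert:
  assumes "diagram lam = insert (r, c) (diagram lam')" "(r, c) \<notin> diagram lam'"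
  shows "row lam' r = c" "row lam = (row lam')(r := Suc c)"
proof -
  have iff: "j < row lam i \<longleftrightarrow> (i = r \<and> j = c) \<or> j < row lam' i" for i j
    using assms(1) mem_diagram by (metis insert_iff prod.inject)
  have c: "row lam' r \<le> c" using assms(2) by simp
  show c': "row lam' r = c"
    using iff[of "row lam' r" r] iff[of c r] c by (metis le_neq_implies_less less_irrefl less_trans)
  have "row lam i = ((row lam')(r := Suc c)) i" for i
  proof (cases "i = r")
    case True
    then show ?thesis using iff[of _ r] c' by (metis fun_upd_same less_Suc_eq linorder_neqE_nat less_irrefl)
  next
    case False
    then show ?thesis using iff[of _ i] by (metis fun_upd_other linorder_neqE_nat less_irrefl)
  qed
  then show "row lam = (row lam')(r := Suc c)" by blast
qed

lemma sum_list_insert_diagram: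
  "diagram lam = insert (r, c) (diagram lam') \<Longrightarrow> (r, c) \<notin> diagram lam' \<Longrightarrow> sum_list lam = Suc (sum_list lam')"
  by (metis card_diagram card_insert_disjoint finite_diagram)


text \<open>Growth from the empty partition, recorded by the starting positions of the moves:
  standard tableaux for \<open>d = 1\<close>, standard domino tableaux for
  \<open>d = 2\<close>.\<close>

inductive bead_path :: "int \<Rightarrow> int list \<Rightarrow> int set \<Rightarrow> bool" for d where
  Nil: "bead_path d [] {..<0}"
| snoc: "bead_path d w M \<Longrightarrow> movable d x M \<Longrightarrow> bead_path d (w @ [x]) (move d x M)"

definition paths :: "int \<Rightarrow> int set \<Rightarrow> int list set" where
  "paths d M = {w. bead_path d w M}"

lemma bead_path_Nil_iff [simp]: "bead_path d [] M \<longleftrightarrow> M = {..<0}"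
  by (auto elim: bead_path.cases intro: bead_path.Nil)

lemma bead_path_snoc_iff [simp]:
  "bead_path d (w @ [x]) M \<longleftrightarrow> (\<exists>M'. bead_path d w M' \<and> movable d x M' \<and> M = move d x M')"
proof
  assume "bead_path d (w @ [x]) M"
  then show "\<exists>M'. bead_path d w M' \<and> movable d x M' \<and> M = move d x M'"
    by cases auto
qed (auto intro: bead_path.snoc)

lemma move_inject: "movable d x M \<Longrightarrow> movable d x M' \<Longrightarrow> move d x M = move d x M' \<Longrightarrow> M = M'"
  unfolding movable_def move_def by (metis Diff_insert_absorb insert_Diff insert_ident insert_iff Diff_iff)

lemma bead_path_partition_1:
  "bead_path 1 w M \<Longrightarrow> \<exists>lam. is_partition lam \<and> maya lam = M \<and> sum_list lam = length w"
proof (induction rule: bead_path.induct)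
  case Nil then show ?case by (intro exI[of _ "[]"]) simp
next
  case (snoc w M x)
  then obtain lam' where lam': "is_partition lam'" "maya lam' = M" "sum_list lam' = length w" by blast
  have "movable 1 x (maya lam')" using snoc lam'(2) by simp
  from add_cell[OF lam'(1) this] obtain lam r where
    lam: "is_partition lam" "maya lam = move 1 x (maya lam')" "row lam = (row lam')(r := Suc (row lam' r))"
    by blast
  have "sum_list lam = Suc (sum_list lam')"
    by (rule sum_list_insert_diagram[OF diagram_row_upd[OF lam(3)]]) simp
  then show ?case using lam lam' by (intro exI[of _ lam]) simp
qed

text \<open>A crude bound: each move widens the disturbed region by at most \<open>d\<close>. It
  serves to show that there are finitely many paths of a given length.\<close>

lemma bead_path_bounds:
  assumes "0 < d"
  shows "bead_path d w M \<Longrightarrow> M \<subseteq> {..<d * int (length w)} \<and> {..<- d * int (length w)} \<subseteq> M \<and>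
    set w \<subseteq> {- d * int (length w)..d * int (length w)}"
proof (induction rule: bead_path.induct)
  case (snoc w M x)
  then have x: "x \<in> M" "x + d \<notin> M" by (auto simp: movable_def)
  have M: "M \<subseteq> {..<d * int (length w)}" "{..<- d * int (length w)} \<subseteq> M"
    and w: "set w \<subseteq> {- d * int (length w)..d * int (length w)}" using snoc.IH by auto
  have b: "x < d * int (length w)" "- d * int (length w) \<le> x + d" using x M by force+
  have l: "d * int (length (w @ [x])) = d * int (length w) + d" by (simp add: algebra_simps)
  have "move d x M \<subseteq> {..<d * int (length w) + d}"
    using M(1) b assms by (force simp: move_def)
  moreover have "{..<- d * int (length w) - d} \<subseteq> move d x M"
    using M(2) b assms by (force simp: move_def)
  moreover have "set (w @ [x]) \<subseteq> {- d * int (length w) - d..d * int (length w) + d}"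
    using w b assms by force
  moreover have "- d * int (length (w @ [x])) = - d * int (length w) - d" by (simp add: algebra_simps)
  ultimately show ?case by (simp only: l)
qed simp

lemma finite_bead_paths: "0 < d \<Longrightarrow> finite {w. bead_path d w M \<and> length w = n}"
proof (rule finite_subset[OF _ finite_lists_length_eq[of "{- d * int n..d * int n}" n]])
  assume "0 < d"
  then show "{w. bead_path d w M \<and> length w = n} \<subseteq> {xs. set xs \<subseteq> {- d * int n..d * int n} \<and> length xs = n}"
    using bead_path_bounds[of d _ M] by blast
qed simp


section \<open>Semistandard tableaux as words\<close>

text \<open>The second component is the content minus 1, the starting position of the bead that
  moves when the cell is added. Ordering by entry and then by content is standardisation: equal
  entries are read from left to right.\<close>

definition cell_key :: "(nat \<times> nat \<Rightarrow> nat) \<Rightarrow> nat \<times> nat \<Rightarrow> nat \<times> int" where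
  "cell_key T x = (T x, int (snd x) - int (fst x) - 1)"

definition key_list :: "nat list \<Rightarrow> (nat \<times> nat \<Rightarrow> nat) \<Rightarrow> (nat \<times> int) list" where
  "key_list lam T = sorted_list_of_set (cell_key T ` diagram lam)"

lemma SSYT_outside: "T \<in> SSYT lam \<Longrightarrow> x \<notin> diagram lam \<Longrightarrow> T x = 0"
  unfolding SSYT_def by blast

lemma SSYT_col_less:
  assumes "is_partition lam" "T \<in> SSYT lam" "r < s" "c < row lam s"
  shows "T (r, c) < T (s, c)"
  using assms(3,4)
proof (induction s)
  case (Suc s)
  have "c < row lam s" using row_antimono[OF assms(1), of s "Suc s"] Suc.prems by simp
  then show ?case using Suc SSYT_col[OF assms(2) Suc.prems(2)] by (cases "r = s") auto
qed simp

text \<open>A step down raises the entry; a step to the right keeps or raises the entry and raises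
  the content. Hence the largest key belongs to a removable corner.\<close>

lemma cell_key_less:
  assumes part: "is_partition lam" and T: "T \<in> SSYT lam" and x: "(s, e) \<in> diagram lam"
    and le: "r \<le> s" "c \<le> e" "(r, c) \<noteq> (s, e)"
  shows "cell_key T (r, c) < cell_key T (s, e)"
proof -
  have e: "e < row lam s" using x by simp
  show ?thesis
  proof (cases "r = s")
    case True
    then show ?thesis using le SSYT_row_le[OF T le(2) e] by (auto simp: cell_key_def)
  next
    case False
    have "T (r, c) < T (s, c)" using SSYT_col_less[OF part T, of r s c] False le e by simp
    then show ?thesis using SSYT_row_le[OF T le(2) e] by (auto simp: cell_key_def)
  qed
qed

lemma inj_cell_key:
  assumes part: "is_partition lam" and T: "T \<in> SSYT lam"
  shows "inj_on (cell_key T) (diagram lam)"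
proof (rule inj_onI)
  fix x y assume xy: "x \<in> diagram lam" "y \<in> diagram lam" "cell_key T x = cell_key T y"
  obtain r c s e where [simp]: "x = (r, c)" "y = (s, e)" by (cases x; cases y)
  have d: "int c - int r = int e - int s" using xy(3) by (simp add: cell_key_def)
  show "x = y"
  proof (rule ccontr)
    assume "x \<noteq> y"
    \<comment> \<open>Equal contents put both cells on one diagonal, where any two cells are
      comparable.\<close>
    then consider "r \<le> s" "c \<le> e" | "s \<le> r" "e \<le> c" using d by linarith
    then show False
      using cell_key_less[OF part T, of s e r c] cell_key_less[OF part T, of r c s e] xy \<open>x \<noteq> y\<close>
      by cases auto
  qed
qed

lemma set_key_list [simp]: "set (key_list lam T) = cell_key T ` diagram lam"
  by (simp add: key_list_def)

lemma sorted_key_list [simp]: "sorted_wrt (<) (key_list lam T)"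
  by (simp add: key_list_def)

lemma mset_key_list:
  assumes "is_partition lam" "T \<in> SSYT lam"
  shows "mset (map fst (key_list lam T)) = content lam T"
proof -
  have "mset (key_list lam T) = mset_set (cell_key T ` diagram lam)"
    by (simp add: key_list_def flip: mset_sorted_list_of_multiset) (metis finite_diagram finite_imageI mset_set_set set_sorted_list_of_set distinct_sorted_list_of_set)
  also have "\<dots> = image_mset (cell_key T) (mset_set (diagram lam))"
    by (simp add: image_mset_mset_set inj_cell_key[OF assms])
  finally show ?thesis by (simp add: content_def multiset.map_comp o_def cell_key_def)
qed

lemma key_list_eqI: "sorted_wrt (<) zs \<Longrightarrow> set zs = cell_key T ` diagram lam \<Longrightarrow> key_list lam T = zs"
  unfolding key_list_def by (metis sorted_list_of_set.idem_if_sorted_distinct strict_sorted_iff)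

lemma SSYT_remove_max:
  assumes part: "is_partition lam" and T: "T \<in> SSYT lam" and ne: "diagram lam \<noteq> {}"
  obtains lam' r c where "is_partition lam'" "diagram lam = insert (r, c) (diagram lam')"
    "(r, c) \<notin> diagram lam'" "T((r, c) := 0) \<in> SSYT lam'"
    "key_list lam T = key_list lam' (T((r, c) := 0)) @ [cell_key T (r, c)]"
proof -
  have "Max (cell_key T ` diagram lam) \<in> cell_key T ` diagram lam" using ne by (intro Max_in) auto
  then obtain x where x: "x \<in> diagram lam" "cell_key T x = Max (cell_key T ` diagram lam)" by auto
  obtain r c where rc: "x = (r, c)" by (cases x)
  have max: "cell_key T y < cell_key T x" if "y \<in> diagram lam - {x}" for y
  proof -
    have "cell_key T y \<le> cell_key T x" using x(2) that by simp
    moreover have "cell_key T y \<noteq> cell_key T x"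
      using inj_cell_key[OF part T] that x(1) by (auto simp: inj_on_def)
    ultimately show ?thesis by simp
  qed
  have "\<exists>lam'. is_partition lam' \<and> diagram lam' = diagram lam - {x}"
  proof (rule ex_partition_diagram)
    fix r' c' s e assume a: "(s, e) \<in> diagram lam - {x}" "r' \<le> s" "c' \<le> e"
    then have "(r', c') \<in> diagram lam" using diagram_down_closed[OF part] by blast
    moreover have "(r', c') \<noteq> x"
      using cell_key_less[OF part T, of s e r' c'] max[OF a(1)] a by (metis DiffE insertCI order_less_asym)
    ultimately show "(r', c') \<in> diagram lam - {x}" by blast
  qed simp
  then obtain lam' where lam': "is_partition lam'" "diagram lam' = diagram lam - {x}" by blast
  let ?T = "T(x := 0)"
  have T': "?T \<in> SSYT lam'"
    unfolding SSYT_def mem_Collect_eq lam'(2)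
  proof (intro conjI allI impI)
    fix y assume "y \<notin> diagram lam - {x}" then show "?T y = 0" using SSYT_outside[OF T, of y] by (metis DiffI fun_upd_apply singletonD)
  next
    fix r c assume a: "(r, Suc c) \<in> diagram lam - {x}"
    then have "(r, c) \<noteq> x"
      using cell_key_less[OF part T, of r "Suc c" r c] max[OF a] by (auto simp del: less_prod_simp)
    then show "?T (r, c) \<le> ?T (r, Suc c)" using a SSYT_row[OF T] by auto
  next
    fix r c assume a: "(Suc r, c) \<in> diagram lam - {x}"
    then have "(r, c) \<noteq> x"
      using cell_key_less[OF part T, of "Suc r" c r c] max[OF a] by (auto simp del: less_prod_simp)
    then show "?T (r, c) < ?T (Suc r, c)" using a SSYT_col[OF T] by auto
  qed
  have img: "cell_key ?T ` diagram lam' = cell_key T ` (diagram lam - {x})"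
    unfolding lam'(2) by (rule image_cong) (auto simp: cell_key_def)
  have key: "key_list lam T = key_list lam' ?T @ [cell_key T x]"
  proof (rule key_list_eqI)
    show "sorted_wrt (<) (key_list lam' ?T @ [cell_key T x])"
      using max by (auto simp: sorted_wrt_append img simp del: less_prod_simp)
    show "set (key_list lam' ?T @ [cell_key T x]) = cell_key T ` diagram lam"
      using x(1) by (auto simp: img)
  qed
  have D: "diagram lam = insert (r, c) (diagram lam')" "(r, c) \<notin> diagram lam'"
    using x(1) unfolding lam'(2) rc by blast+
  show ?thesis by (rule that[OF lam'(1) D T'[unfolded rc] key[unfolded rc]])
qed

lemma key_list_path:
  "is_partition lam \<Longrightarrow> T \<in> SSYT lam \<Longrightarrow> bead_path 1 (map snd (key_list lam T)) (maya lam)"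
proof (induction "sum_list lam" arbitrary: lam T rule: less_induct)
  case less
  show ?case
  proof (cases "diagram lam = {}")
    case True
    then have "sum_list lam = 0" by (simp flip: card_diagram)
    then have "lam = []" using less.prems(1) partition_sum_0 by blast
    then show ?thesis unfolding key_list_def True by simp
  next
    case False
    obtain lam' r c where *: "is_partition lam'" "diagram lam = insert (r, c) (diagram lam')"
      "(r, c) \<notin> diagram lam'" "T((r, c) := 0) \<in> SSYT lam'"
      "key_list lam T = key_list lam' (T((r, c) := 0)) @ [cell_key T (r, c)]"
      by (rule SSYT_remove_max[OF less.prems False])
    have "bead_path 1 (map snd (key_list lam' (T((r, c) := 0)))) (maya lam')"
      using less(1)[OF _ *(1,4)] sum_list_insert_diagram[OF *(2,3)] by simp
    moreover have c: "row lam' r = c" "row lam = (row lam')(r := row lam' r + 1)"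
      using row_diagram_insert[OF *(2,3)] by auto
    note move_row[OF less.prems(1) *(1) _ c(2)]
    ultimately show ?thesis
      unfolding *(5) using c(1) by (auto simp: cell_key_def beta_def)
  qed
qed

text \<open>The content of a corner at the end of row \<open>r\<close> is \<open>beta lam r\<close>,
  and the beta numbers are distinct; so the last letter of the word identifies the corner.\<close>

lemma corner_unique:
  assumes lam: "is_partition lam" and "is_partition lam'" "is_partition mu'"
    and "diagram lam = insert (r, c) (diagram lam')" "(r, c) \<notin> diagram lam'"
    and "diagram lam = insert (s, e) (diagram mu')" "(s, e) \<notin> diagram mu'"
    and d: "int c - int r = int e - int s"
  shows "(r, c) = (s, e) \<and> lam' = mu'"
proof -
  have "row lam r = Suc c" "row lam s = Suc e"
    using row_diagram_insert(2)[OF assms(4,5)] row_diagram_insert(2)[OF assms(6,7)] by (metis fun_upd_same)+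
  then have "beta lam r = beta lam s" using d by (simp add: beta_def)
  then have "r = s" using beta_eq_iff[OF lam] by blast
  with d have rc: "(r, c) = (s, e)" by simp
  have "diagram lam' = diagram mu'" using assms(4-7) rc by (metis insert_ident)
  then show ?thesis using rc diagram_inject assms by blast
qed

lemma key_list_inject:
  "is_partition lam \<Longrightarrow> T \<in> SSYT lam \<Longrightarrow> U \<in> SSYT lam \<Longrightarrow> key_list lam T = key_list lam U \<Longrightarrow> T = U"
proof (induction "sum_list lam" arbitrary: lam T U rule: less_induct)
  case less
  show ?case
  proof (cases "diagram lam = {}")
    case True
    then show ?thesis using less.prems by (auto simp: SSYT_def)
  next
    case False
    obtain lam' r c where *: "is_partition lam'" "diagram lam = insert (r, c) (diagram lam')"
      "(r, c) \<notin> diagram lam'" "T((r, c) := 0) \<in> SSYT lam'"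
      "key_list lam T = key_list lam' (T((r, c) := 0)) @ [cell_key T (r, c)]"
      by (rule SSYT_remove_max[OF less.prems(1,2) False])
    obtain mu' s e where **: "is_partition mu'" "diagram lam = insert (s, e) (diagram mu')"
      "(s, e) \<notin> diagram mu'" "U((s, e) := 0) \<in> SSYT mu'"
      "key_list lam U = key_list mu' (U((s, e) := 0)) @ [cell_key U (s, e)]"
      by (rule SSYT_remove_max[OF less.prems(1,3) False])
    have k: "cell_key T (r, c) = cell_key U (s, e)"
      and l: "key_list lam' (T((r, c) := 0)) = key_list mu' (U((s, e) := 0))"
      using *(5) **(5) less.prems(4) by simp_all
    have eq: "(r, c) = (s, e)" "lam' = mu'"
      using corner_unique[OF less.prems(1) *(1) **(1) *(2,3) **(2,3)] k by (auto simp: cell_key_def)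
    have "T((r, c) := 0) = U((r, c) := 0)"
      using less(1)[of lam' "T((r, c) := 0)" "U((r, c) := 0)"] sum_list_insert_diagram[OF *(2,3)] * ** l eq by simp
    moreover have "T (r, c) = U (r, c)" using k eq by (simp add: cell_key_def)
    ultimately show ?thesis by (metis fun_upd_triv fun_upd_upd)
  qed
qed

lemma key_list_surj:
  "sorted_wrt (<) zs \<Longrightarrow> is_partition lam \<Longrightarrow> bead_path 1 (map snd zs) (maya lam) \<Longrightarrow>
    \<exists>T\<in>SSYT lam. key_list lam T = zs"
proof (induction zs arbitrary: lam rule: rev_induct)
  case Nil
  then have "maya lam = maya []" by simp
  then have "lam = []" using Nil maya_inject by (meson is_partition_Nil)
  then show ?case by (intro bexI[of _ "\<lambda>_. 0"]) (simp_all add: SSYT_def key_list_def diagram_row)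
next
  case (snoc z zs)
  obtain a x where z: "z = (a, x)" by (cases z)
  obtain M where M: "bead_path 1 (map snd zs) M" "movable 1 x M" "maya lam = move 1 x M"
    using snoc.prems(3) by (auto simp: z)
  obtain lam' where lam': "is_partition lam'" "maya lam' = M" using bead_path_partition_1[OF M(1)] by blast
  obtain lam2 r where "is_partition lam2" "maya lam2 = move 1 x (maya lam')"
    and row: "row lam2 = (row lam')(r := Suc (row lam' r))" and x: "x = beta lam' r"
    using add_cell[OF lam'(1)] M(2) lam'(2) by blast
  then have "lam2 = lam" using maya_inject snoc.prems(2) M(3) lam'(2) by metis
  with row have row: "row lam = (row lam')(r := Suc (row lam' r))" by simp
  define c where "c = row lam' r"
  have D: "diagram lam = insert (r, c) (diagram lam')" using diagram_row_upd[OF row] by (simp add: c_def)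
  have nD: "(r, c) \<notin> diagram lam'" by (simp add: c_def)
  have "sorted_wrt (<) zs" using snoc.prems(1) by (simp add: sorted_wrt_append)
  then obtain T' where T': "T' \<in> SSYT lam'" "key_list lam' T' = zs" using snoc.IH[OF _ lam'(1)] M(1) lam'(2) by blast
  let ?T = "T'((r, c) := a)"
  have key: "cell_key ?T (r, c) = z" using x by (simp add: cell_key_def z beta_def c_def)
  have less: "cell_key T' y < z" if "y \<in> diagram lam'" for y
    using snoc.prems(1) that unfolding T'(2)[symmetric] by (auto simp: sorted_wrt_append)
  have T: "?T \<in> SSYT lam"
    unfolding SSYT_def mem_Collect_eq D
  proof (intro conjI allI impI)
    fix y assume "y \<notin> insert (r, c) (diagram lam')" then show "?T y = 0" using SSYT_outside[OF T'(1)] by simp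
  next
    fix i j assume ij: "(i, Suc j) \<in> insert (r, c) (diagram lam')"
    show "?T (i, j) \<le> ?T (i, Suc j)"
    proof (cases "(i, Suc j) = (r, c)")
      case True
      then have "(i, j) \<in> diagram lam'" by (auto simp: c_def)
      with less[OF this] True show ?thesis by (auto simp: cell_key_def z)
    next
      case False
      then have "(i, j) \<noteq> (r, c)" using ij by (auto simp: c_def)
      then show ?thesis using False ij SSYT_row[OF T'(1), of j i] by auto
    qed
  next
    fix i j assume ij: "(Suc i, j) \<in> insert (r, c) (diagram lam')"
    show "?T (i, j) < ?T (Suc i, j)"
    proof (cases "(Suc i, j) = (r, c)")
      case True
      then have "(i, j) \<in> diagram lam'"
        using diagram_down_closed[OF snoc.prems(2), of r c i j] D by auto
      \<comment> \<open>The cell above has the larger content, so its smaller key forces a strictly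
        smaller entry.\<close>
      with less[OF this] True x show ?thesis by (auto simp: cell_key_def z beta_def c_def)
    next
      case False
      then have "(i, j) \<noteq> (r, c)" using ij row_antimono[OF lam'(1), of i "Suc i"] by (auto simp: c_def)
      then show ?thesis using False ij SSYT_col[OF T'(1), of j i] by auto
    qed
  qed
  have "key_list lam ?T = zs @ [z]"
  proof (rule key_list_eqI)
    show "sorted_wrt (<) (zs @ [z])" by (rule snoc.prems(1))
    have "cell_key ?T ` diagram lam' = cell_key T' ` diagram lam'"
      using nD by (intro image_cong) (auto simp: cell_key_def)
    then show "set (zs @ [z]) = cell_key ?T ` diagram lam"
      using T'(2) key by (auto simp: D)
  qed
  with T show ?case by blast
qed

text \<open>Standardisation in disguise: the entries form the upper row of a biword and the bead
  path is the standard tableau. This is the expansion of a Schur function into fundamental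
  quasisymmetric functions.\<close>

lemma schur_eq_words_series:
  assumes "is_partition lam"
  shows "schur lam = words_series (\<lambda>_. True) (paths 1 (maya lam))"
proof
  fix M
  have "bij_betw (key_list lam) {T \<in> SSYT lam. content lam T = M}
    {zs. biword (\<lambda>_. True) M zs \<and> map snd zs \<in> paths 1 (maya lam)}"
  proof (rule bij_betwI')
    show "key_list lam T = key_list lam U \<longleftrightarrow> T = U"
      if "T \<in> {T \<in> SSYT lam. content lam T = M}" "U \<in> {T \<in> SSYT lam. content lam T = M}" for T U
      using that key_list_inject[OF assms] by auto
    show "key_list lam T \<in> {zs. biword (\<lambda>_. True) M zs \<and> map snd zs \<in> paths 1 (maya lam)}"
      if "T \<in> {T \<in> SSYT lam. content lam T = M}" for T
      using that key_list_path[OF assms] mset_key_list[OF assms] by (auto simp: biword_def paths_def)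
    show "\<exists>T\<in>{T \<in> SSYT lam. content lam T = M}. zs = key_list lam T"
      if "zs \<in> {zs. biword (\<lambda>_. True) M zs \<and> map snd zs \<in> paths 1 (maya lam)}" for zs
    proof -
      have "sorted_wrt (<) zs" "mset (map fst zs) = M" "bead_path 1 (map snd zs) (maya lam)"
        using that by (simp_all add: biword_def paths_def)
      with key_list_surj[OF _ assms, of zs] obtain T where "T \<in> SSYT lam" "key_list lam T = zs" by blast
      then show ?thesis
        using mset_key_list[OF assms, of T] \<open>mset (map fst zs) = M\<close> by (intro bexI[of _ T]) auto
    qed
  qed
  then show "schur lam M = words_series (\<lambda>_. True) (paths 1 (maya lam)) M"
    unfolding schur_eq words_series_def by (simp add: bij_betw_same_card)
qed


section \<open>Adding a domino\<close>

definition hstep :: "nat list \<Rightarrow> nat \<Rightarrow> nat list \<Rightarrow> bool" where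
  "hstep lam' r lam \<longleftrightarrow> row lam = (row lam')(r := row lam' r + 2)"

definition vstep :: "nat list \<Rightarrow> nat \<Rightarrow> nat list \<Rightarrow> bool" where
  "vstep lam' r lam \<longleftrightarrow> row lam' (Suc r) = row lam' r \<and>
     row lam = (row lam')(r := Suc (row lam' r), Suc r := Suc (row lam' r))"

lemma hstep_diagram:
  assumes "hstep lam' r lam"
  shows "diagram lam' \<subseteq> diagram lam"
    "diagram lam - diagram lam' = {(r, row lam' r), (r, Suc (row lam' r))}"
  using assms by (auto simp: hstep_def diagram_row split: if_splits)

lemma vstep_diagram:
  assumes "vstep lam' r lam"
  shows "diagram lam' \<subseteq> diagram lam"
    "diagram lam - diagram lam' = {(r, row lam' r), (Suc r, row lam' r)}"
  using assms by (auto simp: vstep_def diagram_row split: if_splits)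

lemma row_eq_diff: "diagram lam' \<subseteq> diagram lam \<Longrightarrow>
    row lam' r \<le> row lam r \<and> {c. (r, c) \<in> diagram lam - diagram lam'} = {row lam' r..<row lam r}"
proof -
  assume sub: "diagram lam' \<subseteq> diagram lam"
  have "row lam' r \<le> row lam r"
  proof (rule ccontr)
    assume "\<not> row lam' r \<le> row lam r"
    then have "(r, row lam r) \<in> diagram lam'" by simp
    then have "(r, row lam r) \<in> diagram lam" using sub by blast
    then show False by simp
  qed
  then show ?thesis by auto
qed

lemma domino_cases:
  assumes sub: "diagram lam' \<subseteq> diagram lam" and dom: "is_domino (diagram lam - diagram lam')"
  shows "\<exists>r. hstep lam' r lam \<or> vstep lam' r lam"
proof -
  let ?D = "diagram lam - diagram lam'"
  have le: "row lam' i \<le> row lam i" and seg: "{c. (i, c) \<in> ?D} = {row lam' i..<row lam i}" for i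
    using row_eq_diff[OF sub] by blast+
  have same: "row lam i = row lam' i" if "{c. (i, c) \<in> ?D} = {}" for i
    using seg[of i] le[of i] that by auto
  have one: "row lam' i = c \<and> row lam i = Suc c" if "{c. (i, c) \<in> ?D} = {c}" for i c
  proof -
    have *: "{row lam' i..<row lam i} = {c}" using seg that by simp
    then have "card {row lam' i..<row lam i} = 1" by simp
    then have "row lam i = Suc (row lam' i)" by simp
    then show ?thesis using * by auto
  qed
  obtain r c where "?D = {(r, c), (r, Suc c)} \<or> ?D = {(r, c), (Suc r, c)}"
    using dom by (auto simp: is_domino_def)
  then show ?thesis
  proof
    assume D: "?D = {(r, c), (r, Suc c)}"
    have "{row lam' r..<row lam r} = {c, Suc c}" using seg[of r] unfolding D by auto
    then have "row lam r - row lam' r = 2" using card_atLeastLessThan[of "row lam' r" "row lam r"] by simp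
    then have "row lam r = row lam' r + 2" by simp
    moreover have "row lam i = row lam' i" if "i \<noteq> r" for i using same[of i] that unfolding D by auto
    ultimately have "hstep lam' r lam" by (auto simp: hstep_def)
    then show ?thesis by blast
  next
    assume D: "?D = {(r, c), (Suc r, c)}"
    have "row lam' r = c \<and> row lam r = Suc c" by (rule one) (auto simp: D)
    moreover have "row lam' (Suc r) = c \<and> row lam (Suc r) = Suc c" by (rule one) (auto simp: D)
    moreover have "row lam i = row lam' i" if "i \<noteq> r" "i \<noteq> Suc r" for i
      using same[of i] that unfolding D by auto
    ultimately have "vstep lam' r lam" by (auto simp: vstep_def)
    then show ?thesis by blast
  qed
qed

text \<open>One row grows by 2, so its bead jumps. A bead at the position jumped over would belong
  to a higher row and be overtaken, against the order of the beads.\<close>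

lemma hstep_move:
  assumes lam: "is_partition lam" and lam': "is_partition lam'" and h: "hstep lam' r lam"
  shows "movable 2 (beta lam' r) (maya lam')" "maya lam = move 2 (beta lam' r) (maya lam')"
    "beta lam' r + 1 \<notin> maya lam'"
proof -
  have row: "row lam = (row lam')(r := row lam' r + 2)" using h by (simp add: hstep_def)
  show "movable 2 (beta lam' r) (maya lam')" "maya lam = move 2 (beta lam' r) (maya lam')"
    using move_row[OF lam lam' _ row] by simp_all
  show "beta lam' r + 1 \<notin> maya lam'"
  proof
    assume "beta lam' r + 1 \<in> maya lam'"
    then obtain j where j: "beta lam' j = beta lam' r + 1" by (auto simp: maya_def)
    then have "j < r" using beta_less_iff[OF lam', of r j] by simp
    then have "beta lam r < beta lam j" by (rule beta_strict_antimono[OF lam])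
    moreover have "beta lam j = beta lam' j" "beta lam r = beta lam' r + 2"
      using \<open>j < r\<close> row by (auto simp: beta_def)
    ultimately show False using j by simp
  qed
qed

text \<open>Two neighbouring beads advance by 1 each. As sets, this is the same as the lower row's
  bead jumping by 2 over the other one.\<close>

lemma vstep_move:
  assumes lam: "is_partition lam" and lam': "is_partition lam'" and v: "vstep lam' r lam"
  shows "movable 2 (beta lam' (Suc r)) (maya lam')" "maya lam = move 2 (beta lam' (Suc r)) (maya lam')"
    "beta lam' (Suc r) + 1 = beta lam' r"
proof -
  let ?x = "beta lam' (Suc r)"
  have row: "row lam' (Suc r) = row lam' r"
    "row lam = (row lam')(r := Suc (row lam' r), Suc r := Suc (row lam' r))" using v by (simp_all add: vstep_def)
  show x: "?x + 1 = beta lam' r" using row(1) by (simp add: beta_def)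
  have b: "beta lam = (beta lam')(r := ?x + 2, Suc r := ?x + 1)"
    using row by (auto simp: beta_def fun_eq_iff)
  have n: "?x + 2 \<noteq> beta lam' j" for j
  proof
    assume j: "?x + 2 = beta lam' j"
    then have "beta lam' r < beta lam' j" using x by simp
    then have "j < r" using beta_less_iff[OF lam'] by blast
    then have "beta lam j = beta lam r" using b j by simp
    then show False using beta_eq_iff[OF lam] \<open>j < r\<close> by simp
  qed
  then show "movable 2 ?x (maya lam')" by (auto simp: movable_def maya_def)
  show "maya lam = move 2 ?x (maya lam')"
  proof (intro set_eqI iffI)
    fix y assume "y \<in> maya lam"
    then obtain j where j: "y = beta lam j" by (auto simp: maya_def)
    consider "j = r" | "j = Suc r" | "j \<noteq> r" "j \<noteq> Suc r" by blast
    then show "y \<in> move 2 ?x (maya lam')"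
    proof cases
      case 1 then show ?thesis using j b by (simp add: move_def)
    next
      case 2 then show ?thesis using j b x by (simp add: move_def)
    next
      case 3
      then show ?thesis using j b beta_eq_iff[OF lam', of j "Suc r"] by (simp add: move_def)
    qed
  next
    fix y assume "y \<in> move 2 ?x (maya lam')"
    then consider "y = ?x + 2" | j where "y = beta lam' j" "y \<noteq> ?x"
      by (auto simp: move_def maya_def)
    then show "y \<in> maya lam"
    proof cases
      case 1
      then have "y = beta lam r" using b by simp
      then show ?thesis by simp
    next
      case 2
      then have "j \<noteq> Suc r" by auto
      show ?thesis
      proof (cases "j = r")
        case True
        then have "y = beta lam (Suc r)" using 2 b x by simp
        then show ?thesis by simp
      next
        case False
        then have "y = beta lam j" using 2 b \<open>j \<noteq> Suc r\<close> by simp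
        then show ?thesis by simp
      qed
    qed
  qed
qed

text \<open>The position \<open>x + 1\<close> decides the orientation: the domino is horizontal if
  it is empty and vertical if it is occupied.\<close>

lemma add_domino:
  assumes lam': "is_partition lam'" and mv: "movable 2 x (maya lam')"
  shows "\<exists>lam. is_partition lam \<and> maya lam = move 2 x (maya lam') \<and>
    diagram lam' \<subseteq> diagram lam \<and> is_domino (diagram lam - diagram lam')"
proof -
  have n: "x + 2 \<notin> maya lam'" and "x \<in> maya lam'" using mv by (auto simp: movable_def)
  then obtain r where r: "x = beta lam' r" by (auto simp: maya_def)
  have "\<exists>lam. is_partition lam \<and> ((\<exists>r. hstep lam' r lam \<and> x = beta lam' r) \<or>
      (\<exists>r. vstep lam' r lam \<and> x = beta lam' (Suc r)))"
  proof (cases "x + 1 \<in> maya lam'")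
    case False
    define p where "p = (row lam')(r := row lam' r + 2)"
    have up: "row lam' r + 2 \<le> row lam' i" if "i < r" for i
    proof -
      have "beta lam' (r - 1) \<noteq> x + 1" "beta lam' (r - 1) \<noteq> x + 2" using False n by (metis beta_in_maya)+
      moreover have "beta lam' r < beta lam' (r - 1)" using that by (intro beta_strict_antimono[OF lam']) simp
      ultimately have "row lam' r + 2 \<le> row lam' (r - 1)"
        using that by (simp add: r beta_def of_nat_diff)
      then show ?thesis using row_antimono[OF lam', of i "r - 1"] that by linarith
    qed
    have "antimono p"
      unfolding antimono_def
    proof (intro allI impI)
      fix i j :: nat assume "i \<le> j"
      then show "p j \<le> p i"
        using up[of i] row_antimono[OF lam', of i j]
        by (cases "i < r"; cases "j = r"; cases "i = r") (auto simp: p_def)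
    qed
    moreover have "p (Suc (length lam' + r)) = 0" by (simp add: p_def row_def)
    ultimately obtain lam where "is_partition lam" "row lam = p" using ex_partition_row by blast
    then show ?thesis using r p_def hstep_def by metis
  next
    case True
    then obtain q where q: "x + 1 = beta lam' q" by (auto simp: maya_def)
    then have "q < r" using r beta_less_iff[OF lam', of r q] by simp
    \<comment> \<open>No bead fits between \<open>x\<close> and \<open>x + 1\<close>, so they belong
      to consecutive rows.\<close>
    have "\<not> q < r - 1"
      using beta_strict_antimono[OF lam', of q "r - 1"] beta_strict_antimono[OF lam', of "r - 1" r] q r by linarith
    with \<open>q < r\<close> have rq: "r = Suc q" by simp
    have row: "row lam' (Suc q) = row lam' q" using q r rq by (simp add: beta_def)
    define p where "p = (row lam')(q := Suc (row lam' q), Suc q := Suc (row lam' q))"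
    have up: "Suc (row lam' q) \<le> row lam' i" if "i < q" for i
    proof (rule ccontr)
      assume "\<not> ?thesis"
      then have "row lam' (q - 1) = row lam' q"
        using row_antimono[OF lam', of i "q - 1"] row_antimono[OF lam', of "q - 1" q] that by linarith
      then have "beta lam' (q - 1) = x + 2" using that q by (simp add: beta_def of_nat_diff)
      then show False using n by (metis beta_in_maya)
    qed
    have "antimono p"
      unfolding antimono_def
    proof (intro allI impI)
      fix i j :: nat assume "i \<le> j"
      then show "p j \<le> p i"
        using up[of i] row_antimono[OF lam', of i j] row_antimono[OF lam', of q j] row
        by (cases "i < q"; cases "j = q"; cases "j = Suc q"; cases "i = q"; cases "i = Suc q") (auto simp: p_def)
    qed
    moreover have "p (Suc (length lam' + r)) = 0" by (simp add: p_def row_def rq)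
    ultimately obtain lam where "is_partition lam" "row lam = p" using ex_partition_row by blast
    then show ?thesis using r rq row p_def vstep_def by metis
  qed
  then obtain lam where lam: "is_partition lam"
    and "(\<exists>r. hstep lam' r lam \<and> x = beta lam' r) \<or> (\<exists>r. vstep lam' r lam \<and> x = beta lam' (Suc r))" by blast
  from this(2) show ?thesis
  proof (elim disjE exE conjE)
    fix r assume h: "hstep lam' r lam" "x = beta lam' r"
    then show ?thesis
      using lam hstep_diagram[OF h(1)] hstep_move(2)[OF lam lam' h(1)]
      by (intro exI[of _ lam]) (auto simp: is_domino_def simp del: mem_diagram)
  next
    fix r assume h: "vstep lam' r lam" "x = beta lam' (Suc r)"
    then show ?thesis
      using lam vstep_diagram[OF h(1)] vstep_move(2)[OF lam lam' h(1)]
      by (intro exI[of _ lam]) (auto simp: is_domino_def simp del: mem_diagram)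
  qed
qed

text \<open>The smaller content, minus 1. The cell attaining it is the left one of a horizontal and
  the lower one of a vertical domino, and the value is the bead of its row before the domino is
  added.\<close>

definition domino_letter :: "(nat \<times> nat) set \<Rightarrow> int" where
  "domino_letter D = Min ((\<lambda>(r, c). int c - int r) ` D) - 1"

text \<open>Expressing the rows of a domino by bead counts treats both orientations at once, so the
  descent rule for two dominoes needs no distinction of four cases.\<close>

lemma domino_step:
  assumes lam: "is_partition lam" and lam': "is_partition lam'"
    and sub: "diagram lam' \<subseteq> diagram lam" and dom: "is_domino (diagram lam - diagram lam')"
  defines "D \<equiv> diagram lam - diagram lam'" and "x \<equiv> domino_letter (diagram lam - diagram lam')"
  shows "movable 2 x (maya lam')" "maya lam = move 2 x (maya lam')"
    "Min (fst ` D) = card {b \<in> maya lam'. x + 2 < b}" "Max (fst ` D) = card {b \<in> maya lam'. x < b}"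
    "(\<exists>r c. (r, c) \<in> D \<and> (Suc r, c) \<in> D) \<longleftrightarrow> x + 1 \<in> maya lam'"
proof -
  have "movable 2 x (maya lam') \<and> maya lam = move 2 x (maya lam') \<and>
    Min (fst ` D) = card {b \<in> maya lam'. x + 2 < b} \<and> Max (fst ` D) = card {b \<in> maya lam'. x < b} \<and>
    ((\<exists>r c. (r, c) \<in> D \<and> (Suc r, c) \<in> D) \<longleftrightarrow> x + 1 \<in> maya lam')"
  proof -
    obtain r where "hstep lam' r lam \<or> vstep lam' r lam" using domino_cases[OF sub dom] by blast
    then show ?thesis
    proof
      assume h: "hstep lam' r lam"
      have D: "D = {(r, row lam' r), (r, Suc (row lam' r))}" using hstep_diagram[OF h] D_def by simp
      have x: "x = beta lam' r"
        unfolding x_def D_def[symmetric] D domino_letter_def by (simp add: beta_def)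
      note m = hstep_move[OF lam lam' h, folded x]
      have eq: "{b \<in> maya lam'. x + 2 < b} = {b \<in> maya lam'. x < b}"
      proof -
        have "x + 2 < b \<longleftrightarrow> x < b" if "b \<in> maya lam'" for b
        proof -
          have "b \<noteq> x + 1" "b \<noteq> x + 2" using m that by (auto simp: movable_def)
          then show ?thesis by linarith
        qed
        then show ?thesis by blast
      qed
      have "card {b \<in> maya lam'. x < b} = r" unfolding x by (rule card_beads_above[OF lam'])
      moreover have "\<not> (\<exists>r c. (r, c) \<in> D \<and> (Suc r, c) \<in> D)" unfolding D by auto
      moreover have "fst ` D = {r}" unfolding D by simp
      ultimately show ?thesis using m eq by simp
    next
      assume v: "vstep lam' r lam"
      have D: "D = {(r, row lam' r), (Suc r, row lam' r)}" using vstep_diagram[OF v] D_def by simp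
      have x: "x = beta lam' (Suc r)"
        using v unfolding x_def D_def[symmetric] D domino_letter_def by (simp add: beta_def vstep_def)
      note m = vstep_move[OF lam lam' v, folded x]
      have eq: "{b \<in> maya lam'. x + 2 < b} = {b \<in> maya lam'. beta lam' r < b}"
      proof -
        have "x + 2 < b \<longleftrightarrow> beta lam' r < b" if "b \<in> maya lam'" for b
        proof -
          have "b \<noteq> x + 2" using m that by (auto simp: movable_def)
          then show ?thesis using m(3) by linarith
        qed
        then show ?thesis by blast
      qed
      have "card {b \<in> maya lam'. x < b} = Suc r" unfolding x by (rule card_beads_above[OF lam'])
      moreover have "card {b \<in> maya lam'. x + 2 < b} = r" unfolding eq by (rule card_beads_above[OF lam'])
      moreover have "\<exists>r c. (r, c) \<in> D \<and> (Suc r, c) \<in> D" unfolding D by blast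
      moreover have "fst ` D = {r, Suc r}" unfolding D by simp
      moreover have "x + 1 \<in> maya lam'" using m(3) by simp
      ultimately show ?thesis using m by simp
    qed
  qed
  then show "movable 2 x (maya lam')" "maya lam = move 2 x (maya lam')"
    "Min (fst ` D) = card {b \<in> maya lam'. x + 2 < b}" "Max (fst ` D) = card {b \<in> maya lam'. x < b}"
    "(\<exists>r c. (r, c) \<in> D \<and> (Suc r, c) \<in> D) \<longleftrightarrow> x + 1 \<in> maya lam'" by blast+
qed

lemma finite_beads_above: "is_partition lam \<Longrightarrow> finite {b \<in> maya lam. k < b}"
proof (rule finite_subset)
  assume lam: "is_partition lam"
  show "{b \<in> maya lam. k < b} \<subseteq> {k<..beta lam 0}"
    using beta_less_iff[OF lam, of 0] by (auto simp: maya_def not_less[symmetric])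
qed simp

text \<open>Consecutive moves from \<open>x\<close> and then from \<open>y\<close>: the bottom row of the first domino lies above
  the top row of the second one if and only if the second bead starts to the left of the first.\<close>

lemma beads_above_less_iff:
  assumes fin: "\<And>k. finite {b \<in> M. k < b}"
    and x: "movable 2 x M" and y: "movable 2 y (move 2 x M)"
  shows "y \<noteq> x" "card {b \<in> M. x < b} < card {b \<in> move 2 x M. y + 2 < b} \<longleftrightarrow> y < x"
proof -
  have x': "x \<in> M" "x + 2 \<notin> M" and y': "y \<in> move 2 x M" "y + 2 \<notin> move 2 x M"
    using x y by (auto simp: movable_def)
  show ne: "y \<noteq> x" using y' by (auto simp: move_def)
  have fin': "finite {b \<in> move 2 x M. k < b}" for k
    by (rule finite_subset[of _ "insert (x + 2) {b \<in> M. k < b}"]) (use fin in \<open>auto simp: move_def\<close>)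
  show "card {b \<in> M. x < b} < card {b \<in> move 2 x M. y + 2 < b} \<longleftrightarrow> y < x"
  proof
    assume "y < x"
    \<comment> \<open>Every bead right of \<open>x\<close>, and also the moved bead, lies right of
      \<open>y + 2\<close>; the position \<open>y + 2\<close> itself is free. The moved bead makes
      the count strictly larger.\<close>
    have "insert (x + 2) {b \<in> M. x < b} \<subseteq> {b \<in> move 2 x M. y + 2 < b}"
    proof
      fix b assume b: "b \<in> insert (x + 2) {b \<in> M. x < b}"
      then have "b \<in> move 2 x M" by (auto simp: move_def)
      moreover from this have "b \<noteq> y + 2" using y'(2) by auto
      ultimately show "b \<in> {b \<in> move 2 x M. y + 2 < b}" using b \<open>y < x\<close> by auto
    qed
    then have "card (insert (x + 2) {b \<in> M. x < b}) \<le> card {b \<in> move 2 x M. y + 2 < b}"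
      by (rule card_mono[OF fin'])
    then show "card {b \<in> M. x < b} < card {b \<in> move 2 x M. y + 2 < b}"
      using fin x'(2) by simp
  next
    assume less: "card {b \<in> M. x < b} < card {b \<in> move 2 x M. y + 2 < b}"
    show "y < x"
    proof (rule ccontr)
      assume "\<not> y < x"
      \<comment> \<open>For \<open>y\<close> not left of \<open>x\<close>, the moved bead at
        \<open>x + 2\<close> is not right of \<open>y + 2\<close>, so the beads counted on the left
        are all old ones.\<close>
      then have "{b \<in> move 2 x M. y + 2 < b} \<subseteq> {b \<in> M. x < b}" by (auto simp: move_def)
      then have "card {b \<in> move 2 x M. y + 2 < b} \<le> card {b \<in> M. x < b}" by (rule card_mono[OF fin])
      with less show False by simp
    qed
  qed
qed


section \<open>Domino tableaux as words\<close>

lemma SDT_outside: "T \<in> SDT lam \<Longrightarrow> x \<notin> diagram lam \<Longrightarrow> T x = 0"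
  unfolding SDT_def by blast

lemma SDT_mono:
  assumes part: "is_partition lam" and T: "T \<in> SDT lam" and x: "(s, e) \<in> diagram lam" "r \<le> s" "c \<le> e"
  shows "T (r, c) \<le> T (s, e)"
proof -
  have "T (s, c) \<le> T (s, e)" using x(3,1)
  proof (induction e rule: dec_induct)
    case (step e)
    then have "T (s, e) \<le> T (s, Suc e)" using T by (simp add: SDT_def)
    then show ?case using step by simp
  qed simp
  moreover have "T (r, c) \<le> T (s, c)"
    using x(2) diagram_down_closed[OF part x(1) order_refl x(3)]
  proof (induction s rule: dec_induct)
    case (step s)
    then have "T (s, c) \<le> T (Suc s, c)" using T by (simp add: SDT_def)
    then show ?case using step diagram_down_closed[OF part step.prems, of s c] by simp
  qed simp
  ultimately show ?thesis by simp
qed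

lemma domino_card: "is_domino D \<Longrightarrow> finite D \<and> card D = 2"
  by (auto simp: is_domino_def)

text \<open>The label \<open>Suc n\<close> is the largest, so the cells with smaller labels are
  down-closed and form a shape.\<close>

lemma SDT_restrict:
  assumes part: "is_partition lam" and sz: "sum_list lam = 2 * Suc n" and T: "T \<in> SDT lam"
  defines "T' \<equiv> (\<lambda>x. if T x = Suc n then 0 else T x)"
  obtains lam' where "is_partition lam'" "sum_list lam' = 2 * n" "diagram lam' \<subseteq> diagram lam"
    "diagram lam - diagram lam' = {x. T x = Suc n}" "is_domino {x. T x = Suc n}" "T' \<in> SDT lam'"
proof -
  let ?D = "{x. T x = Suc n}"
  have dom: "is_domino ?D" using T sz by (simp add: SDT_def)
  have D_sub: "?D \<subseteq> diagram lam" using SDT_outside[OF T] by (metis (mono_tags) mem_Collect_eq nat.distinct(1) subsetI)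
  have le: "1 \<le> T x \<and> T x \<le> Suc n" if "x \<in> diagram lam" for x
    using T sz that unfolding SDT_def by auto
  have "\<exists>lam'. is_partition lam' \<and> diagram lam' = diagram lam - ?D"
  proof (rule ex_partition_diagram)
    fix r c s e assume a: "(s, e) \<in> diagram lam - ?D" "r \<le> s" "c \<le> e"
    then have s: "(s, e) \<in> diagram lam" by blast
    then have "(r, c) \<in> diagram lam" using diagram_down_closed[OF part] a by blast
    moreover have "T (r, c) \<le> T (s, e)" by (rule SDT_mono[OF part T s a(2,3)])
    then have "T (r, c) \<noteq> Suc n" using a(1) le[OF s] by simp
    ultimately show "(r, c) \<in> diagram lam - ?D" by blast
  qed simp
  then obtain lam' where lam': "is_partition lam'" "diagram lam' = diagram lam - ?D" by blast
  have sz': "sum_list lam' = 2 * n"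
  proof -
    have "sum_list lam' = sum_list lam - 2"
      using card_Diff_subset[OF _ D_sub] domino_card[OF dom] by (simp flip: card_diagram lam'(2))
    then show ?thesis using sz by simp
  qed
  have "T' \<in> SDT lam'"
    unfolding SDT_def mem_Collect_eq sz'
  proof (intro conjI allI impI ballI)
    fix x assume "x \<notin> diagram lam'"
    then show "T' x = 0" using SDT_outside[OF T, of x] unfolding lam'(2) T'_def by auto
  next
    fix x assume "x \<in> diagram lam'"
    then show "T' x \<in> {1..2 * n div 2}" using le[of x] unfolding lam'(2) T'_def by auto
  next
    fix i assume i: "i \<in> {1..2 * n div 2}"
    then have "{x. T' x = i} = {x. T x = i}" by (auto simp: T'_def)
    then show "is_domino {x. T' x = i}" using T sz i by (simp add: SDT_def)
  next
    fix r c assume "(r, Suc c) \<in> diagram lam'"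
    then have x: "(r, Suc c) \<in> diagram lam" "T (r, Suc c) \<noteq> Suc n" unfolding lam'(2) by blast+
    then show "T' (r, c) \<le> T' (r, Suc c)" using SDT_mono[OF part T x(1), of r c] by (simp add: T'_def)
  next
    fix r c assume "(Suc r, c) \<in> diagram lam'"
    then have x: "(Suc r, c) \<in> diagram lam" "T (Suc r, c) \<noteq> Suc n" unfolding lam'(2) by blast+
    then show "T' (r, c) \<le> T' (Suc r, c)" using SDT_mono[OF part T x(1), of r c] by (simp add: T'_def)
  qed
  moreover have "diagram lam - diagram lam' = ?D" using lam'(2) D_sub by blast
  ultimately show ?thesis using that[OF lam'(1) sz'] lam'(2) dom by blast
qed

lemma SDT_extend:
  assumes part: "is_partition lam" and part': "is_partition lam'" and sz': "sum_list lam' = 2 * n"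
    and sub: "diagram lam' \<subseteq> diagram lam"
    and dom: "is_domino (diagram lam - diagram lam')" and T': "T' \<in> SDT lam'"
  shows "sum_list lam = 2 * Suc n"
    "(\<lambda>x. if x \<in> diagram lam - diagram lam' then Suc n else T' x) \<in> SDT lam" (is "?T \<in> _")
proof -
  let ?D = "diagram lam - diagram lam'"
  have "card (diagram lam) = card (diagram lam') + card ?D"
    using sub by (metis card_Un_disjoint Diff_disjoint Un_Diff_cancel Un_absorb1 finite_Diff finite_diagram)
  then show sz: "sum_list lam = 2 * Suc n"
    using domino_card[OF dom] by (simp add: card_diagram sz')
  have le: "1 \<le> T' x \<and> T' x \<le> n" if "x \<in> diagram lam'" for x using T' sz' that unfolding SDT_def by auto
  have le0: "T' x \<le> n" for x using le[of x] SDT_outside[OF T', of x] by (cases "x \<in> diagram lam'") auto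
  have mono: "?T (r, c) \<le> ?T (s, e)" if x: "(s, e) \<in> diagram lam" "r \<le> s" "c \<le> e" for r c s e
  proof (cases "(s, e) \<in> diagram lam'")
    case True
    then have "(r, c) \<in> diagram lam'" using diagram_down_closed[OF part'] x by blast
    then show ?thesis using SDT_mono[OF part' T' True x(2,3)] True by (simp del: mem_diagram)
  next
    case False
    then show ?thesis using x(1) le0[of "(r, c)"] by (simp del: mem_diagram)
  qed
  show "?T \<in> SDT lam"
    unfolding SDT_def mem_Collect_eq sz
  proof (intro conjI allI impI ballI)
    fix x assume "x \<notin> diagram lam"
    then show "?T x = 0" using SDT_outside[OF T', of x] sub by auto
  next
    fix x assume "x \<in> diagram lam"
    then show "?T x \<in> {1..2 * Suc n div 2}" using le[of x] by auto
  next
    fix i assume i: "i \<in> {1..2 * Suc n div 2}"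
    show "is_domino {x. ?T x = i}"
    proof (cases "i = Suc n")
      case True
      have "{x. ?T x = i} = ?D" using le0 True by (auto simp del: mem_diagram) (metis Suc_n_not_le_n)+
      then show ?thesis using dom by simp
    next
      case False
      have "{x. ?T x = i} = {x. T' x = i}"
      proof (intro set_eqI)
        fix x
        show "x \<in> {x. ?T x = i} \<longleftrightarrow> x \<in> {x. T' x = i}"
          using False i SDT_outside[OF T', of x] by (cases "x \<in> ?D") auto
      qed
      moreover have "i \<in> {1..sum_list lam' div 2}" using i False sz' by auto
      ultimately show ?thesis using T' by (simp add: SDT_def)
    qed
  next
    fix r c assume "(r, Suc c) \<in> diagram lam" then show "?T (r, c) \<le> ?T (r, Suc c)" by (rule mono) auto
  next
    fix r c assume "(Suc r, c) \<in> diagram lam" then show "?T (r, c) \<le> ?T (Suc r, c)" by (rule mono) auto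
  qed
qed

definition tableau_word :: "nat \<Rightarrow> (nat \<times> nat \<Rightarrow> nat) \<Rightarrow> int list" where
  "tableau_word n T = map (\<lambda>i. domino_letter {x. T x = i}) [1..<Suc n]"

lemma length_tableau_word [simp]: "length (tableau_word n T) = n"
  by (simp add: tableau_word_def)

lemma tableau_word_Suc:
  "tableau_word (Suc n) T = tableau_word n (\<lambda>x. if T x = Suc n then 0 else T x) @ [domino_letter {x. T x = Suc n}]"
proof -
  have "tableau_word n (\<lambda>x. if T x = Suc n then 0 else T x) = tableau_word n T"
    unfolding tableau_word_def
  proof (rule map_cong[OF refl])
    fix i assume "i \<in> set [1..<Suc n]"
    then have "{x. (if T x = Suc n then 0 else T x) = i} = {x. T x = i}" by auto
    then show "domino_letter {x. (if T x = Suc n then 0 else T x) = i} = domino_letter {x. T x = i}" by simp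
  qed
  then show ?thesis by (simp add: tableau_word_def)
qed

lemma bead_path_partition_2:
  "bead_path 2 w M \<Longrightarrow> \<exists>lam. is_partition lam \<and> maya lam = M \<and> sum_list lam = 2 * length w"
proof (induction rule: bead_path.induct)
  case Nil then show ?case by (intro exI[of _ "[]"]) simp
next
  case (snoc w M x)
  then obtain lam' where lam': "is_partition lam'" "maya lam' = M" "sum_list lam' = 2 * length w" by blast
  have "movable 2 x (maya lam')" using snoc lam'(2) by simp
  from add_domino[OF lam'(1) this] obtain lam where
    lam: "is_partition lam" "maya lam = move 2 x (maya lam')" "diagram lam' \<subseteq> diagram lam"
    "is_domino (diagram lam - diagram lam')" by blast
  have "card (diagram lam) = card (diagram lam') + card (diagram lam - diagram lam')"
    using lam(3) by (metis card_Un_disjoint Diff_disjoint Un_Diff_cancel Un_absorb1 finite_Diff finite_diagram)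
  then have "sum_list lam = 2 * length (w @ [x])"
    using domino_card[OF lam(4)] lam'(3) by (simp add: card_diagram)
  then show ?case using lam lam' by (intro exI[of _ lam]) simp
qed

lemma tableau_word_path:
  "is_partition lam \<Longrightarrow> sum_list lam = 2 * n \<Longrightarrow> T \<in> SDT lam \<Longrightarrow> bead_path 2 (tableau_word n T) (maya lam)"
proof (induction n arbitrary: lam T)
  case 0
  then have "lam = []" using partition_sum_0 by simp
  then show ?case unfolding tableau_word_def by simp
next
  case (Suc n)
  obtain lam' where lam': "is_partition lam'" "sum_list lam' = 2 * n" "diagram lam' \<subseteq> diagram lam"
    "diagram lam - diagram lam' = {x. T x = Suc n}" "is_domino {x. T x = Suc n}"
    "(\<lambda>x. if T x = Suc n then 0 else T x) \<in> SDT lam'"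
    by (rule SDT_restrict[OF Suc.prems])
  show ?case
    unfolding tableau_word_Suc bead_path_snoc_iff
    using Suc.IH[OF lam'(1,2,6)] domino_step(1,2)[OF Suc.prems(1) lam'(1,3)] lam'(4,5) by auto
qed

lemma move_source_unique: "d \<noteq> 0 \<Longrightarrow> movable d x M \<Longrightarrow> movable d y M \<Longrightarrow> move d x M = move d y M \<Longrightarrow> x = y"
proof -
  assume d: "d \<noteq> 0" and x: "movable d x M" and eq: "move d x M = move d y M"
  have "x \<notin> move d x M" using d by (simp add: move_def)
  then have "x \<notin> move d y M" unfolding eq .
  then show "x = y" using x by (simp add: move_def movable_def)
qed

text \<open>The last letter and the final bead set determine the bead set before the last move,
  hence the smaller shape and the position of the last domino.\<close>

lemma tableau_word_inject:
  "is_partition lam \<Longrightarrow> sum_list lam = 2 * n \<Longrightarrow> T \<in> SDT lam \<Longrightarrow> U \<in> SDT lam \<Longrightarrow>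
    tableau_word n T = tableau_word n U \<Longrightarrow> T = U"
proof (induction n arbitrary: lam T U)
  case 0
  then have "lam = []" using partition_sum_0 by simp
  then have "diagram lam = {}" by (simp add: diagram_row)
  then show ?case using SDT_outside[OF 0(3)] SDT_outside[OF 0(4)] by (auto simp: fun_eq_iff)
next
  case (Suc n)
  let ?T = "\<lambda>x. if T x = Suc n then 0 else T x" and ?U = "\<lambda>x. if U x = Suc n then 0 else U x"
  obtain lam' where lam': "is_partition lam'" "sum_list lam' = 2 * n" "diagram lam' \<subseteq> diagram lam"
    "diagram lam - diagram lam' = {x. T x = Suc n}" "is_domino {x. T x = Suc n}" "?T \<in> SDT lam'"
    by (rule SDT_restrict[OF Suc.prems(1,2,3)])
  obtain mu' where mu': "is_partition mu'" "sum_list mu' = 2 * n" "diagram mu' \<subseteq> diagram lam"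
    "diagram lam - diagram mu' = {x. U x = Suc n}" "is_domino {x. U x = Suc n}" "?U \<in> SDT mu'"
    by (rule SDT_restrict[OF Suc.prems(1,2,4)])
  have eq: "tableau_word n ?T = tableau_word n ?U" "domino_letter {x. T x = Suc n} = domino_letter {x. U x = Suc n}"
    using Suc.prems(5) by (simp_all add: tableau_word_Suc)
  have "maya lam' = maya mu'"
    using domino_step(1,2)[OF Suc.prems(1) lam'(1,3)] domino_step(1,2)[OF Suc.prems(1) mu'(1,3)]
      lam'(4,5) mu'(4,5) eq(2) move_inject by metis
  then have lm: "lam' = mu'" using maya_inject lam'(1) mu'(1) by blast
  then have "?T = ?U" using Suc.IH[OF lam'(1,2,6) _ eq(1)] mu'(6) by blast
  moreover have "{x. T x = Suc n} = {x. U x = Suc n}" using lm lam'(4) mu'(4) by simp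
  then have "T x = Suc n \<longleftrightarrow> U x = Suc n" for x by blast
  ultimately show ?case by (metis ext)
qed

lemma tableau_word_surj:
  "is_partition lam \<Longrightarrow> sum_list lam = 2 * n \<Longrightarrow> bead_path 2 w (maya lam) \<Longrightarrow> \<exists>T\<in>SDT lam. tableau_word n T = w"
proof (induction w arbitrary: lam n rule: rev_induct)
  case Nil
  then have "maya lam = maya []" by simp
  then have "lam = []" using Nil maya_inject by (meson is_partition_Nil)
  then show ?case using Nil(2) by (intro bexI[of _ "\<lambda>_. 0"]) (auto simp: SDT_def tableau_word_def diagram_row)
next
  case (snoc x w)
  obtain M where M: "bead_path 2 w M" "movable 2 x M" "maya lam = move 2 x M"
    using snoc.prems(3) by auto
  obtain lam' where lam': "is_partition lam'" "maya lam' = M" "sum_list lam' = 2 * length w"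
    using bead_path_partition_2[OF M(1)] by blast
  obtain lam2 where "is_partition lam2" "maya lam2 = move 2 x (maya lam')"
    and D: "diagram lam' \<subseteq> diagram lam2" "is_domino (diagram lam2 - diagram lam')"
    using add_domino[OF lam'(1)] M(2) lam'(2) by blast
  then have "lam2 = lam" using maya_inject snoc.prems(1) M(3) lam'(2) by metis
  note D = D[unfolded this]
  obtain T' where T': "T' \<in> SDT lam'" "tableau_word (length w) T' = w"
    using snoc.IH[OF lam'(1,3)] M(1) lam'(2) by blast
  let ?T = "\<lambda>x. if x \<in> diagram lam - diagram lam' then Suc (length w) else T' x"
  note ext = SDT_extend[OF snoc.prems(1) lam'(1,3) D T'(1)]
  have n: "n = Suc (length w)" using ext(1) snoc.prems(2) by simp
  have le0: "T' y \<le> length w" for y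
    using T'(1) lam'(3) SDT_outside[OF T'(1), of y] unfolding SDT_def by (cases "y \<in> diagram lam'") auto
  then have no: "T' y \<noteq> Suc (length w)" for y by (metis Suc_n_not_le_n)
  have DT: "{y. ?T y = Suc (length w)} = diagram lam - diagram lam'" using no by auto
  have "(if ?T y = Suc (length w) then 0 else ?T y) = T' y" for y
    using no[of y] SDT_outside[OF T'(1), of y] by auto
  then have restr: "(\<lambda>y. if ?T y = Suc (length w) then 0 else ?T y) = T'" by blast
  note st = domino_step(1,2)[OF snoc.prems(1) lam'(1) D]
  have "domino_letter (diagram lam - diagram lam') = x"
    by (rule move_source_unique[of 2 _ "maya lam'"]) (use st M lam'(2) in simp_all)
  then have "tableau_word n ?T = w @ [x]"
    unfolding n tableau_word_Suc restr DT T'(2) by simp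
  then show ?case using ext(2) by blast
qed

lemma word_Des_snoc: "word_Des t (w @ [x]) = word_Des t w \<union> {i. i = length w \<and> x \<le> (t # w) ! length w}"
proof -
  have "(t # w @ [x]) ! i = (t # w) ! i" if "i \<le> length w" for i
    using that by (cases i) (auto simp: nth_append)
  moreover have "(t # w @ [x]) ! Suc (length w) = x" by simp
  ultimately show ?thesis
    unfolding word_Des_def by (auto simp: less_Suc_eq simp del: nth_Cons_Suc)
qed

text \<open>A new largest label affects the descent at \<open>n\<close> alone. Positivity of
  \<open>n\<close> separates this from the descent 0, which depends on the orientation of a single
  domino.\<close>

lemma DesT_Suc:
  assumes "0 < n"
  shows "DesT (Suc n) T = DesT n (\<lambda>x. if T x = Suc n then 0 else T x) \<union>
    {i. i = n \<and> (\<forall>x y. T x = n \<and> T y = Suc n \<longrightarrow> fst x < fst y)}"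
proof -
  let ?T = "\<lambda>x. if T x = Suc n then 0 else T x"
  have eq: "?T x = i \<longleftrightarrow> T x = i" if "0 < i" "i \<le> n" for x i using that by auto
  have v: "vertical ?T 1 \<longleftrightarrow> vertical T 1" using eq[of 1] assms by (simp add: vertical_def)
  show ?thesis
  proof (rule set_eqI)
    fix i
    consider "i = 0" | "0 < i" "i < n" | "i = n" | "n < i" by linarith
    then show "i \<in> DesT (Suc n) T \<longleftrightarrow>
        i \<in> DesT n ?T \<union> {i. i = n \<and> (\<forall>x y. T x = n \<and> T y = Suc n \<longrightarrow> fst x < fst y)}"
    proof cases
      case 1 then show ?thesis using assms v by (simp add: DesT_def)
    next
      case 2
      then show ?thesis using eq[of i] eq[of "Suc i"] by (simp add: DesT_def)
    next
      case 3 then show ?thesis using assms by (simp add: DesT_def)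
    next
      case 4 then show ?thesis using assms by (simp add: DesT_def)
    qed
  qed
qed

text \<open>For consecutive labels, lying strictly below means that the bottom row of the first
  domino is above the top row of the second. In bead counts this compares the two letters.\<close>

lemma Des_tableau_word:
  "is_partition lam \<Longrightarrow> sum_list lam = 2 * n \<Longrightarrow> T \<in> SDT lam \<Longrightarrow> DesT n T = word_Des (-2) (tableau_word n T)"
proof (induction n arbitrary: lam T)
  case 0
  then show ?case by (simp add: DesT_def word_Des_def)
next
  case (Suc n)
  let ?T = "\<lambda>x. if T x = Suc n then 0 else T x"
  let ?D = "{x. T x = Suc n}"
  obtain lam' where lam': "is_partition lam'" "sum_list lam' = 2 * n" "diagram lam' \<subseteq> diagram lam"
    "diagram lam - diagram lam' = ?D" "is_domino ?D" "?T \<in> SDT lam'"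
    by (rule SDT_restrict[OF Suc.prems])
  note st = domino_step[OF Suc.prems(1) lam'(1,3), unfolded lam'(4), OF lam'(5)]
  show ?case
  proof (cases n)
    case 0
    then have "lam' = []" using lam'(1,2) partition_sum_0 by simp
    then have M: "maya lam' = {..<0}" by simp
    let ?x = "domino_letter ?D"
    \<comment> \<open>From the ground state a bead starts at a negative position and lands at a
      nonnegative one, so the letter is -1 or -2. In the second case the bead jumps over the
      occupied position -1, and the domino is vertical.\<close>
    have "?x < 0" "0 \<le> ?x + 2" using st(1) unfolding movable_def M by auto
    moreover have "vertical T 1 \<longleftrightarrow> ?x + 1 < 0" using st(5) unfolding M vertical_def 0 by simp
    ultimately have "vertical T 1 \<longleftrightarrow> ?x \<le> -2" by linarith
    moreover have "tableau_word (Suc n) T = [?x]" unfolding tableau_word_Suc by (simp add: 0 tableau_word_def)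
    ultimately show ?thesis using 0 by (auto simp: DesT_def word_Des_def)
  next
    case (Suc k)
    let ?D' = "{x. ?T x = Suc k}"
    obtain lam'' where lam'': "is_partition lam''" "diagram lam'' \<subseteq> diagram lam'"
      "diagram lam' - diagram lam'' = ?D'" "is_domino ?D'"
      by (rule SDT_restrict[OF lam'(1) lam'(2)[unfolded Suc] lam'(6)])
    have D': "?D' = {x. T x = n}" using Suc by auto
    note lam'' = lam''[unfolded D']
    let ?E = "{x. T x = n}"
    note st' = domino_step[OF lam'(1) lam''(1,2), unfolded lam''(3), OF lam''(4)]
    let ?x = "domino_letter ?E" and ?y = "domino_letter ?D"
    have fin: "finite ?E" "?E \<noteq> {}" "finite ?D" "?D \<noteq> {}"
      using lam''(4) lam'(5) by (auto simp: is_domino_def)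
    have "(\<forall>x y. T x = n \<and> T y = Suc n \<longrightarrow> fst x < fst y) \<longleftrightarrow> Max (fst ` ?E) < Min (fst ` ?D)"
      using fin by (subst Max_less_iff) (auto simp del: Min_gr_iff simp: Min_gr_iff[of "fst ` ?D"])
    also have "\<dots> \<longleftrightarrow> card {b \<in> maya lam''. ?x < b} < card {b \<in> maya lam'. ?y + 2 < b}"
      using st(3) st'(4) by simp
    also have "\<dots> \<longleftrightarrow> ?y < ?x"
      using beads_above_less_iff(2)[OF finite_beads_above[OF lam''(1)] st'(1), of ?y] st(1) st'(2) by simp
    \<comment> \<open>Consecutive moves never start at the same position, so the weak comparison in
      \<open>word_Des\<close> agrees with the strict one.\<close>
    also have "\<dots> \<longleftrightarrow> ?y \<le> ?x"
      using beads_above_less_iff(1)[OF finite_beads_above[OF lam''(1)] st'(1), of ?y] st(1) st'(2) by auto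
    finally have des: "(\<forall>x y. T x = n \<and> T y = Suc n \<longrightarrow> fst x < fst y) \<longleftrightarrow> ?y \<le> ?x" .
    have "(-2 # tableau_word n ?T) ! n = ?x"
      unfolding Suc tableau_word_Suc[of k] using D' unfolding Suc by (simp add: nth_append)
    then show ?thesis
      unfolding tableau_word_Suc word_Des_snoc length_tableau_word
      using DesT_Suc[of n T] Suc.IH[OF lam'(1,2,6)] des Suc by simp
  qed
qed

lemma tableau_word_bij:
  assumes "is_partition lam" "sum_list lam = 2 * n"
  shows "bij_betw (tableau_word n) (SDT lam) (paths 2 (maya lam))"
proof (rule bij_betw_imageI)
  show "inj_on (tableau_word n) (SDT lam)" using tableau_word_inject[OF assms] by (rule inj_onI)
  show "tableau_word n ` SDT lam = paths 2 (maya lam)"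
  proof
    show "tableau_word n ` SDT lam \<subseteq> paths 2 (maya lam)"
      using tableau_word_path[OF assms] by (auto simp: paths_def)
    show "paths 2 (maya lam) \<subseteq> tableau_word n ` SDT lam"
    proof
      fix w assume "w \<in> paths 2 (maya lam)"
      then obtain T where "T \<in> SDT lam" "tableau_word n T = w"
        using tableau_word_surj[OF assms, of w] by (auto simp: paths_def)
      then show "w \<in> tableau_word n ` SDT lam" by blast
    qed
  qed
qed


section \<open>The 2-quotient\<close>

definition runner :: "int \<Rightarrow> int set \<Rightarrow> int set" where
  "runner e M = {k. 2 * k + e \<in> M}"

lemma mem_runner [simp]: "k \<in> runner e M \<longleftrightarrow> 2 * k + e \<in> M"
  by (simp add: runner_def)

lemma runner_eqI: "runner 0 M = runner 0 M' \<Longrightarrow> runner 1 M = runner 1 M' \<Longrightarrow> M = M'"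
proof (rule set_eqI)
  fix y :: int
  assume eq: "runner 0 M = runner 0 M'" "runner 1 M = runner 1 M'"
  have "y = 2 * (y div 2) + 0 \<or> y = 2 * (y div 2) + 1" by linarith
  then show "y \<in> M \<longleftrightarrow> y \<in> M'" using eq by (metis mem_runner)
qed

definition interleave :: "int set \<Rightarrow> int set \<Rightarrow> int set" where
  "interleave A B = {y. if even y then y div 2 \<in> A else y div 2 \<in> B}"

lemma runner_interleave [simp]: "runner 0 (interleave A B) = A" "runner 1 (interleave A B) = B"
  by (auto simp: interleave_def)

lemma interleave_runner [simp]: "interleave (runner 0 M) (runner 1 M) = M"
  by (rule runner_eqI) simp_all

lemma movable_interleave_even: "movable 2 (2 * k) (interleave A B) \<longleftrightarrow> movable 1 k A"
  and movable_interleave_odd: "movable 2 (2 * k + 1) (interleave A B) \<longleftrightarrow> movable 1 k B"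
  by (simp_all add: movable_def interleave_def add.commute)

lemma move_interleave_even: "move 2 (2 * k) (interleave A B) = interleave (move 1 k A) B"
proof (rule set_eqI)
  fix y :: int
  show "y \<in> move 2 (2 * k) (interleave A B) \<longleftrightarrow> y \<in> interleave (move 1 k A) B"
    by (cases "even y") (auto simp: move_def interleave_def elim!: evenE)
qed

lemma move_interleave_odd: "move 2 (2 * k + 1) (interleave A B) = interleave A (move 1 k B)"
proof (rule set_eqI)
  fix y :: int
  show "y \<in> move 2 (2 * k + 1) (interleave A B) \<longleftrightarrow> y \<in> interleave A (move 1 k B)"
    by (cases "even y") (auto simp: move_def interleave_def elim!: oddE)
qed

definition even_part :: "int list \<Rightarrow> int list" where
  "even_part w = map (\<lambda>x. x div 2) (filter even w)"

definition odd_part :: "int list \<Rightarrow> int list" where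
  "odd_part w = map (\<lambda>x. x div 2) (filter odd w)"

text \<open>A jump by 2 keeps the parity, so it is a jump by 1 on one runner and leaves the other
  alone. The order between moves on different runners is free.\<close>

lemma bead_path_interleave:
  "bead_path 2 w (interleave A B) \<longleftrightarrow> bead_path 1 (even_part w) A \<and> bead_path 1 (odd_part w) B"
proof (induction w arbitrary: A B rule: rev_induct)
  case Nil
  have "interleave A B = {..<0} \<longleftrightarrow> A = {..<0} \<and> B = {..<0}"
  proof
    assume "interleave A B = {..<0}"
    then have "runner 0 (interleave A B) = runner 0 {..<0}" "runner 1 (interleave A B) = runner 1 {..<0}" by simp_all
    then show "A = {..<0} \<and> B = {..<0}" by auto
  next
    assume "A = {..<0} \<and> B = {..<0}"
    then show "interleave A B = {..<0}" by (auto simp: interleave_def)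
  qed
  then show ?case by (simp add: even_part_def odd_part_def)
next
  case (snoc x w)
  have step: "bead_path 2 (w @ [x]) (interleave A B) \<longleftrightarrow>
      (\<exists>A' B'. bead_path 2 w (interleave A' B') \<and> movable 2 x (interleave A' B') \<and>
        interleave A B = move 2 x (interleave A' B'))"
    unfolding bead_path_snoc_iff by (metis interleave_runner)
  have inj: "interleave A B = interleave A' B' \<longleftrightarrow> A = A' \<and> B = B'" for A B A' B'
    by (metis runner_interleave)
  show ?case
  proof (cases "even x")
    case True
    then obtain k where x: "x = 2 * k" by blast
    have p: "even_part (w @ [x]) = even_part w @ [k]" "odd_part (w @ [x]) = odd_part w"
      by (simp_all add: even_part_def odd_part_def x)
    show ?thesis
      unfolding p step
      by (auto simp: x movable_interleave_even move_interleave_even inj snoc.IH)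
  next
    case False
    then obtain k where x: "x = 2 * k + 1" by (elim oddE)
    have p: "even_part (w @ [x]) = even_part w" "odd_part (w @ [x]) = odd_part w @ [k]"
      by (simp_all add: even_part_def odd_part_def x)
    show ?thesis
      unfolding p step
      by (auto simp: x movable_interleave_odd move_interleave_odd inj snoc.IH)
  qed
qed

text \<open>Brings the runner decomposition into the form of \<open>words_series_shuffle\<close>,
  with parity separating the two alphabets.\<close>

lemma paths_interleave:
  "paths 2 (interleave A B) = {w. filter even w \<in> map (\<lambda>k. 2 * k) ` paths 1 A \<and>
     filter odd w \<in> map (\<lambda>k. 2 * k + 1) ` paths 1 B}"
proof -
  have e: "filter even w \<in> map (\<lambda>k. 2 * k) ` U \<longleftrightarrow> even_part w \<in> U" for w U
  proof
    assume "filter even w \<in> map (\<lambda>k. 2 * k) ` U"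
    then show "even_part w \<in> U" by (auto simp: even_part_def o_def)
  next
    assume "even_part w \<in> U"
    moreover have "filter even w = map (\<lambda>k. 2 * k) (even_part w)"
      unfolding even_part_def map_map o_def by (rule map_idI[symmetric]) simp
    ultimately show "filter even w \<in> map (\<lambda>k. 2 * k) ` U" by blast
  qed
  have o: "filter odd w \<in> map (\<lambda>k. 2 * k + 1) ` U \<longleftrightarrow> odd_part w \<in> U" for w U
  proof
    assume "filter odd w \<in> map (\<lambda>k. 2 * k + 1) ` U"
    then show "odd_part w \<in> U" by (auto simp: odd_part_def o_def)
  next
    assume "odd_part w \<in> U"
    moreover have "filter odd w = map (\<lambda>k. 2 * k + 1) (odd_part w)"
      unfolding odd_part_def map_map o_def by (rule map_idI[symmetric]) simp
    ultimately show "filter odd w \<in> map (\<lambda>k. 2 * k + 1) ` U" by blast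
  qed
  show ?thesis unfolding e o by (simp add: paths_def bead_path_interleave)
qed

lemma bead_path_hd: "bead_path d w M \<Longrightarrow> w \<noteq> [] \<Longrightarrow> hd w < 0 \<and> 0 \<le> hd w + d"
proof (induction rule: bead_path.induct)
  case (snoc w M x)
  show ?case
  proof (cases "w = []")
    case True
    then show ?thesis using snoc.hyps by (auto simp: movable_def)
  next
    case False
    then show ?thesis using snoc.IH by simp
  qed
qed simp

lemma finite_paths:
  assumes "is_partition lam"
  shows "finite (paths 1 (maya lam))"
proof (rule finite_subset[OF _ finite_bead_paths[of 1 "maya lam" "sum_list lam"]])
  show "paths 1 (maya lam) \<subseteq> {w. bead_path 1 w (maya lam) \<and> length w = sum_list lam}"
  proof
    fix w assume "w \<in> paths 1 (maya lam)"
    then have w: "bead_path 1 w (maya lam)" by (simp add: paths_def)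
    from bead_path_partition_1[OF this] obtain mu where
      "is_partition mu" "maya mu = maya lam" "sum_list mu = length w" by blast
    then show "w \<in> {w. bead_path 1 w (maya lam) \<and> length w = sum_list lam}"
      using maya_inject[OF _ assms, of mu] w by auto
  qed
qed simp

text \<open>A bead path starts with the letter \<open>-1\<close>.  Therefore the boundary condition on the letters paired
  with \<open>0\<close> is void on the odd runner and excludes the entry \<open>0\<close> on the even runner.\<close>

lemma words_series_odd_runner:
  "words_series (\<lambda>k. -2 < 2 * k + 1) (paths 1 M) = words_series (\<lambda>_. True) (paths 1 M)"
proof
  fix A
  have "biword (\<lambda>k. -2 < 2 * k + 1) A zs"
    if "biword (\<lambda>_. True) A zs" "map snd zs \<in> paths 1 M" for zs
  proof -
    have "-2 < 2 * x + 1" if "(0, x) \<in> set zs" for x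
    proof -
      obtain z zs' where zs: "zs = z # zs'" using \<open>(0, x) \<in> set zs\<close> by (cases zs) auto
      have "snd z = -1"
        using bead_path_hd[of 1 "map snd zs" M] \<open>map snd zs \<in> paths 1 M\<close> by (simp add: paths_def zs)
      \<comment> \<open>The first pair is the smallest. If an index 0 occurs anywhere, the first
        index is 0, so \<open>x\<close> is at least the first letter -1 and \<open>2 * x + 1\<close>
        exceeds -2.\<close>
      moreover have "z \<le> (0, x)"
        using \<open>biword (\<lambda>_. True) A zs\<close> that by (auto simp: biword_def zs intro: less_imp_le)
      ultimately show ?thesis by (cases z) auto
    qed
    with that show ?thesis by (auto simp: biword_def)
  qed
  then have "{zs. biword (\<lambda>k. -2 < 2 * k + 1) A zs \<and> map snd zs \<in> paths 1 M} =
    {zs. biword (\<lambda>_. True) A zs \<and> map snd zs \<in> paths 1 M}"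
    by (auto simp: biword_def)
  then show "words_series (\<lambda>k. -2 < 2 * k + 1) (paths 1 M) A = words_series (\<lambda>_. True) (paths 1 M) A"
    by (simp add: words_series_def)
qed

lemma words_series_even_runner:
  "words_series (\<lambda>k. -2 < 2 * k) (paths 1 M) = drop_zero (words_series (\<lambda>_. True) (paths 1 M))"
proof
  fix A
  show "words_series (\<lambda>k. -2 < 2 * k) (paths 1 M) A = drop_zero (words_series (\<lambda>_. True) (paths 1 M)) A"
  proof (cases "0 \<in># A")
    case True
    have "\<not> biword (\<lambda>k. -2 < 2 * k) A zs" if "map snd zs \<in> paths 1 M" for zs
    proof
      assume bw: "biword (\<lambda>k. -2 < 2 * k) A zs"
      then have "0 \<in> set (map fst zs)" using True by (metis biword_def set_mset_mset)
      then obtain x where x: "(0, x) \<in> set zs" by auto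
      then obtain z zs' where zs: "zs = z # zs'" by (cases zs) auto
      have "snd z = -1"
        using bead_path_hd[of 1 "map snd zs" M] that by (simp add: paths_def zs)
      moreover have "z \<le> (0, x)" using bw x by (auto simp: biword_def zs intro: less_imp_le)
      \<comment> \<open>An occurring index 0 also occurs in the first pair, whose letter -1 is the
        tie of \<open>2 * (-1)\<close> with the threshold -2.\<close>
      ultimately have "z = (0, -1)" by (cases z) auto
      then show False using bw by (simp add: biword_def zs)
    qed
    then have "{zs. biword (\<lambda>k. -2 < 2 * k) A zs \<and> map snd zs \<in> paths 1 M} = {}" by blast
    then have "words_series (\<lambda>k. -2 < 2 * k) (paths 1 M) A = 0"
      unfolding words_series_def by (metis card.empty of_nat_0)
    then show ?thesis using True by (simp add: drop_zero_def)
  next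
    case False
    have "biword (\<lambda>k. -2 < 2 * k) A zs \<longleftrightarrow> biword (\<lambda>_. True) A zs" for zs :: "(nat \<times> int) list"
    proof -
      have "0 \<notin> fst ` set zs" if "mset (map fst zs) = A"
        using False that by (metis set_map set_mset_mset)
      then show ?thesis by (force simp: biword_def)
    qed
    then show ?thesis using False by (simp add: drop_zero_def words_series_def)
  qed
qed

definition domino_series :: "nat list \<Rightarrow> series" where
  "domino_series lam = words_series (\<lambda>x. -2 < x) (paths 2 (maya lam))"

text \<open>Even and odd letters are separate alphabets, and a path on both runners is an arbitrary
  shuffle. The strictly monotone maps \<open>2 * k\<close> and \<open>2 * k + 1\<close> then carry
  the threshold over to the runners.\<close>

lemma domino_series_factor:
  assumes "is_partition al" "is_partition be"
    and "runner 0 (maya lam) = maya al" "runner 1 (maya lam) = maya be"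
  shows "domino_series lam = series_mult (drop_zero (schur al)) (schur be)"
proof -
  have sm: "strict_mono (\<lambda>k::int. 2 * k)" "strict_mono (\<lambda>k::int. 2 * k + 1)" by (simp_all add: strict_mono_def)
  have "maya lam = interleave (maya al) (maya be)" using assms(3,4) by (metis interleave_runner)
  then have "domino_series lam = words_series (\<lambda>x. -2 < x)
    {w. filter even w \<in> map (\<lambda>k. 2 * k) ` paths 1 (maya al) \<and> filter odd w \<in> map (\<lambda>k. 2 * k + 1) ` paths 1 (maya be)}"
    unfolding domino_series_def by (simp only: paths_interleave)
  also have "\<dots> = series_mult (words_series (\<lambda>x. -2 < x) (map (\<lambda>k. 2 * k) ` paths 1 (maya al)))
      (words_series (\<lambda>x. -2 < x) (map (\<lambda>k. 2 * k + 1) ` paths 1 (maya be)))"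
    by (rule words_series_shuffle) (use finite_paths assms(1,2) in auto)
  finally show ?thesis
    unfolding words_series_map_strict_mono[OF sm(1)] words_series_map_strict_mono[OF sm(2)]
      words_series_odd_runner words_series_even_runner
    by (simp add: schur_eq_words_series assms(1,2))
qed


subsection \<open>Reading off the quotient\<close>

text \<open>The finite bead set is the infinite one shifted by the number of beads and cut off at 0.
  This number is even, so the shift preserves the runners.\<close>

lemma beta_set_maya: "beta_set lam = {b. int b - 2 * int (length lam) \<in> maya lam}"
proof -
  let ?N = "2 * length lam"
  have b: "int (row lam i + (?N - Suc i)) - 2 * int (length lam) = beta lam i" if "i < ?N" for i
    using that by (simp add: beta_def of_nat_diff)
  have "beta_set lam = {row lam i + (?N - Suc i) |i. i < ?N}"
    by (simp add: beta_set_def row_def Let_def)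
  also have "\<dots> = {b. int b - 2 * int (length lam) \<in> maya lam}"
  proof (intro set_eqI iffI)
    fix y assume "y \<in> {row lam i + (?N - Suc i) |i. i < ?N}"
    then obtain i where "y = row lam i + (?N - Suc i)" "i < ?N" by blast
    then have "int y - 2 * int (length lam) = beta lam i" using b by blast
    then show "y \<in> {b. int b - 2 * int (length lam) \<in> maya lam}" by simp
  next
    fix y assume "y \<in> {b. int b - 2 * int (length lam) \<in> maya lam}"
    then obtain i where i: "int y - 2 * int (length lam) = beta lam i" by (auto simp: maya_def)
    have "i < ?N"
    proof (rule ccontr)
      assume "\<not> i < ?N"
      then show False using i by (simp add: beta_def row_def split: if_splits)
    qed
    moreover have "y = row lam i + (?N - Suc i)" using b[OF \<open>i < ?N\<close>] i by linarith
    ultimately show "y \<in> {row lam i + (?N - Suc i) |i. i < ?N}" by blast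
  qed
  finally show ?thesis .
qed

lemma maya_small:
  assumes "x < - int (length lam)"
  shows "x \<in> maya lam"
proof -
  have "\<not> nat (- x - 1) < length lam" using assms by linarith
  then have "x = beta lam (nat (- x - 1))" using assms by (simp add: beta_def row_def)
  then show ?thesis by (metis beta_in_maya)
qed

text \<open>The bead of row i sits at \<open>row kap i + L - i - 1\<close> after the shift and has
  \<open>L - i - 1\<close> beads to its left, which leaves \<open>row kap i\<close> gaps. Since all
  positions below \<open>- int L\<close> are occupied, the cut at 0 loses no gap.\<close>

lemma partition_of_beads_maya:
  assumes part: "is_partition kap" and small: "\<And>x. x < - int L \<Longrightarrow> x \<in> maya kap"
  shows "partition_of_beads {b. int b - int L \<in> maya kap} = kap"
proof -
  let ?B = "{b. int b - int L \<in> maya kap}"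
  define K where "K = card {i. - int L \<le> beta kap i}"
  have seg: "{i. - int L \<le> beta kap i} = {..<K}"
    unfolding K_def
  proof (rule initial_segment)
    show "finite {i. - int L \<le> beta kap i}"
    proof (rule finite_subset)
      show "{i. - int L \<le> beta kap i} \<subseteq> {..row kap 0 + L}"
      proof
        fix i assume "i \<in> {i. - int L \<le> beta kap i}"
        then show "i \<in> {..row kap 0 + L}" using row_antimono[OF part, of 0 i] by (simp add: beta_def)
      qed
    qed simp
    show "i \<in> {i. - int L \<le> beta kap i}" if "j \<in> {i. - int L \<le> beta kap i}" "i \<le> j" for i j
      using that beta_strict_antimono[OF part, of i j] by (cases "i = j") auto
  qed
  have tail: "beta kap (K + t) = - int L - 1 - int t" for t
  proof (induction t)
    case 0
    have "K \<notin> {i. - int L \<le> beta kap i}" unfolding seg by simp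
    then have "beta kap K < - int L" by simp
    moreover obtain j where j: "- int L - 1 = beta kap j" using small[of "- int L - 1"] by (auto simp: maya_def)
    moreover have "\<not> j < K"
    proof
      assume "j < K"
      then have "j \<in> {i. - int L \<le> beta kap i}" unfolding seg by simp
      then show False using j by simp
    qed
    ultimately show ?case using beta_strict_antimono[OF part, of K j] by (cases "j = K") auto
  next
    case (Suc t)
    obtain j where j: "- int L - 2 - int t = beta kap j"
      using small[of "- int L - 2 - int t"] by (auto simp: maya_def)
    then have "beta kap j < beta kap (K + t)" using Suc by simp
    then have "K + t < j" using beta_less_iff[OF part] by blast
    then show ?case
      using beta_strict_antimono[OF part, of "K + t" "K + Suc t"] beta_strict_antimono[OF part, of "K + Suc t" j] j Suc
      by (cases "j = K + Suc t") auto
  qed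
  \<comment> \<open>Beyond \<open>length kap\<close> the rows are empty and the i-th bead is at
    \<open>- i - 1\<close>; comparing with \<open>tail\<close> fixes the number of beads
    kept.\<close>
  have "K = L" using tail[of "length kap"] by (simp add: beta_def row_def)
  note seg = seg[unfolded this] and tail = tail[unfolded this]
  have "row kap L = 0" using tail[of 0] by (simp add: beta_def)
  then have len: "length kap \<le> L" using row_pos_iff[OF part, of L] by simp
  define f where "f i = nat (beta kap i + int L)" for i
  have f: "int (f i) = beta kap i + int L" if "i < L" for i
  proof -
    have "i \<in> {i. - int L \<le> beta kap i}" unfolding seg using that by simp
    then show ?thesis by (simp add: f_def)
  qed
  have B: "?B = f ` {..<L}"
  proof (intro set_eqI iffI)
    fix b assume "b \<in> ?B"
    then obtain i where i: "int b - int L = beta kap i" by (auto simp: maya_def)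
    then have "i \<in> {i. - int L \<le> beta kap i}" by auto
    then have "i < L" using seg by simp
    moreover have "b = f i" using f[OF \<open>i < L\<close>] i by linarith
    ultimately show "b \<in> f ` {..<L}" by blast
  next
    fix b assume "b \<in> f ` {..<L}"
    then show "b \<in> ?B" using f by auto
  qed
  have f_less: "f j < f i" if "i < j" "j < L" for i j
    using f[of i] f[of j] beta_strict_antimono[OF part that(1)] that by linarith
  have srt: "sorted_list_of_set ?B = rev (map f [0..<L])"
  proof -
    have "sorted_wrt (<) (rev (map f [0..<L]))"
      using f_less by (subst sorted_wrt_rev) (auto simp: sorted_wrt_iff_nth_less)
    moreover have "set (rev (map f [0..<L])) = ?B" using B by auto
    ultimately show ?thesis by (metis sorted_list_of_set.idem_if_sorted_distinct strict_sorted_iff)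
  qed
  have gaps: "card ({..<f i} - ?B) = row kap i" if "i < L" for i
  proof -
    have "{..<f i} \<inter> ?B = f ` {i<..<L}"
    proof (intro set_eqI iffI)
      fix b assume "b \<in> {..<f i} \<inter> ?B"
      then obtain j where j: "b = f j" "j < L" "f j < f i" using B by auto
      then have "i < j" using f_less[of j i] that by (metis less_asym less_irrefl linorder_neqE_nat)
      then show "b \<in> f ` {i<..<L}" using j by auto
    next
      fix b assume "b \<in> f ` {i<..<L}"
      then show "b \<in> {..<f i} \<inter> ?B" using f_less that unfolding B by auto
    qed
    moreover have "inj_on f {i<..<L}"
      using f_less by (intro inj_onI) (metis greaterThanLessThan_iff less_irrefl linorder_neqE_nat)
    ultimately have "card ({..<f i} \<inter> ?B) = L - Suc i" by (simp add: card_image)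
    then have "card ({..<f i} - ?B) = f i - (L - Suc i)" by (simp add: card_Diff_subset_Int)
    then show ?thesis using f[OF that] that by (simp add: beta_def)
  qed
  have "partition_of_beads ?B = filter (\<lambda>k. 0 < k) (map (\<lambda>b. card ({..<b} - ?B)) (map f [0..<L]))"
    unfolding partition_of_beads_def srt by simp
  also have "\<dots> = filter (\<lambda>k. 0 < k) (map (row kap) [0..<L])"
  proof -
    have "map (\<lambda>b. card ({..<b} - ?B)) (map f [0..<L]) = map (row kap) [0..<L]"
      unfolding map_map o_def by (rule map_cong[OF refl], rule gaps) simp
    then show ?thesis by (simp only:)
  qed
  also have "[0..<L] = [0..<length kap] @ [length kap..<L]" using len by (metis le_add_diff_inverse upt_add_eq_append zero_le)
  also have "filter (\<lambda>k. 0 < k) (map (row kap) \<dots>) = filter (\<lambda>k. 0 < k) (map (row kap) [0..<length kap])"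
    by (auto simp: row_def filter_empty_conv)
  also have "map (row kap) [0..<length kap] = kap"
    by (rule nth_equalityI) (auto simp: row_def)
  also have "filter (\<lambda>k. 0 < k) kap = kap"
    using part by (intro filter_True) (auto simp: is_partition_iff intro: gr0I)
  finally show ?thesis .
qed

text \<open>The shift by \<open>2 * length lam\<close> on the abacus is a shift by
  \<open>length lam\<close> on each runner.\<close>

lemma quot_eqI:
  assumes "is_partition kap" "runner e (maya lam) = maya kap" "0 \<le> e" "e \<le> 1"
  shows "partition_of_beads {b. 2 * b + nat e \<in> beta_set lam} = kap"
proof -
  let ?L = "length lam"
  have "int (2 * b + nat e) - 2 * int ?L = 2 * (int b - int ?L) + e" for b using assms(3) by simp
  then have "2 * b + nat e \<in> beta_set lam \<longleftrightarrow> int b - int ?L \<in> maya kap" for b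
    unfolding assms(2)[symmetric] beta_set_maya mem_runner mem_Collect_eq by metis
  then have "{b. 2 * b + nat e \<in> beta_set lam} = {b. int b - int ?L \<in> maya kap}" by blast
  moreover have "x \<in> maya kap" if "x < - int ?L" for x
    unfolding assms(2)[symmetric] mem_runner by (rule maya_small) (use that assms(4) in linarith)
  ultimately show ?thesis using partition_of_beads_maya[OF assms(1)] by simp
qed

section \<open>Partitions with empty 2-core and the bijectivity of the 2-quotient\<close>

lemma domino_not_removable_Nil: "\<not> removes_domino [] mu"
  by (auto simp: removes_domino_def is_domino_def diagram_row)

text \<open>Removing dominoes until nothing is left, read backwards, is a path of bead moves from
  the ground state.\<close>

lemma P0_iff: "lam \<in> P0 n \<longleftrightarrow> is_partition lam \<and> sum_list lam = 2 * n \<and> (\<exists>w. bead_path 2 w (maya lam))"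
proof -
  have 1: "\<exists>w. bead_path 2 w (maya lam)" if "removes_domino\<^sup>*\<^sup>* lam []" for lam
    using that
  proof (induction rule: converse_rtranclp_induct)
    case base
    have "bead_path 2 [] (maya [])" by simp
    then show ?case by blast
  next
    case (step lam mu)
    then obtain w where "bead_path 2 w (maya mu)" by blast
    moreover have "is_partition lam" "is_partition mu" "diagram mu \<subseteq> diagram lam" "is_domino (diagram lam - diagram mu)"
      using step(1) by (auto simp: removes_domino_def)
    note domino_step(1,2)[OF this]
    ultimately show ?case by (metis bead_path.snoc)
  qed
  have 2: "removes_domino\<^sup>*\<^sup>* lam []" if "bead_path 2 w M" "is_partition lam" "maya lam = M" for w M lam
    using that
  proof (induction arbitrary: lam rule: bead_path.induct)
    case Nil
    then have "lam = []" using maya_inject[OF Nil(1) is_partition_Nil] by simp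
    then show ?case by simp
  next
    case (snoc w M x)
    obtain mu where mu: "is_partition mu" "maya mu = M" using bead_path_partition_2[OF snoc(1)] by blast
    then obtain lam2 where "is_partition lam2" "maya lam2 = move 2 x M"
      and d: "diagram mu \<subseteq> diagram lam2" "is_domino (diagram lam2 - diagram mu)"
      using add_domino[OF mu(1), of x] snoc(2) by blast
    then have "lam2 = lam" using maya_inject snoc.prems by metis
    then have "removes_domino lam mu" using d mu(1) snoc.prems(1) by (simp add: removes_domino_def)
    then show ?case using snoc.IH[OF mu] by (meson converse_rtranclp_into_rtranclp)
  qed
  show ?thesis
    using 1 2 domino_not_removable_Nil by (auto simp: P0_def partitions_iff is_two_core_of_def)
qed

lemma P0_quotient:
  assumes "lam \<in> P0 n"
  shows "is_partition (quot_minus lam)" "is_partition (quot_plus lam)"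
    "runner 0 (maya lam) = maya (quot_minus lam)" "runner 1 (maya lam) = maya (quot_plus lam)"
    "sum_list (quot_minus lam) + sum_list (quot_plus lam) = n"
proof -
  from assms obtain w where lam: "is_partition lam" "sum_list lam = 2 * n" and w: "bead_path 2 w (maya lam)"
    by (auto simp: P0_iff)
  have "length w = n" using bead_path_partition_2[OF w] lam maya_inject by fastforce
  have *: "bead_path 1 (even_part w) (runner 0 (maya lam))" "bead_path 1 (odd_part w) (runner 1 (maya lam))"
    using w bead_path_interleave[of w "runner 0 (maya lam)" "runner 1 (maya lam)"] by simp_all
  obtain al where al: "is_partition al" "maya al = runner 0 (maya lam)" "sum_list al = length (even_part w)"
    using bead_path_partition_1[OF *(1)] by blast
  obtain be where be: "is_partition be" "maya be = runner 1 (maya lam)" "sum_list be = length (odd_part w)"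
    using bead_path_partition_1[OF *(2)] by blast
  have q: "quot_minus lam = al" "quot_plus lam = be"
    using quot_eqI[OF al(1) al(2)[symmetric]] quot_eqI[OF be(1) be(2)[symmetric]]
    by (simp_all add: quot_minus_def quot_plus_def)
  show "is_partition (quot_minus lam)" "is_partition (quot_plus lam)"
    "runner 0 (maya lam) = maya (quot_minus lam)" "runner 1 (maya lam) = maya (quot_plus lam)"
    using q al be by simp_all
  show "sum_list (quot_minus lam) + sum_list (quot_plus lam) = n"
    using q al(3) be(3) \<open>length w = n\<close> sum_length_filter_compl[of even w]
    by (simp add: even_part_def odd_part_def)
qed

text \<open>The tableau with content \<open>lam\<close> exists because the corresponding Schur
  coefficient is 1; its key list is a path.\<close>

lemma ex_bead_path: "is_partition lam \<Longrightarrow> \<exists>w. bead_path 1 w (maya lam)"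
proof -
  assume lam: "is_partition lam"
  have "{T \<in> SSYT lam. content lam T = row_monomial lam} \<noteq> {}"
    using schur_row_monomial_self[OF lam] by (metis (mono_tags) card.empty of_nat_0 schur_eq zero_neq_one)
  then show ?thesis using key_list_path[OF lam] by blast
qed

lemma bij_betw_quotient:
  "bij_betw (\<lambda>lam. (quot_minus lam, quot_plus lam)) (P0 n)
     {(al, be). is_partition al \<and> is_partition be \<and> sum_list al + sum_list be = n}"
proof (rule bij_betwI')
  fix lam mu assume l: "lam \<in> P0 n" and m: "mu \<in> P0 n"
  have "lam = mu" if "quot_minus lam = quot_minus mu" "quot_plus lam = quot_plus mu"
  proof -
    have "maya lam = maya mu"
      using P0_quotient(3,4)[OF l] P0_quotient(3,4)[OF m] that by (metis interleave_runner)
    moreover have "is_partition lam" "is_partition mu" using l m by (simp_all add: P0_iff)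
    ultimately show ?thesis using maya_inject by blast
  qed
  then show "((quot_minus lam, quot_plus lam) = (quot_minus mu, quot_plus mu)) = (lam = mu)" by auto
next
  fix lam assume "lam \<in> P0 n"
  then show "(quot_minus lam, quot_plus lam) \<in> {(al, be). is_partition al \<and> is_partition be \<and> sum_list al + sum_list be = n}"
    using P0_quotient by simp
next
  fix p assume "p \<in> {(al, be). is_partition al \<and> is_partition be \<and> sum_list al + sum_list be = n}"
  then obtain al be where p: "p = (al, be)" and ab: "is_partition al" "is_partition be" "sum_list al + sum_list be = n"
    by auto
  obtain u v where uv: "bead_path 1 u (maya al)" "bead_path 1 v (maya be)" using ex_bead_path ab by blast
  \<comment> \<open>Any shuffle of the two runner paths would serve; this one makes all moves on the
    even runner first.\<close>
  define w where "w = map (\<lambda>k. 2 * k) u @ map (\<lambda>k. 2 * k + 1) v"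
  have "even_part w = u" "odd_part w = v"
    by (simp_all add: w_def even_part_def odd_part_def filter_map o_def)
  then have w: "bead_path 2 w (interleave (maya al) (maya be))" using uv by (simp add: bead_path_interleave)
  obtain lam where lam: "is_partition lam" "maya lam = interleave (maya al) (maya be)" "sum_list lam = 2 * length w"
    using bead_path_partition_2[OF w] by blast
  have "lam \<in> P0 (length w)" unfolding P0_iff using lam w by auto
  note q = P0_quotient[OF this]
  have "quot_minus lam = al" "quot_plus lam = be"
    using q(1-4) lam(2) ab maya_inject by auto
  moreover from this have "length w = n" using q(5) ab(3) by simp
  ultimately show "\<exists>lam\<in>P0 n. p = (quot_minus lam, quot_plus lam)"
    using \<open>lam \<in> P0 (length w)\<close> p by blast
qed


section \<open>Signed permutations\<close>

definition signed_words :: "nat \<Rightarrow> int list set" where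
  "signed_words n = {w. length w = n \<and> abs ` set w = {1..int n}}"

lemma length_word [simp]: "length (word n p) = n"
  by (simp add: word_def)

lemma nth_word: "i < n \<Longrightarrow> word n p ! i = p (int i + 1)"
  by (simp add: word_def nth_upto add.commute)

lemma signed_perm_zero: "p \<in> signed_perms n \<Longrightarrow> p 0 = 0"
  by (auto simp: signed_perms_def) (metis add.inverse_neutral equal_neg_zero)

lemma signed_perm_inj: "p \<in> signed_perms n \<Longrightarrow> p x = p y \<longleftrightarrow> x = y"
  using permutes_inj by (fastforce simp: signed_perms_def inj_def)

lemma word_in_signed_words:
  assumes p: "p \<in> signed_perms n"
  shows "word n p \<in> signed_words n"
proof -
  have perm: "p permutes {- int n..int n}" and neg: "\<And>i. p (- i) = - p i"
    using p by (auto simp: signed_perms_def)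
  have "(\<lambda>i. \<bar>p i\<bar>) ` {1..int n} \<subseteq> {1..int n}"
  proof
    fix y assume "y \<in> (\<lambda>i. \<bar>p i\<bar>) ` {1..int n}"
    then obtain i where i: "1 \<le> i" "i \<le> int n" "y = \<bar>p i\<bar>" by auto
    then have "p i \<in> {- int n..int n}" using permutes_in_image[OF perm, of i] by simp
    moreover have "p i \<noteq> 0" using signed_perm_inj[OF p, of i 0] signed_perm_zero[OF p] i by simp
    ultimately show "y \<in> {1..int n}" using i(3) by auto
  qed
  moreover have "inj_on (\<lambda>i. \<bar>p i\<bar>) {1..int n}"
  proof (rule inj_onI)
    fix i j assume ij: "i \<in> {1..int n}" "j \<in> {1..int n}" "\<bar>p i\<bar> = \<bar>p j\<bar>"
    then have "p i = p j \<or> p i = p (- j)" using neg[of j] by (auto simp: abs_eq_iff)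
    then show "i = j" using signed_perm_inj[OF p] ij by auto
  qed
  ultimately have "(\<lambda>i. \<bar>p i\<bar>) ` {1..int n} = {1..int n}" by (intro endo_inj_surj) simp_all
  then show ?thesis by (simp add: signed_words_def word_def image_image)
qed

lemma inj_on_word: "inj_on (word n) (signed_perms n)"
proof (rule inj_onI)
  fix p q assume p: "p \<in> signed_perms n" and q: "q \<in> signed_perms n" and eq: "word n p = word n q"
  have pos: "p i = q i" if "1 \<le> i" "i \<le> int n" for i
    using eq that by (auto simp: word_def)
  show "p = q"
  proof
    fix i
    consider "1 \<le> i" "i \<le> int n" | "1 \<le> - i" "- i \<le> int n" | "i = 0" | "i \<notin> {- int n..int n}" by force
    then show "p i = q i"
    proof cases
      case 2
      then have "p (- i) = q (- i)" by (rule pos)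
      then show ?thesis using p q by (simp add: signed_perms_def)
    next
      case 4
      have "p permutes {- int n..int n}" "q permutes {- int n..int n}" using p q by (simp_all add: signed_perms_def)
      then show ?thesis using 4 by (metis permutes_not_in)
    qed (simp_all add: pos signed_perm_zero[OF p] signed_perm_zero[OF q])
  qed
qed

lemma word_surj:
  assumes w: "w \<in> signed_words n"
  shows "\<exists>p\<in>signed_perms n. word n p = w"
proof -
  have len: "length w = n" and abs: "abs ` set w = {1..int n}" using w by (auto simp: signed_words_def)
  have "distinct (map abs w)" by (rule card_distinct) (simp add: abs len)
  then have dist: "i = j" if "i < n" "j < n" "\<bar>w ! i\<bar> = \<bar>w ! j\<bar>" for i j
    using that len by (simp add: distinct_conv_nth) blast
  have rng: "\<bar>w ! i\<bar> \<in> {1..int n}" if "i < n" for i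
    unfolding abs[symmetric] using that len by simp
  define p where "p i = (if 1 \<le> i \<and> i \<le> int n then w ! nat (i - 1)
    else if 1 \<le> - i \<and> - i \<le> int n then - (w ! nat (- i - 1)) else i)" for i :: int
  have neg: "p (- i) = - p i" for i by (auto simp: p_def)
  have abs_p: "\<bar>p i\<bar> = \<bar>w ! nat (\<bar>i\<bar> - 1)\<bar>" if "i \<noteq> 0" "i \<in> {- int n..int n}" for i
    using that by (auto simp: p_def)
  have p0: "p 0 = 0" by (simp add: p_def)
  have p_rng: "\<bar>p i\<bar> \<in> {1..int n}" if "i \<noteq> 0" "i \<in> {- int n..int n}" for i
    unfolding abs_p[OF that] by (rule rng) (use that in auto)
  have zero: "i = 0" if "i \<in> {- int n..int n}" "p i = 0" for i
    using p_rng[OF _ that(1)] that(2) by (cases "i = 0") auto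
  have inj: "inj_on p {- int n..int n}"
  proof (rule inj_onI)
    fix i j assume i: "i \<in> {- int n..int n}" and j: "j \<in> {- int n..int n}" and eq: "p i = p j"
    show "i = j"
    proof (cases "i = 0 \<or> j = 0")
      case True
      then show ?thesis using zero[OF i] zero[OF j] eq p0 by auto
    next
      case False
      then have "\<bar>w ! nat (\<bar>i\<bar> - 1)\<bar> = \<bar>w ! nat (\<bar>j\<bar> - 1)\<bar>"
        using abs_p[OF _ i] abs_p[OF _ j] eq by simp
      then have "nat (\<bar>i\<bar> - 1) = nat (\<bar>j\<bar> - 1)" using dist[of "nat (\<bar>i\<bar> - 1)" "nat (\<bar>j\<bar> - 1)"] i j False by force
      then have "\<bar>i\<bar> = \<bar>j\<bar>" using False by linarith
      moreover have "i \<noteq> - j"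
      proof
        assume "i = - j"
        then have "p j = 0" using eq neg[of j] by simp
        then show False using p_rng[OF _ j] False by auto
      qed
      ultimately show ?thesis by (simp add: abs_eq_iff)
    qed
  qed
  have "p i \<in> {- int n..int n}" if "i \<in> {- int n..int n}" for i
    using p_rng[OF _ that] p0 by (cases "i = 0") auto
  then have "p ` {- int n..int n} = {- int n..int n}"
    by (intro endo_inj_surj inj image_subsetI) simp_all
  then have "p permutes {- int n..int n}"
    using inj by (intro bij_imp_permutes) (auto simp: bij_betw_def p_def)
  then have "p \<in> signed_perms n" using neg by (simp add: signed_perms_def)
  moreover have "word n p = w"
    by (rule nth_equalityI) (simp_all add: len nth_word p_def)
  ultimately show ?thesis by blast
qed

text \<open>Since \<open>p 0 = 0\<close>, the threshold is 0. Injectivity excludes ties, so strict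
  and weak descents agree.\<close>

lemma Des_word: "p \<in> signed_perms n \<Longrightarrow> Des n p = word_Des 0 (word n p)"
proof -
  assume p: "p \<in> signed_perms n"
  have "(0 # word n p) ! i = p (int i)" if "i \<le> n" for i
    using that signed_perm_zero[OF p] by (cases i) (simp_all add: nth_word add.commute)
  moreover have "p (int i + 1) \<noteq> p (int i)" for i using signed_perm_inj[OF p] by simp
  ultimately show ?thesis
    unfolding Des_def word_Des_def
    by (auto simp: nth_word order_le_less simp del: nth_Cons_Suc)
qed

text \<open>Positive letters move up, negative ones down, and 0 stays; so order and sign survive,
  and with them the threshold 0.\<close>

lemma strict_mono_shift_letter: "strict_mono (shift_letter n)"
  by (auto simp: strict_mono_def shift_letter_def sgn_if)

lemma shift_letter_pos_iff: "0 < shift_letter n x \<longleftrightarrow> 0 < x"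
  by (auto simp: shift_letter_def sgn_if)

lemma abs_shift_letter: "x \<noteq> 0 \<Longrightarrow> \<bar>shift_letter n x\<bar> = \<bar>x\<bar> + int n"
  by (simp add: shift_letter_def abs_mult abs_sgn_eq)

lemma set_word_bounds: "p \<in> signed_perms n \<Longrightarrow> x \<in> set (word n p) \<Longrightarrow> 1 \<le> \<bar>x\<bar> \<and> \<bar>x\<bar> \<le> int n"
proof -
  assume "p \<in> signed_perms n" "x \<in> set (word n p)"
  then have "\<bar>x\<bar> \<in> {1..int n}" using word_in_signed_words[of p n] by (auto simp: signed_words_def)
  then show ?thesis by simp
qed

text \<open>The absolute value of a letter tells which word it came from, so filtering undoes the
  shuffle. This is the form needed for \<open>words_series_shuffle\<close>.\<close>

lemma words_signed_shuffle_sets: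
  assumes A: "A \<subseteq> signed_perms n" and B: "B \<subseteq> signed_perms m"
  shows "word (n + m) ` signed_shuffle_sets n m A B =
    {w. filter (\<lambda>x. \<bar>x\<bar> \<le> int n) w \<in> word n ` A \<and>
        filter (\<lambda>x. \<not> \<bar>x\<bar> \<le> int n) w \<in> map (shift_letter n) ` word m ` B}"
proof -
  let ?X = "\<lambda>x. \<bar>x\<bar> \<le> int n"
  have u: "\<forall>x\<in>set (word n a). ?X x" if "a \<in> A" for a using set_word_bounds[of a n] A that by blast
  have v: "\<forall>x\<in>set (map (shift_letter n) (word m b)). \<not> ?X x" if "b \<in> B" for b
  proof
    fix x assume "x \<in> set (map (shift_letter n) (word m b))"
    then obtain y where y: "y \<in> set (word m b)" "x = shift_letter n y" by auto
    then have "1 \<le> \<bar>y\<bar>" using set_word_bounds[of b m y] B that by blast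
    then show "\<not> ?X x" using abs_shift_letter[of y n] y(2) by auto
  qed
  show ?thesis
  proof (intro set_eqI iffI)
    fix w assume "w \<in> word (n + m) ` signed_shuffle_sets n m A B"
    then obtain a b where ab: "a \<in> A" "b \<in> B" and w: "w \<in> shuffles (word n a) (map (shift_letter n) (word m b))"
      by (auto simp: signed_shuffle_sets_def signed_shuffle_def)
    have "filter P w \<in> shuffles (filter P (word n a)) (filter P (map (shift_letter n) (word m b)))" for P
      using w filter_shuffles by blast
    from this[of ?X] this[of "\<lambda>x. \<not> ?X x"]
    have "filter ?X w = word n a" "filter (\<lambda>x. \<not> ?X x) w = map (shift_letter n) (word m b)"
      using u[OF ab(1)] v[OF ab(2)] by simp_all
    then show "w \<in> {w. filter ?X w \<in> word n ` A \<and> filter (\<lambda>x. \<not> ?X x) w \<in> map (shift_letter n) ` word m ` B}"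
      using ab by simp
  next
    fix w assume "w \<in> {w. filter ?X w \<in> word n ` A \<and> filter (\<lambda>x. \<not> ?X x) w \<in> map (shift_letter n) ` word m ` B}"
    then obtain a b where ab: "a \<in> A" "b \<in> B" and w: "filter ?X w = word n a"
      "filter (\<lambda>x. \<not> ?X x) w = map (shift_letter n) (word m b)" by auto
    have sh: "w \<in> shuffles (word n a) (map (shift_letter n) (word m b))"
      using partition_in_shuffles[of w ?X] w by simp
    have wa: "abs ` set (word n a) = {1..int n}" and wb: "abs ` set (word m b) = {1..int m}"
      using word_in_signed_words A B ab by (auto simp: signed_words_def)
    have "abs ` set (map (shift_letter n) (word m b)) = (\<lambda>y. y + int n) ` abs ` set (word m b)"
      using set_word_bounds[of b m] B ab(2) by (force simp: image_image intro!: image_cong abs_shift_letter)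
    also have "\<dots> = {int n + 1..int n + int m}" unfolding wb by (simp add: add.commute)
    finally have "abs ` set w = {1..int n} \<union> {int n + 1..int n + int m}"
      using wa sh by (simp add: set_shuffles image_Un)
    also have "\<dots> = {1..int (n + m)}" by auto
    finally have "w \<in> signed_words (n + m)" using length_shuffles[OF sh] by (simp add: signed_words_def)
    then obtain p where "p \<in> signed_perms (n + m)" "word (n + m) p = w" using word_surj by blast
    then show "w \<in> word (n + m) ` signed_shuffle_sets n m A B"
      using sh ab unfolding signed_shuffle_sets_def signed_shuffle_def by blast
  qed
qed

lemma signed_shuffle_sets_subset: "signed_shuffle_sets n m A B \<subseteq> signed_perms (n + m)"
  by (auto simp: signed_shuffle_sets_def signed_shuffle_def)

lemma finite_signed_perms: "finite (signed_perms n)"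
  by (rule finite_subset[OF _ finite_permutations[of "{- int n..int n}"]]) (auto simp: signed_perms_def)

text \<open>The bijection of the class followed by \<open>tableau_word\<close> preserves descent
  sets while the threshold changes from 0 to -2.\<close>

lemma words_series_CB_class:
  assumes lam: "is_partition lam" "sum_list lam = 2 * n" and C: "is_CB_class n lam T C"
  shows "words_series (\<lambda>x. 0 < x) (word n ` C) = domino_series lam"
proof -
  from C obtain f where sub: "C \<subseteq> signed_perms n" and f: "bij_betw f C (SDT lam)"
    and des: "\<And>p. p \<in> C \<Longrightarrow> DesT n (f p) = Des n p"
    unfolding is_CB_class_def by blast
  have inj: "inj_on (word n) C" using inj_on_word sub by (rule inj_on_subset)
  then have "bij_betw (inv_into C (word n)) (word n ` C) C" by (simp add: bij_betw_inv_into inj_on_imp_bij_betw)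
  then have "bij_betw (tableau_word n \<circ> (f \<circ> inv_into C (word n))) (word n ` C) (paths 2 (maya lam))"
    using f tableau_word_bij[OF lam] by (intro bij_betw_trans)
  then show ?thesis
    unfolding domino_series_def
  proof (rule words_series_cong_Des)
    fix u assume "u \<in> word n ` C"
    then obtain p where p: "p \<in> C" "u = word n p" by blast
    have "f p \<in> SDT lam" using f p(1) by (auto simp: bij_betw_def)
    then have "word_Des (-2) (tableau_word n (f p)) = word_Des 0 u"
      using Des_tableau_word[OF lam] des[OF p(1)] Des_word sub p by auto
    then show "length ((tableau_word n \<circ> (f \<circ> inv_into C (word n))) u) = length u \<and>
        word_Des (-2) ((tableau_word n \<circ> (f \<circ> inv_into C (word n))) u) = word_Des 0 u"
      using p inj by (simp add: inv_into_f_f)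
  qed
qed

lemma words_series_signed_shuffle:
  assumes "lam \<in> P0 n" "mu \<in> P0 m" "is_CB_class n lam T CT" "is_CB_class m mu U CU"
  shows "words_series (\<lambda>x. 0 < x) (word (n + m) ` signed_shuffle_sets n m CT CU) =
    series_mult (domino_series lam) (domino_series mu)"
proof -
  have sub: "CT \<subseteq> signed_perms n" "CU \<subseteq> signed_perms m" using assms(3,4) by (simp_all add: is_CB_class_def)
  have "words_series (\<lambda>x. 0 < x) (word (n + m) ` signed_shuffle_sets n m CT CU) =
    series_mult (words_series (\<lambda>x. 0 < x) (word n ` CT)) (words_series (\<lambda>x. 0 < x) (map (shift_letter n) ` word m ` CU))"
    unfolding words_signed_shuffle_sets[OF sub]
  proof (rule words_series_shuffle)
    show "finite (word n ` CT)" "finite (map (shift_letter n) ` word m ` CU)"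
      using finite_signed_perms sub finite_subset by blast+
    show "\<forall>x\<in>set u. \<bar>x\<bar> \<le> int n" if "u \<in> word n ` CT" for u
      using that set_word_bounds sub(1) by blast
    show "\<forall>x\<in>set v. \<not> \<bar>x\<bar> \<le> int n" if "v \<in> map (shift_letter n) ` word m ` CU" for v
    proof
      fix x assume "x \<in> set v"
      then obtain b y where y: "b \<in> CU" "y \<in> set (word m b)" "x = shift_letter n y" using \<open>v \<in> _\<close> by auto
      then have "1 \<le> \<bar>y\<bar>" using set_word_bounds[of b m y] sub(2) by blast
      then show "\<not> \<bar>x\<bar> \<le> int n" using abs_shift_letter[of y n] y(3) by auto
    qed
  qed
  then show ?thesis
    unfolding words_series_map_strict_mono[OF strict_mono_shift_letter] shift_letter_pos_iff
    using words_series_CB_class[OF _ _ assms(3)] words_series_CB_class[OF _ _ assms(4)] assms(1,2)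
    by (simp add: P0_iff)
qed


section \<open>The product of two domino functions\<close>

lemma drop_zero_sum: "drop_zero (\<lambda>M. \<Sum>x\<in>A. c x * f x M) = (\<lambda>M. \<Sum>x\<in>A. c x * drop_zero (f x) M)"
  by (auto simp: drop_zero_def)

lemma finite_P0: "finite (P0 n)"
  by (rule finite_subset[OF _ finite_partitions[of "2 * n"]]) (auto simp: P0_def)

text \<open>Both products of Schur series, one for each component, are expanded separately; a pair
  of resulting partitions is the quotient of exactly one \<open>nu\<close>, which collects the terms
  into domino series.\<close>

lemma domino_series_mult:
  assumes lam: "lam \<in> P0 n" and mu: "mu \<in> P0 m"
  shows "series_mult (domino_series lam) (domino_series mu) M =
    (\<Sum>nu\<in>P0 (n + m). lr_coeff (quot_minus lam) (quot_minus mu) (quot_minus nu) *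
       lr_coeff (quot_plus lam) (quot_plus mu) (quot_plus nu) * domino_series nu M)"
proof -
  note l = P0_quotient[OF lam] and m = P0_quotient[OF mu]
  let ?c = "lr_coeff (quot_minus lam) (quot_minus mu)" and ?d = "lr_coeff (quot_plus lam) (quot_plus mu)"
  let ?P = "partitions (sum_list (quot_minus lam) + sum_list (quot_minus mu))"
  let ?Q = "partitions (sum_list (quot_plus lam) + sum_list (quot_plus mu))"
  let ?R = "{(al, be). is_partition al \<and> is_partition be \<and> sum_list al + sum_list be = n + m}"
  let ?h = "\<lambda>(al, be). ?c al * ?d be * series_mult (drop_zero (schur al)) (schur be) M"
  have bij: "bij_betw (\<lambda>nu. (quot_minus nu, quot_plus nu)) (P0 (n + m)) ?R" by (rule bij_betw_quotient)
  have "series_mult (domino_series lam) (domino_series mu) =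
    series_mult (drop_zero (series_mult (schur (quot_minus lam)) (schur (quot_minus mu))))
      (series_mult (schur (quot_plus lam)) (schur (quot_plus mu)))"
    unfolding domino_series_factor[OF l(1-4)] domino_series_factor[OF m(1-4)]
    by (subst series_mult_four) (simp only: series_mult_drop_zero)
  also have "\<dots> = (\<lambda>M. \<Sum>al\<in>?P. \<Sum>be\<in>?Q. ?c al * ?d be * series_mult (drop_zero (schur al)) (schur be) M)"
    unfolding lr_coeff_spec(2)[OF l(1) m(1)] lr_coeff_spec(2)[OF l(2) m(2)] drop_zero_sum
    by (rule series_mult_sums[OF finite_partitions finite_partitions])
  finally have "series_mult (domino_series lam) (domino_series mu) M = (\<Sum>p\<in>?P \<times> ?Q. ?h p)"
    by (simp add: sum.cartesian_product)
  \<comment> \<open>The coefficients vanish unless each component has the right size, so the sum may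
    run over all pairs of total size \<open>n + m\<close>, the range of the quotient map.\<close>
  also have "\<dots> = (\<Sum>p\<in>?R. ?h p)"
  proof (rule sum.mono_neutral_left)
    show "finite ?R" using bij finite_P0 bij_betw_finite by blast
    show "?P \<times> ?Q \<subseteq> ?R" using l(5) m(5) by (auto simp: partitions_iff)
    show "\<forall>p\<in>?R - ?P \<times> ?Q. ?h p = 0"
    proof
      fix p assume "p \<in> ?R - ?P \<times> ?Q"
      then obtain al be where p: "p = (al, be)" and "al \<notin> ?P \<or> be \<notin> ?Q" by blast
      then have "?c al = 0 \<or> ?d be = 0"
        using lr_coeff_spec(1)[OF l(1) m(1)] lr_coeff_spec(1)[OF l(2) m(2)] by blast
      then show "?h p = 0" by (auto simp: p)
    qed
  qed
  also have "\<dots> = (\<Sum>nu\<in>P0 (n + m). ?h (quot_minus nu, quot_plus nu))"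
    by (rule sum.reindex_bij_betw[OF bij, symmetric])
  also have "\<dots> = (\<Sum>nu\<in>P0 (n + m). ?c (quot_minus nu) * ?d (quot_plus nu) * domino_series nu M)"
    by (intro sum.cong refl) (simp add: domino_series_factor[OF P0_quotient(1-4)])
  finally show ?thesis .
qed

section \<open>From coefficients of series to numbers of tableaux and permutations\<close>

lemma card_Des_subset:
  assumes "finite X" "finite I"
  shows "card {x \<in> X. D x \<subseteq> I} = (\<Sum>J\<in>Pow I. card {x \<in> X. D x = J})"
proof -
  have "{x \<in> X. D x \<subseteq> I} = (\<Union>J\<in>Pow I. {x \<in> X. D x = J})" by auto
  also have "card \<dots> = (\<Sum>J\<in>Pow I. card {x \<in> X. D x = J})"
    using assms by (intro card_UN_disjoint) auto
  finally show ?thesis .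
qed

lemma finite_SDT:
  assumes "is_partition lam" "sum_list lam = 2 * n"
  shows "finite (SDT lam)"
proof -
  have "tableau_word n ` SDT lam \<subseteq> {w. bead_path 2 w (maya lam) \<and> length w = n}"
    using tableau_word_path[OF assms] by auto
  then have "finite (tableau_word n ` SDT lam)" by (rule finite_subset) (simp add: finite_bead_paths)
  then show ?thesis by (rule finite_imageD[OF _ bij_betw_imp_inj_on[OF tableau_word_bij[OF assms]]])
qed

lemma domino_series_eq_card:
  assumes lam: "is_partition lam" "sum_list lam = 2 * n" and M: "size M = n"
  shows "domino_series lam M = int (card {T \<in> SDT lam. DesT n T \<subseteq> cuts M})"
proof -
  have bij: "bij_betw (tableau_word n) (SDT lam) (paths 2 (maya lam))" by (rule tableau_word_bij[OF lam])
  have "tableau_word n ` {T \<in> SDT lam. DesT n T \<subseteq> cuts M} =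
    {w \<in> paths 2 (maya lam). length w = size M \<and> word_Des (-2) w \<subseteq> cuts M}"
    unfolding bij_betw_imp_surj_on[OF bij, symmetric] using Des_tableau_word[OF lam] M by auto
  then have "bij_betw (tableau_word n) {T \<in> SDT lam. DesT n T \<subseteq> cuts M}
      {w \<in> paths 2 (maya lam). length w = size M \<and> word_Des (-2) w \<subseteq> cuts M}"
    by (intro bij_betw_subset[OF bij]) auto
  then show ?thesis
    unfolding domino_series_def words_series_eq_card_Des by (simp add: bij_betw_same_card)
qed

lemma words_series_signed_eq_card:
  assumes S: "S \<subseteq> signed_perms n" and M: "size M = n"
  shows "words_series (\<lambda>x. 0 < x) (word n ` S) M = int (card {p \<in> S. Des n p \<subseteq> cuts M})"
proof -
  have "Des n p = word_Des 0 (word n p)" if "p \<in> S" for p using Des_word S that by blast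
  then have "word n ` {p \<in> S. Des n p \<subseteq> cuts M} =
    {w \<in> word n ` S. length w = size M \<and> word_Des 0 w \<subseteq> cuts M}"
    unfolding M by auto
  moreover have inj: "inj_on (word n) {p \<in> S. Des n p \<subseteq> cuts M}"
    by (rule inj_on_subset[OF inj_on_word]) (use S in auto)
  ultimately show ?thesis
    unfolding words_series_eq_card_Des using card_image[OF inj] by simp
qed

theorem theorem2:
  fixes n m :: nat and lam mu :: "nat list" and T U :: "nat \<times> nat \<Rightarrow> nat"
    and CT CU :: "(int \<Rightarrow> int) set" and I :: "nat set"
  assumes "lam \<in> P0 n" and "mu \<in> P0 m"
    and "T \<in> SDT lam" and "U \<in> SDT mu"
    and "is_CB_class n lam T CT" and "is_CB_class m mu U CU"
    and "I \<subseteq> {0} \<union> {1..n + m - 1}"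
  shows "(\<Sum>nu\<in>P0 (n + m).
            lr_coeff (quot_minus lam) (quot_minus mu) (quot_minus nu) *
            lr_coeff (quot_plus lam) (quot_plus mu) (quot_plus nu) *
            int (card (SDT nu \<inter> Delta_B (n + m) I)))
         = int (card (signed_shuffle_sets n m CT CU \<inter> D_B (n + m) I))"
proof -
  let ?N = "n + m" and ?S = "signed_shuffle_sets n m CT CU"
  define c where "c nu = lr_coeff (quot_minus lam) (quot_minus mu) (quot_minus nu) *
            lr_coeff (quot_plus lam) (quot_plus mu) (quot_plus nu)" for nu
  \<comment> \<open>\<open>f\<close> and \<open>g\<close> count by exact descent set. A coefficient
    gives the number of objects with descent set inside \<open>J\<close>, the sum over the subsets
    of \<open>J\<close>, from which exact counts are recovered.\<close>
  define f where "f J = (\<Sum>nu\<in>P0 ?N. c nu * int (card {V \<in> SDT nu. DesT ?N V = J}))" for J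
  define g where "g J = int (card {p \<in> ?S. Des ?N p = J})" for J
  have finS: "finite ?S" by (rule finite_subset[OF signed_shuffle_sets_subset finite_signed_perms])
  have P0: "is_partition nu" "sum_list nu = 2 * ?N" if "nu \<in> P0 ?N" for nu
    using that by (simp_all add: P0_iff)
  have sums: "(\<Sum>K\<in>Pow J. f K) = (\<Sum>K\<in>Pow J. g K)" if "J \<subseteq> {..<?N}" for J
  proof -
    \<comment> \<open>At this monomial the condition \<open>Des \<subseteq> cuts M\<close> becomes
      containment in the prescribed set \<open>J\<close>.\<close>
    obtain M where M: "size M = ?N" "cuts M = J" using ex_cuts[OF \<open>J \<subseteq> {..<?N}\<close>] by blast
    have finJ: "finite J" using that finite_subset by blast
    have "(\<Sum>K\<in>Pow J. f K) = (\<Sum>nu\<in>P0 ?N. c nu * (\<Sum>K\<in>Pow J. int (card {V \<in> SDT nu. DesT ?N V = K})))"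
      unfolding f_def by (subst sum.swap) (simp add: sum_distrib_left)
    also have "\<dots> = (\<Sum>nu\<in>P0 ?N. c nu * domino_series nu M)"
    proof (intro sum.cong refl)
      fix nu assume nu: "nu \<in> P0 ?N"
      show "c nu * (\<Sum>K\<in>Pow J. int (card {V \<in> SDT nu. DesT ?N V = K})) = c nu * domino_series nu M"
        unfolding domino_series_eq_card[OF P0[OF nu] M(1)] M(2)
          card_Des_subset[OF finite_SDT[OF P0[OF nu]] finJ] by simp
    qed
    also have "\<dots> = words_series (\<lambda>x. 0 < x) (word ?N ` ?S) M"
      unfolding words_series_signed_shuffle[OF assms(1,2,5,6)] domino_series_mult[OF assms(1,2)] c_def ..
    also have "\<dots> = (\<Sum>K\<in>Pow J. g K)"
      using finJ finS M words_series_signed_eq_card[OF signed_shuffle_sets_subset, of M n m CT CU]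
      by (simp add: g_def card_Des_subset)
    finally show ?thesis .
  qed
  have small: "f I = g I" if "I \<subseteq> {..<?N}"
  proof (rule eq_if_subset_sums_eq)
    show "finite I" using that by (rule finite_subset) simp
    show "(\<Sum>K\<in>Pow J. f K) = (\<Sum>K\<in>Pow J. g K)" if "J \<subseteq> I" for J
      using that \<open>I \<subseteq> {..<?N}\<close> by (intro sums) blast
  qed
  \<comment> \<open>Under the assumption on \<open>I\<close> this happens only for
    \<open>n + m = 0\<close> and \<open>I = {0}\<close>, where neither side has any object with that
    descent set.\<close>
  have large: "f I = g I" if "\<not> I \<subseteq> {..<?N}"
  proof -
    have "DesT ?N V \<noteq> I" "Des ?N p \<noteq> I" for V p using that by (auto simp: DesT_def Des_def)
    then show ?thesis by (simp add: f_def g_def)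
  qed
  have "SDT nu \<inter> Delta_B ?N I = {V \<in> SDT nu. DesT ?N V = I}" if "nu \<in> P0 ?N" for nu
    using that by (auto simp: Delta_B_def)
  then have "(\<Sum>nu\<in>P0 ?N. c nu * int (card (SDT nu \<inter> Delta_B ?N I))) = f I"
    unfolding f_def by (intro sum.cong refl) (simp only:)
  moreover have "?S \<inter> D_B ?N I = {p \<in> ?S. Des ?N p = I}"
    using signed_shuffle_sets_subset[of n m CT CU] by (auto simp: D_B_def)
  then have "int (card (?S \<inter> D_B ?N I)) = g I" by (simp only: g_def)
  moreover have "f I = g I" using small large by blast
  ultimately show ?thesis unfolding c_def by (simp only:)
qed

end
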